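(* Let $(M,J)$ be a compact complex manifold and let $g(t)$, $t\in[0,\tau)$, be a solution of the HCF on $M$. Then for every $q\in\mathbb{R}$ the condition $\widehat{\mathrm{sc}}\ge q$ on $M$ is preserved: if the second scalar curvature of $g(0)$ is $\ge q$ everywhere on $M$, then the second scalar curvature of $g(t)$ is $\ge q$ everywhere on $M$ for all $t\in(0,\tau)$. In particular, $\inf_M\widehat{\mathrm{sc}}$ is nondecreasing in $t$.
   Context: Einstein summation is used. Hermitian metric: a $J$-invariant Riemannian metric $g$, with components $g_{i\bar j}$ on $T^{1,0}M$ and inverse $g^{i\bar j}$. In holomorphic coordinates the torsion of the Chern connection is $T_{ij}^k=g^{k\bar l}(\partial_i g_{j\bar l}-\partial_j g_{i\bar l})$, with $T_{ij\bar l}=T_{ij}^kg_{k\bar l}$, $T_{\bar i\bar j l}=\overline{T_{ij\bar l}}$, and the Chern curvature is $\Omega_{i\bar jk\bar l}=-\partial_i\partial_{\bar j}g_{k\bar l}+g^{p\bar s}\partial_{\bar j}g_{p\bar l}\,\partial_ig_{k\bar s}$. The second scalar curvature is $\widehat{\mathrm{sc}}=g^{i\bar l}g^{k\bar j}\Omega_{i\bar jk\bar l}$. HCF: $\partial_t g_{i\bar j}=-S^{(2)}_{i\bar j}-Q_{i\bar j}$ for a smooth family of Hermitian metrics $g(t)$, where $S^{(2)}_{i\bar j}=g^{m\bar n}\Omega_{m\bar ni\bar j}$ and $Q_{i\bar j}=\frac12 g^{m\bar n}g^{p\bar s}T_{mp\bar j}T_{\bar n\bar s i}$. *)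

theory Defs
  imports "HOL-Analysis.Analysis"
begin

section \<open>Smooth and holomorphic maps\<close>

text \<open>
  Derivatives are taken within the set, so that the definition also covers sets such as
  \<open>[0,\<tau>) \<times> V\<close> with \<open>V\<close> open; there (and on open sets) they are unique,
  and at time \<open>0\<close> the time derivative is one-sided.
\<close>

primrec Ck_on :: "nat \<Rightarrow> 'a::real_normed_vector set \<Rightarrow> ('a \<Rightarrow> 'b::real_normed_vector) \<Rightarrow> bool" where
  "Ck_on 0 S f \<longleftrightarrow> continuous_on S f"
| "Ck_on (Suc k) S f \<longleftrightarrow>
     (\<exists>f'. (\<forall>x\<in>S. (f has_derivative f' x) (at x within S)) \<and> (\<forall>v. Ck_on k S (\<lambda>x. f' x v)))"

definition smooth_on :: "'a::real_normed_vector set \<Rightarrow> ('a \<Rightarrow> 'b::real_normed_vector) \<Rightarrow> bool" where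
  "smooth_on S f \<longleftrightarrow> (\<forall>k. Ck_on k S f)"

definition holomorphic_map_on :: "(complex^'n \<Rightarrow> complex^'m) \<Rightarrow> (complex^'n) set \<Rightarrow> bool" where
  "holomorphic_map_on f S \<longleftrightarrow>
     (\<forall>z\<in>S. \<exists>D. (f has_derivative D) (at z) \<and> (\<forall>a v. D (a *s v) = a *s D v))"

definition wirtinger :: "'n \<Rightarrow> (complex^'n \<Rightarrow> complex) \<Rightarrow> complex^'n \<Rightarrow> complex" where
  "wirtinger i f z =
     (frechet_derivative f (at z) (axis i 1) - \<i> * frechet_derivative f (at z) (axis i \<i>)) / 2"

definition wirtinger_bar :: "'n \<Rightarrow> (complex^'n \<Rightarrow> complex) \<Rightarrow> complex^'n \<Rightarrow> complex" where
  "wirtinger_bar i f z =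
     (frechet_derivative f (at z) (axis i 1) + \<i> * frechet_derivative f (at z) (axis i \<i>)) / 2"

section \<open>Complex manifolds\<close>

text \<open>
  The underlying space of the manifold is a whole type; a chart consists of its domain and its
  coordinate map. Coordinate maps are only meaningful on their domains.
\<close>

type_synonym ('a, 'n) chart = "'a set \<times> ('a \<Rightarrow> complex^'n)"

abbreviation chart_dom :: "('a, 'n) chart \<Rightarrow> 'a set" where
  "chart_dom c \<equiv> fst c"

abbreviation chart_coord :: "('a, 'n) chart \<Rightarrow> 'a \<Rightarrow> complex^'n" where
  "chart_coord c \<equiv> snd c"

abbreviation chart_inv :: "('a, 'n) chart \<Rightarrow> complex^'n \<Rightarrow> 'a" where
  "chart_inv c \<equiv> inv_into (chart_dom c) (chart_coord c)"

abbreviation chart_image :: "('a, 'n) chart \<Rightarrow> (complex^'n) set" where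
  "chart_image c \<equiv> chart_coord c ` chart_dom c"

abbreviation chart_change :: "('a, 'n) chart \<Rightarrow> ('a, 'n) chart \<Rightarrow> complex^'n \<Rightarrow> complex^'n" where
  "chart_change c d \<equiv> chart_coord d \<circ> chart_inv c"

definition is_chart :: "('a::topological_space, 'n::finite) chart \<Rightarrow> bool" where
  "is_chart c \<longleftrightarrow> open (chart_dom c) \<and> open (chart_image c) \<and>
     homeomorphism (chart_dom c) (chart_image c) (chart_coord c) (chart_inv c)"

definition complex_atlas :: "('a::topological_space, 'n::finite) chart set \<Rightarrow> bool" where
  "complex_atlas A \<longleftrightarrow>
     (\<forall>c\<in>A. is_chart c) \<and>
     (\<Union>c\<in>A. chart_dom c) = UNIV \<and>
     (\<forall>c\<in>A. \<forall>d\<in>A.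
        holomorphic_map_on (chart_change c d) (chart_coord c ` (chart_dom c \<inter> chart_dom d)))"

section \<open>Hermitian metrics\<close>

text \<open>
  A field of real bilinear forms on the real tangent bundle. In a chart \<open>c\<close> the tangent space at
  \<open>p\<close> is read as \<open>\<complex>\<^sup>n\<close>, regarded as a real vector space on which \<open>J\<close> is multiplication by
  \<open>\<i>\<close>; the value \<open>h c p u v\<close> is the form at \<open>p\<close> evaluated on the tangent vectors with
  components \<open>u\<close> and \<open>v\<close> with respect to \<open>c\<close>.
\<close>

type_synonym ('a, 'n) tensor2 =
  "('a, 'n) chart \<Rightarrow> 'a \<Rightarrow> complex^'n \<Rightarrow> complex^'n \<Rightarrow> real"

definition hermitian_metric ::
  "('a::topological_space, 'n::finite) chart set \<Rightarrow> ('a, 'n) tensor2 \<Rightarrow> bool" where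
  "hermitian_metric A h \<longleftrightarrow>
     (\<forall>c\<in>A. \<forall>p\<in>chart_dom c.
        bilinear (h c p) \<and>
        (\<forall>u v. h c p u v = h c p v u) \<and>
        (\<forall>v. v \<noteq> 0 \<longrightarrow> h c p v v > 0) \<and>
        (\<forall>u v. h c p (\<i> *s u) (\<i> *s v) = h c p u v)) \<and>
     (\<forall>c\<in>A. \<forall>d\<in>A. \<forall>p\<in>chart_dom c \<inter> chart_dom d. \<forall>u v.
        h c p u v =
          h d p (frechet_derivative (chart_change c d) (at (chart_coord c p)) u)
                (frechet_derivative (chart_change c d) (at (chart_coord c p)) v)) \<and>
     (\<forall>c\<in>A. \<forall>u v. smooth_on (chart_image c) (\<lambda>z. h c (chart_inv c z) u v))"

text \<open>
  The components \<open>g\<^bsub>i\<^esub>\<^bsub>j-bar\<^esub>\<close> at the point with coordinates \<open>z\<close>: the complex-bilinear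
  extension of the metric, evaluated on \<open>(e\<^sub>i - \<i> J e\<^sub>i)/2\<close> and \<open>(e\<^sub>j + \<i> J e\<^sub>j)/2\<close>.
\<close>

definition metric_comp ::
  "('a, 'n::finite) tensor2 \<Rightarrow> ('a, 'n) chart \<Rightarrow> 'n \<Rightarrow> 'n \<Rightarrow> complex^'n \<Rightarrow> complex" where
  "metric_comp h c i j z =
     (let B = h c (chart_inv c z) in
      (complex_of_real (B (axis i 1) (axis j 1)) + complex_of_real (B (axis i \<i>) (axis j \<i>))
       + \<i> * (complex_of_real (B (axis i 1) (axis j \<i>))
              - complex_of_real (B (axis i \<i>) (axis j 1)))) / 4)"

text \<open>The inverse \<open>g\<^bsup>i j-bar\<^esup>\<close>, normalised by \<open>\<Sum>j. g\<^bsup>i j-bar\<^esup> g\<^bsub>k j-bar\<^esub> = \<delta>\<^bsub>ik\<^esub>\<close>; hence the transpose.\<close>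

definition inv_comp ::
  "('a, 'n::finite) tensor2 \<Rightarrow> ('a, 'n) chart \<Rightarrow> 'n \<Rightarrow> 'n \<Rightarrow> complex^'n \<Rightarrow> complex" where
  "inv_comp h c i j z = transpose (matrix_inv (\<chi> k l. metric_comp h c k l z)) $ i $ j"

section \<open>Torsion and curvature of the Chern connection\<close>

definition torsion ::
  "('a, 'n::finite) tensor2 \<Rightarrow> ('a, 'n) chart \<Rightarrow> 'n \<Rightarrow> 'n \<Rightarrow> 'n \<Rightarrow> complex^'n \<Rightarrow> complex" where
  "torsion h c i j k z =
     (\<Sum>l\<in>UNIV. inv_comp h c k l z *
        (wirtinger i (metric_comp h c j l) z - wirtinger j (metric_comp h c i l) z))"

definition torsion_low ::
  "('a, 'n::finite) tensor2 \<Rightarrow> ('a, 'n) chart \<Rightarrow> 'n \<Rightarrow> 'n \<Rightarrow> 'n \<Rightarrow> complex^'n \<Rightarrow> complex" where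
  "torsion_low h c i j l z = (\<Sum>k\<in>UNIV. torsion h c i j k z * metric_comp h c k l z)"

text \<open>\<open>chern_curv h c i j k l\<close> is \<open>\<Omega>\<close> with indices \<open>i, j-bar, k, l-bar\<close>.\<close>

definition chern_curv ::
  "('a, 'n::finite) tensor2 \<Rightarrow> ('a, 'n) chart \<Rightarrow> 'n \<Rightarrow> 'n \<Rightarrow> 'n \<Rightarrow> 'n \<Rightarrow> complex^'n \<Rightarrow> complex" where
  "chern_curv h c i j k l z =
     - wirtinger i (wirtinger_bar j (metric_comp h c k l)) z
     + (\<Sum>p\<in>UNIV. \<Sum>s\<in>UNIV. inv_comp h c p s z *
          wirtinger_bar j (metric_comp h c p l) z * wirtinger i (metric_comp h c k s) z)"

definition S2_comp ::
  "('a, 'n::finite) tensor2 \<Rightarrow> ('a, 'n) chart \<Rightarrow> 'n \<Rightarrow> 'n \<Rightarrow> complex^'n \<Rightarrow> complex" where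
  "S2_comp h c i j z = (\<Sum>m\<in>UNIV. \<Sum>n\<in>UNIV. inv_comp h c m n z * chern_curv h c m n i j z)"

definition Q_comp ::
  "('a, 'n::finite) tensor2 \<Rightarrow> ('a, 'n) chart \<Rightarrow> 'n \<Rightarrow> 'n \<Rightarrow> complex^'n \<Rightarrow> complex" where
  "Q_comp h c i j z =
     (1/2) * (\<Sum>m\<in>UNIV. \<Sum>n\<in>UNIV. \<Sum>p\<in>UNIV. \<Sum>s\<in>UNIV.
        inv_comp h c m n z * inv_comp h c p s z *
        torsion_low h c m p j z * cnj (torsion_low h c n s i z))"

definition second_scalar_in_chart ::
  "('a, 'n::finite) tensor2 \<Rightarrow> ('a, 'n) chart \<Rightarrow> complex^'n \<Rightarrow> complex" where
  "second_scalar_in_chart h c z =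
     (\<Sum>i\<in>UNIV. \<Sum>j\<in>UNIV. \<Sum>k\<in>UNIV. \<Sum>l\<in>UNIV.
        inv_comp h c i l z * inv_comp h c k j z * chern_curv h c i j k l z)"

text \<open>
  For a Hermitian metric the full contraction of the tensor \<open>\<Omega>\<close> is real (as \<open>\<Omega>\<close> and \<open>g\<close> are
  Hermitian) and independent of the chart, so neither the real part nor the choice matters.
\<close>

definition second_scalar_curvature ::
  "('a, 'n::finite) chart set \<Rightarrow> ('a, 'n) tensor2 \<Rightarrow> 'a \<Rightarrow> real" where
  "second_scalar_curvature A h p =
     (let c = (SOME c. c \<in> A \<and> p \<in> chart_dom c)
      in Re (second_scalar_in_chart h c (chart_coord c p)))"

section \<open>The Hermitian curvature flow\<close>

text \<open>Solutions on \<open>[0,\<tau>)\<close>, where \<open>\<tau> = \<infinity>\<close> is allowed.\<close>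

definition time_interval :: "ereal \<Rightarrow> real set" where
  "time_interval \<tau> = {t. 0 \<le> t \<and> ereal t < \<tau>}"

definition smooth_metric_family ::
  "('a::topological_space, 'n::finite) chart set \<Rightarrow> ereal \<Rightarrow> (real \<Rightarrow> ('a, 'n) tensor2) \<Rightarrow> bool" where
  "smooth_metric_family A \<tau> g \<longleftrightarrow>
     (\<forall>t\<in>time_interval \<tau>. hermitian_metric A (g t)) \<and>
     (\<forall>c\<in>A. \<forall>u v. smooth_on (time_interval \<tau> \<times> chart_image c)
                      (\<lambda>(t, z). g t c (chart_inv c z) u v))"

definition HCF_solution ::
  "('a::topological_space, 'n::finite) chart set \<Rightarrow> ereal \<Rightarrow> (real \<Rightarrow> ('a, 'n) tensor2) \<Rightarrow> bool" where
  "HCF_solution A \<tau> g \<longleftrightarrow>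
     smooth_metric_family A \<tau> g \<and>
     (\<forall>t\<in>time_interval \<tau>. \<forall>c\<in>A. \<forall>z\<in>chart_image c. \<forall>i j.
        ((\<lambda>s. metric_comp (g s) c i j z) has_vector_derivative
           (- S2_comp (g t) c i j z - Q_comp (g t) c i j z)) (at t within time_interval \<tau>))"

end

theory Submission
  imports Defs "HOL-Complex_Analysis.Cauchy_Integral_Formula"
begin

text \<open>The proof rewrites the flow for the inverse metric \<open>h\<^bsup>i j-bar\<^esup>\<close> and applies the minimum
  principle to the second scalar curvature \<open>sc\<close>.

  Raising the indices of \<open>S\<^sup>(\<^sup>2\<^sup>)\<close> and \<open>Q\<close>, most quadratic terms cancel (\<open>raised_Om\<close>,
  \<open>raised_Q\<close>), and the flow becomes (\<open>flow_H\<close>)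

    \<open>\<partial>\<^sub>t h\<^bsup>i j-bar\<^esup> = h\<^bsup>m n-bar\<^esup> \<partial>\<^sub>m \<partial>-bar\<^sub>n h\<^bsup>i j-bar\<^esup> - \<partial>\<^sub>m h\<^bsup>i n-bar\<^esup> \<partial>-bar\<^sub>n h\<^bsup>m j-bar\<^esup>\<close>.

  In the same way \<open>sc = \<partial>\<^sub>i \<partial>-bar\<^sub>j h\<^bsup>i j-bar\<^esup> - |D|\<^sup>2\<close>, where \<open>D\<^bsup>j-bar\<^esup> = \<partial>\<^sub>i h\<^bsup>i j-bar\<^esup>\<close>
  is the divergence (\<open>sc_divergence\<close>). With the heat operator \<open>L = \<partial>\<^sub>t - h\<^bsup>m n-bar\<^esup> \<partial>\<^sub>m \<partial>-bar\<^sub>n\<close>,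
  a cancellation specific to this flow gives \<open>L D\<^bsup>j-bar\<^esup> = - \<partial>\<^sub>m D\<^bsup>n-bar\<^esup> \<partial>-bar\<^sub>n h\<^bsup>m j-bar\<^esup>\<close>, and the
  double divergence obeys a similar equation (\<open>dt_D\<close>, \<open>heat_DD\<close>). Fix a point \<open>x\<close> and subtract from
  \<open>D\<close> a multiple of \<open>h\<close> with constant coefficients such that the difference \<open>E\<close> vanishes at \<open>x\<close>; this
  replaces a choice of special holomorphic coordinates at \<open>x\<close>. Completing the square
  (\<open>sc_complete_square\<close>) one obtains at \<open>x\<close>

    \<open>L sc = |\<partial>E|\<^sup>2 + |\<partial>-bar E|\<^sup>2 - \<partial>\<^sub>m E\<^bsup>n-bar\<^esup> cnj (\<partial>\<^sub>n E\<^bsup>m-bar\<^esup>) \<ge> 0\<close>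

  (\<open>heat_Phi\<close>, \<open>sc_supersolution\<close>), because the last term pairs \<open>\<partial>E\<close> with its
  transpose and so is bounded by the first (\<open>contraction_le_norm\<close>). At a spatial minimum the
  second-order term is nonnegative (\<open>lap_nonneg_at_min\<close>), whence \<open>\<partial>\<^sub>t sc \<ge> 0\<close> there, and
  \<open>minimum_principle\<close> yields that lower bounds are preserved from any time on. Applied to the
  infimum at an earlier time this is the monotonicity.

  The minimum principle needs \<open>sc\<close> as one continuous function on \<open>[0,\<tau>) \<times> M\<close>, whereas it is given
  through an arbitrary chart at each point. Chart independence (\<open>scal_chart_independent\<close>) is the tensor
  character of the curvature under holomorphic changes of coordinates. As chart changes are only
  assumed complex differentiable, their Jacobians must first be shown to be holomorphic, which
  follows by differentiating Cauchy's formula (\<open>cholomorphic_on_ddir\<close>).\<close>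

section \<open>Calculus of smooth functions\<close>

lemma Ck_on_subset: "Ck_on k S f \<Longrightarrow> T \<subseteq> S \<Longrightarrow> Ck_on k T f"
proof (induction k arbitrary: f)
  case 0
  then show ?case by (auto intro: continuous_on_subset)
next
  case (Suc k)
  then obtain f' where f': "\<forall>x\<in>S. (f has_derivative f' x) (at x within S)" "\<forall>v. Ck_on k S (\<lambda>x. f' x v)"
    by auto
  with Suc show ?case
    by (auto intro!: exI[of _ f'] intro: has_derivative_subset)
qed

lemma Ck_on_SucD: "Ck_on (Suc k) S f \<Longrightarrow> Ck_on k S f"
proof (induction k arbitrary: f)
  case 0
  then show ?case
    by (auto simp: continuous_on_eq_continuous_within intro: has_derivative_continuous)
next
  case (Suc k)
  from Suc.prems obtain f' where "\<forall>x\<in>S. (f has_derivative f' x) (at x within S)"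
    "\<forall>v. Ck_on (Suc k) S (\<lambda>x. f' x v)"
    by auto
  with Suc.IH show ?case by (auto intro!: exI[of _ f'])
qed

lemma Ck_on_cong:
  assumes "\<And>x. x \<in> S \<Longrightarrow> f x = g x" "Ck_on k S f"
  shows "Ck_on k S g"
proof (cases k)
  case 0
  with assms show ?thesis by (simp cong: continuous_on_cong)
next
  case (Suc j)
  with assms(2) obtain f' where f': "\<forall>x\<in>S. (f has_derivative f' x) (at x within S)"
    "\<forall>v. Ck_on j S (\<lambda>x. f' x v)"
    by auto
  have "\<forall>x\<in>S. (g has_derivative f' x) (at x within S)"
    using f'(1) assms(1) by (metis has_derivative_transform)
  with f'(2) Suc show ?thesis by auto
qed

lemma Ck_on_const: "Ck_on k S (\<lambda>_. c)"
proof (induction k arbitrary: c)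
  case (Suc k)
  then show ?case by (auto intro!: exI[of _ "\<lambda>_ _. 0"])
qed simp

lemma Ck_on_add: "Ck_on k S f \<Longrightarrow> Ck_on k S g \<Longrightarrow> Ck_on k S (\<lambda>x. f x + g x)"
proof (induction k arbitrary: f g)
  case 0
  then show ?case by (auto intro: continuous_on_add)
next
  case (Suc k)
  then obtain f' g' where "\<forall>x\<in>S. (f has_derivative f' x) (at x within S)" "\<forall>v. Ck_on k S (\<lambda>x. f' x v)"
     "\<forall>x\<in>S. (g has_derivative g' x) (at x within S)" "\<forall>v. Ck_on k S (\<lambda>x. g' x v)"
    by auto
  with Suc show ?case
    by (auto intro!: exI[of _ "\<lambda>x v. f' x v + g' x v"] has_derivative_add)
qed

lemma Ck_on_bounded_linear:
  assumes "bounded_linear L"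
  shows "Ck_on k S f \<Longrightarrow> Ck_on k S (\<lambda>x. L (f x))"
proof (induction k arbitrary: f)
  case 0
  then show ?case using assms by (auto intro: bounded_linear.continuous_on)
next
  case (Suc k)
  then obtain f' where "\<forall>x\<in>S. (f has_derivative f' x) (at x within S)" "\<forall>v. Ck_on k S (\<lambda>x. f' x v)"
    by auto
  with Suc assms show ?case
    by (auto intro!: exI[of _ "\<lambda>x v. L (f' x v)"] bounded_linear.has_derivative[OF assms])
qed

lemma Ck_on_mult:
  fixes f g :: "'a::real_normed_vector \<Rightarrow> 'b::real_normed_algebra"
  shows "Ck_on k S f \<Longrightarrow> Ck_on k S g \<Longrightarrow> Ck_on k S (\<lambda>x. f x * g x)"
proof (induction k arbitrary: f g)
  case 0
  then show ?case by (auto intro: continuous_on_mult)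
next
  case (Suc k)
  then obtain f' g' where *: "\<forall>x\<in>S. (f has_derivative f' x) (at x within S)" "\<forall>v. Ck_on k S (\<lambda>x. f' x v)"
     "\<forall>x\<in>S. (g has_derivative g' x) (at x within S)" "\<forall>v. Ck_on k S (\<lambda>x. g' x v)"
    by auto
  have "Ck_on k S f" "Ck_on k S g" using Suc.prems by (blast intro: Ck_on_SucD)+
  with * Suc.IH show ?case
    by (auto intro!: exI[of _ "\<lambda>x v. f x * g' x v + f' x v * g x"] has_derivative_mult Ck_on_add)
qed

lemma Ck_on_inverse:
  fixes f :: "'a::real_normed_vector \<Rightarrow> 'b::real_normed_field"
  shows "Ck_on k S f \<Longrightarrow> (\<And>x. x \<in> S \<Longrightarrow> f x \<noteq> 0) \<Longrightarrow> Ck_on k S (\<lambda>x. inverse (f x))"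
proof (induction k arbitrary: f)
  case 0
  then show ?case by (auto intro: continuous_on_inverse)
next
  case (Suc k)
  then obtain f' where *: "\<forall>x\<in>S. (f has_derivative f' x) (at x within S)" "\<forall>v. Ck_on k S (\<lambda>x. f' x v)"
    by auto
  have k: "Ck_on k S (\<lambda>x. inverse (f x))"
    using Suc.IH[OF Ck_on_SucD[OF Suc.prems(1)]] Suc.prems(2) by blast
  have "((\<lambda>x. inverse (f x)) has_derivative (\<lambda>v. - 1 * (inverse (f x) * f' x v * inverse (f x)))) (at x within S)"
    if "x \<in> S" for x
    using Deriv.has_derivative_inverse[OF Suc.prems(2)[OF that] *(1)[rule_format, OF that]] by simp
  moreover have "Ck_on k S (\<lambda>x. - 1 * (inverse (f x) * f' x v * inverse (f x)))" for v
    by (intro Ck_on_mult k Ck_on_const *(2)[rule_format])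
  ultimately show ?case
    by (auto intro!: exI[of _ "\<lambda>x v. - 1 * (inverse (f x) * f' x v * inverse (f x))"])
qed

lemma smooth_on_subset: "smooth_on S f \<Longrightarrow> T \<subseteq> S \<Longrightarrow> smooth_on T f"
  by (auto simp: smooth_on_def intro: Ck_on_subset)

lemma smooth_on_cong: "(\<And>x. x \<in> S \<Longrightarrow> f x = g x) \<Longrightarrow> smooth_on S f \<Longrightarrow> smooth_on S g"
  unfolding smooth_on_def by (metis Ck_on_cong)

lemma smooth_on_const [intro, simp]: "smooth_on S (\<lambda>_. c)"
  by (auto simp: smooth_on_def intro: Ck_on_const)

lemma smooth_on_add: "smooth_on S f \<Longrightarrow> smooth_on S g \<Longrightarrow> smooth_on S (\<lambda>x. f x + g x)"
  by (auto simp: smooth_on_def intro: Ck_on_add)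

lemma smooth_on_bounded_linear: "bounded_linear L \<Longrightarrow> smooth_on S f \<Longrightarrow> smooth_on S (\<lambda>x. L (f x))"
  by (auto simp: smooth_on_def intro: Ck_on_bounded_linear)

lemma smooth_on_minus: "smooth_on S f \<Longrightarrow> smooth_on S (\<lambda>x. - f x)"
  using smooth_on_bounded_linear[OF bounded_linear_minus[OF bounded_linear_ident]] .

lemma smooth_on_diff: "smooth_on S f \<Longrightarrow> smooth_on S g \<Longrightarrow> smooth_on S (\<lambda>x. f x - g x)"
  using smooth_on_add[of S f "\<lambda>x. - g x"] smooth_on_minus[of S g] by simp

lemma smooth_on_cnj: "smooth_on S f \<Longrightarrow> smooth_on S (\<lambda>x. cnj (f x))"
  using smooth_on_bounded_linear[OF bounded_linear_cnj] .

lemma smooth_on_of_real: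
  fixes f :: "'a::real_normed_vector \<Rightarrow> real"
  shows "smooth_on S f \<Longrightarrow> smooth_on S (\<lambda>x. complex_of_real (f x))"
  using smooth_on_bounded_linear[OF bounded_linear_of_real] .

lemma smooth_on_mult:
  fixes f g :: "'a::real_normed_vector \<Rightarrow> 'b::real_normed_algebra"
  shows "smooth_on S f \<Longrightarrow> smooth_on S g \<Longrightarrow> smooth_on S (\<lambda>x. f x * g x)"
  by (auto simp: smooth_on_def intro: Ck_on_mult)

lemma smooth_on_divide:
  fixes f g :: "'a::real_normed_vector \<Rightarrow> 'b::real_normed_field"
  shows "smooth_on S f \<Longrightarrow> smooth_on S g \<Longrightarrow> (\<And>x. x \<in> S \<Longrightarrow> g x \<noteq> 0) \<Longrightarrow> smooth_on S (\<lambda>x. f x / g x)"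
  unfolding divide_inverse
  by (intro smooth_on_mult) (auto simp: smooth_on_def intro: Ck_on_inverse)

lemma smooth_on_sum: "(\<And>i. i \<in> I \<Longrightarrow> smooth_on S (f i)) \<Longrightarrow> smooth_on S (\<lambda>x. \<Sum>i\<in>I. f i x)"
  by (induction I rule: infinite_finite_induct) (auto intro: smooth_on_add)

lemma smooth_on_prod:
  fixes f :: "'i \<Rightarrow> 'a::real_normed_vector \<Rightarrow> 'b::real_normed_field"
  shows "(\<And>i. i \<in> I \<Longrightarrow> smooth_on S (f i)) \<Longrightarrow> smooth_on S (\<lambda>x. \<Prod>i\<in>I. f i x)"
  by (induction I rule: infinite_finite_induct) (auto intro: smooth_on_mult)

lemma smooth_on_imp_continuous_on: "smooth_on S f \<Longrightarrow> continuous_on S f"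
  unfolding smooth_on_def by (metis Ck_on.simps(1))

lemmas smooth_on_intros = smooth_on_add smooth_on_minus smooth_on_diff smooth_on_mult smooth_on_sum
  smooth_on_cnj smooth_on_of_real smooth_on_const

definition ddir :: "'a::real_normed_vector \<Rightarrow> ('a \<Rightarrow> 'b::real_normed_vector) \<Rightarrow> 'a \<Rightarrow> 'b" where
  "ddir v f x = frechet_derivative f (at x) v"

lemma has_derivative_imp_ddir: "(f has_derivative f') (at x) \<Longrightarrow> ddir v f x = f' v"
  unfolding ddir_def by (metis frechet_derivative_at)

lemma smooth_on_has_derivative:
  assumes "smooth_on S f" "open S" "x \<in> S"
  shows "(f has_derivative (\<lambda>v. ddir v f x)) (at x)"
proof -
  from assms(1) have "Ck_on (Suc 0) S f" unfolding smooth_on_def by blast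
  then obtain f' where "(f has_derivative f' x) (at x within S)"
    using assms(3) by auto
  then have *: "(f has_derivative f' x) (at x)" using assms by (metis at_within_open)
  moreover have "f' x = (\<lambda>v. ddir v f x)" using has_derivative_imp_ddir[OF *] by auto
  ultimately show ?thesis by simp
qed

lemma smooth_on_ddir:
  assumes "smooth_on S f" "open S"
  shows "smooth_on S (ddir v f)"
  unfolding smooth_on_def
proof
  fix k
  from assms(1) have "Ck_on (Suc k) S f" unfolding smooth_on_def by blast
  then obtain f' where f': "\<forall>x\<in>S. (f has_derivative f' x) (at x within S)" "Ck_on k S (\<lambda>x. f' x v)"
    by auto
  have "f' x v = ddir v f x" if "x \<in> S" for x
    using f'(1) assms(2) that by (metis at_within_open has_derivative_imp_ddir)
  with f'(2) show "Ck_on k S (ddir v f)" by (rule Ck_on_cong[rotated])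
qed

lemma ddir_cong:
  assumes "open S" "x \<in> S" "\<And>y. y \<in> S \<Longrightarrow> f y = g y"
  shows "ddir v f x = ddir v g x"
proof -
  have "(f has_derivative F) (at x) \<longleftrightarrow> (g has_derivative F) (at x)" for F
    using assms has_derivative_transform_within_open[OF _ assms(1,2)] by metis
  then show ?thesis unfolding ddir_def frechet_derivative_def by simp
qed

text \<open>The mean value theorem, applied once in each direction, turns the second difference of \<open>f\<close> over
  a small parallelogram into a nearby value of a mixed derivative. The second difference is
  symmetric in \<open>v\<close> and \<open>w\<close>, which forces the two mixed derivatives to agree in the limit
  \<open>s \<rightarrow> 0\<close>.\<close>

lemma second_difference_mvt:
  fixes f :: "'a::real_normed_vector \<Rightarrow> real"
  assumes f: "smooth_on S f" and S: "open S"
    and s: "0 < s" and box: "\<And>a b. a \<in> {0..s} \<Longrightarrow> b \<in> {0..s} \<Longrightarrow> x + a *\<^sub>R v + b *\<^sub>R w \<in> S"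
  shows "\<exists>a\<in>{0..s}. \<exists>b\<in>{0..s}. f (x + s *\<^sub>R v + s *\<^sub>R w) - f (x + s *\<^sub>R w) - f (x + s *\<^sub>R v) + f x
           = s * s * ddir w (ddir v f) (x + a *\<^sub>R v + b *\<^sub>R w)"
proof -
  have D: "(g has_derivative (\<lambda>v. ddir v g y)) (at y)" if "smooth_on S g" "y \<in> S" for g :: "'a \<Rightarrow> real" and y
    using smooth_on_has_derivative that S by blast
  let ?g = "\<lambda>a. f (x + a *\<^sub>R v + s *\<^sub>R w) - f (x + a *\<^sub>R v)"
  have lin: "ddir (r *\<^sub>R u) g y = r * ddir u g y" if "smooth_on S g" "y \<in> S" for g :: "'a \<Rightarrow> real" and y r u
    using linear_cmul[OF bounded_linear.linear[OF has_derivative_bounded_linear[OF D[OF that]]], of r u] by simp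
  have g: "(?g has_derivative (\<lambda>r. r * (ddir v f (x + a *\<^sub>R v + s *\<^sub>R w) - ddir v f (x + a *\<^sub>R v)))) (at a within {0..s})"
    if "a \<in> {0..s}" for a
  proof -
    have 1: "x + a *\<^sub>R v + s *\<^sub>R w \<in> S" "x + a *\<^sub>R v \<in> S"
      using box[of a s] box[of a 0] that s by auto
    show ?thesis
      by (rule derivative_eq_intros has_derivative_compose[OF _ D[OF f]] 1 refl)+
         (simp add: lin[OF f] 1 right_diff_distrib)
  qed
  obtain a where a: "a \<in> {0<..<s}" "?g s - ?g 0 = s * (ddir v f (x + a *\<^sub>R v + s *\<^sub>R w) - ddir v f (x + a *\<^sub>R v))"
    using mvt_simple[OF s, of ?g, OF g] by auto
  let ?h = "\<lambda>b. ddir v f (x + a *\<^sub>R v + b *\<^sub>R w)"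
  have sm: "smooth_on S (ddir v f)" using f S by (rule smooth_on_ddir)
  have h: "(?h has_derivative (\<lambda>r. r * ddir w (ddir v f) (x + a *\<^sub>R v + b *\<^sub>R w))) (at b within {0..s})"
    if "b \<in> {0..s}" for b
  proof -
    have 1: "x + a *\<^sub>R v + b *\<^sub>R w \<in> S"
      using box[of a b] that a s by auto
    have "((\<lambda>b. x + a *\<^sub>R v + b *\<^sub>R w) has_derivative (\<lambda>r. r *\<^sub>R w)) (at b within {0..s})"
      by (auto intro!: derivative_eq_intros)
    from has_derivative_compose[OF this D[OF sm 1]] show ?thesis
      by (simp add: lin[OF sm 1])
  qed
  obtain b where b: "b \<in> {0<..<s}" "?h s - ?h 0 = s * ddir w (ddir v f) (x + a *\<^sub>R v + b *\<^sub>R w)"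
    using mvt_simple[OF s, of ?h, OF h] by auto
  show ?thesis
    using a b by (intro bexI[of _ a] bexI[of _ b]) (auto simp: algebra_simps)
qed

lemma ddir_commute_real:
  fixes f :: "'a::real_normed_vector \<Rightarrow> real"
  assumes f: "smooth_on S f" and S: "open S" "x \<in> S"
  shows "ddir v (ddir w f) x = ddir w (ddir v f) x"
proof -
  obtain r where r: "r > 0" "ball x r \<subseteq> S" using S openE by blast
  define \<delta> where "\<delta> = r / (norm v + norm w + 1)"
  have pos: "norm v + norm w + 1 > 0" by (smt (verit) norm_ge_zero)
  then have "\<delta> > 0" using r unfolding \<delta>_def by simp
  have small: "norm (a *\<^sub>R v + b *\<^sub>R w) \<le> s * (norm v + norm w)" if "a \<in> {0..s}" "b \<in> {0..s}" for a b s
  proof -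
    have "norm (a *\<^sub>R v + b *\<^sub>R w) \<le> a * norm v + b * norm w"
      using norm_triangle_ineq[of "a *\<^sub>R v" "b *\<^sub>R w"] that by simp
    also have "\<dots> \<le> s * norm v + s * norm w"
      using that by (intro add_mono mult_right_mono) auto
    finally show ?thesis by (simp add: algebra_simps)
  qed
  have box: "x + a *\<^sub>R v + b *\<^sub>R w \<in> S" if "0 < s" "s < \<delta>" "a \<in> {0..s}" "b \<in> {0..s}" for a b s
  proof -
    have "norm (a *\<^sub>R v + b *\<^sub>R w) \<le> s * (norm v + norm w)" using small that by blast
    also have "\<dots> \<le> s * (norm v + norm w + 1)" using that by simp
    also have "\<dots> < r" using that pos unfolding \<delta>_def by (simp add: field_simps)
    finally have "norm (a *\<^sub>R v + b *\<^sub>R w) < r" .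
    moreover have "x + u \<in> ball x r" if "norm u < r" for u
      using that by (simp add: dist_norm)
    ultimately have "x + (a *\<^sub>R v + b *\<^sub>R w) \<in> ball x r" by blast
    then show ?thesis using r by (auto simp: add.assoc)
  qed
  have near: "\<exists>y z. norm (y - x) \<le> s * (norm v + norm w) \<and> norm (z - x) \<le> s * (norm v + norm w) \<and>
            ddir w (ddir v f) y = ddir v (ddir w f) z" if s: "0 < s" "s < \<delta>" for s
  proof -
    obtain a b where ab: "a \<in> {0..s}" "b \<in> {0..s}"
       "f (x + s *\<^sub>R v + s *\<^sub>R w) - f (x + s *\<^sub>R w) - f (x + s *\<^sub>R v) + f x
           = s * s * ddir w (ddir v f) (x + a *\<^sub>R v + b *\<^sub>R w)"
      using second_difference_mvt[OF f S(1) s(1) box[OF s]] by blast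
    have box': "x + a *\<^sub>R w + b *\<^sub>R v \<in> S" if "a \<in> {0..s}" "b \<in> {0..s}" for a b
      using box[OF s that(2,1)] by (simp add: algebra_simps)
    obtain c d where cd: "c \<in> {0..s}" "d \<in> {0..s}"
       "f (x + s *\<^sub>R w + s *\<^sub>R v) - f (x + s *\<^sub>R v) - f (x + s *\<^sub>R w) + f x
           = s * s * ddir v (ddir w f) (x + c *\<^sub>R w + d *\<^sub>R v)"
      using second_difference_mvt[OF f S(1) s(1) box'] by blast
    have "s * s * ddir w (ddir v f) (x + a *\<^sub>R v + b *\<^sub>R w) = s * s * ddir v (ddir w f) (x + c *\<^sub>R w + d *\<^sub>R v)"
      using ab(3) cd(3) by (simp add: algebra_simps)
    then have "ddir w (ddir v f) (x + a *\<^sub>R v + b *\<^sub>R w) = ddir v (ddir w f) (x + c *\<^sub>R w + d *\<^sub>R v)"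
      using s by simp
    then show ?thesis
      using small[OF ab(1,2)] small[OF cd(2,1)]
      by (intro exI[of _ "x + a *\<^sub>R v + b *\<^sub>R w"] exI[of _ "x + c *\<^sub>R w + d *\<^sub>R v"])
         (simp add: algebra_simps)
  qed
  have "\<forall>s. \<exists>p. 0 < s \<and> s < \<delta> \<longrightarrow> norm (fst p - x) \<le> s * (norm v + norm w) \<and>
            norm (snd p - x) \<le> s * (norm v + norm w) \<and>
            ddir w (ddir v f) (fst p) = ddir v (ddir w f) (snd p)"
    using near by fastforce
  then obtain p where p: "\<forall>s. 0 < s \<and> s < \<delta> \<longrightarrow> norm (fst (p s) - x) \<le> s * (norm v + norm w) \<and>
            norm (snd (p s) - x) \<le> s * (norm v + norm w) \<and>
            ddir w (ddir v f) (fst (p s)) = ddir v (ddir w f) (snd (p s))"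
    by (rule choice[THEN exE])
  define y z where "y s = fst (p s)" and "z s = snd (p s)" for s
  have yz: "\<And>s. 0 < s \<Longrightarrow> s < \<delta> \<Longrightarrow> norm (y s - x) \<le> s * (norm v + norm w)"
     "\<And>s. 0 < s \<Longrightarrow> s < \<delta> \<Longrightarrow> norm (z s - x) \<le> s * (norm v + norm w)"
     "\<And>s. 0 < s \<Longrightarrow> s < \<delta> \<Longrightarrow> ddir w (ddir v f) (y s) = ddir v (ddir w f) (z s)"
    using p unfolding y_def z_def by simp_all
  have ev: "eventually (\<lambda>s. 0 < s \<and> s < \<delta>) (at_right 0)"
    using \<open>\<delta> > 0\<close> by (intro eventually_at_rightI[of 0 \<delta>]) auto
  have lim0: "((\<lambda>s. s * (norm v + norm w)) \<longlongrightarrow> 0) (at_right 0)"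
    by (auto intro!: tendsto_eq_intros)
  have lim: "(u \<longlongrightarrow> x) (at_right 0)" if "\<And>s. 0 < s \<Longrightarrow> s < \<delta> \<Longrightarrow> norm (u s - x) \<le> s * (norm v + norm w)" for u
  proof -
    have "((\<lambda>s. u s - x) \<longlongrightarrow> 0) (at_right 0)"
      by (rule Lim_null_comparison[OF _ lim0]) (use ev that in \<open>auto elim: eventually_mono\<close>)
    then show ?thesis by (simp add: LIM_zero_iff)
  qed
  have c: "isCont (ddir w (ddir v f)) x" "isCont (ddir v (ddir w f)) x"
    using smooth_on_imp_continuous_on[OF smooth_on_ddir[OF smooth_on_ddir[OF f S(1)] S(1)]] S
    by (auto simp: continuous_on_eq_continuous_at)
  have 1: "((\<lambda>s. ddir w (ddir v f) (y s)) \<longlongrightarrow> ddir w (ddir v f) x) (at_right 0)"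
    using isCont_tendsto_compose[OF c(1) lim[OF yz(1)]] .
  have 2: "((\<lambda>s. ddir v (ddir w f) (z s)) \<longlongrightarrow> ddir v (ddir w f) x) (at_right 0)"
    using isCont_tendsto_compose[OF c(2) lim[OF yz(2)]] .
  have "((\<lambda>s. ddir v (ddir w f) (z s)) \<longlongrightarrow> ddir w (ddir v f) x) (at_right 0)"
    by (rule Lim_transform_eventually[OF 1]) (use ev yz(3) in \<open>auto elim: eventually_mono\<close>)
  with 2 show ?thesis by (rule tendsto_unique[rotated]) simp
qed

lemma ddir_bounded_linear:
  assumes "bounded_linear L" "smooth_on S f" "open S" "x \<in> S"
  shows "ddir v (\<lambda>x. L (f x)) x = L (ddir v f x)"
  using has_derivative_imp_ddir[OF bounded_linear.has_derivative[OF assms(1) smooth_on_has_derivative[OF assms(2-4)]]] .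

lemma ddir_commute:
  fixes f :: "'a::real_normed_vector \<Rightarrow> complex"
  assumes f: "smooth_on S f" and S: "open S" "x \<in> S"
  shows "ddir v (ddir w f) x = ddir w (ddir v f) x"
proof -
  have *: "L (ddir v (ddir w f) x) = ddir v (ddir w (\<lambda>x. L (f x))) x"
    if L: "bounded_linear L" for L :: "complex \<Rightarrow> real" and v w
  proof -
    have "ddir v (ddir w (\<lambda>x. L (f x))) x = ddir v (\<lambda>x. L (ddir w f x)) x"
      by (rule ddir_cong[OF S]) (rule ddir_bounded_linear[OF L f S(1)])
    then show ?thesis
      using ddir_bounded_linear[OF L smooth_on_ddir[OF f S(1)] S] by (rule trans[THEN sym])
  qed
  have "L (ddir v (ddir w f) x) = L (ddir w (ddir v f) x)" if L: "bounded_linear L" for L :: "complex \<Rightarrow> real"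
    unfolding *[OF L] using ddir_commute_real[OF smooth_on_bounded_linear[OF L f] S] .
  from this[OF bounded_linear_Re] this[OF bounded_linear_Im] show ?thesis
    by (rule complex_eqI)
qed

text \<open>Wirtinger derivatives and the time derivative are all of this form, so that the product rule and
  the commutation rule need to be proved only once.\<close>

definition cdir :: "complex \<Rightarrow> 'a::real_normed_vector \<Rightarrow> complex \<Rightarrow> 'a \<Rightarrow> ('a \<Rightarrow> complex) \<Rightarrow> 'a \<Rightarrow> complex" where
  "cdir a v b w f x = a * ddir v f x + b * ddir w f x"

lemma ddir_cdir:
  assumes "open S" "x \<in> S" "smooth_on S f"
  shows "ddir v (cdir a v' b w' f) x = a * ddir v (ddir v' f) x + b * ddir v (ddir w' f) x"
proof -
  have sm: "smooth_on S (ddir v f)" for v by (rule smooth_on_ddir[OF assms(3,1)])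
  show ?thesis
    unfolding cdir_def[abs_def]
    using has_derivative_imp_ddir[OF has_derivative_add[OF
        has_derivative_mult_right[OF smooth_on_has_derivative[OF sm assms(1,2)], of a v']
        has_derivative_mult_right[OF smooth_on_has_derivative[OF sm assms(1,2)], of b w']], of v] by simp
qed

context
  fixes S :: "'a::real_normed_vector set"
  assumes S: "open S"
begin

lemma smooth_on_cdir: "smooth_on S f \<Longrightarrow> smooth_on S (cdir a v b w f)"
  unfolding cdir_def[abs_def] by (intro smooth_on_intros smooth_on_ddir S)

lemma cdir_cong: "x \<in> S \<Longrightarrow> (\<And>y. y \<in> S \<Longrightarrow> f y = g y) \<Longrightarrow> cdir a v b w f x = cdir a v b w g x"
  unfolding cdir_def using ddir_cong[OF S, of x f g] by simp

lemma cdir_const [simp]: "cdir a v b w (\<lambda>_. c) x = 0"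
  by (simp add: cdir_def has_derivative_imp_ddir[OF has_derivative_const])

context
  fixes x
  assumes x: "x \<in> S"
begin

lemma cdir_add:
  assumes "smooth_on S f" "smooth_on S g"
  shows "cdir a v b w (\<lambda>x. f x + g x) x = cdir a v b w f x + cdir a v b w g x"
  using has_derivative_imp_ddir[OF has_derivative_add[OF assms[THEN smooth_on_has_derivative[OF _ S x]]]]
  by (simp add: cdir_def algebra_simps)

lemma cdir_minus:
  assumes "smooth_on S f"
  shows "cdir a v b w (\<lambda>x. - f x) x = - cdir a v b w f x"
  using has_derivative_imp_ddir[OF has_derivative_minus[OF assms[THEN smooth_on_has_derivative[OF _ S x]]]]
  by (simp add: cdir_def algebra_simps)

lemma cdir_diff:
  assumes "smooth_on S f" "smooth_on S g"
  shows "cdir a v b w (\<lambda>x. f x - g x) x = cdir a v b w f x - cdir a v b w g x"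
  using cdir_add[OF assms(1) smooth_on_minus[OF assms(2)]] cdir_minus[OF assms(2)] by simp

lemma cdir_mult:
  assumes "smooth_on S f" "smooth_on S g"
  shows "cdir a v b w (\<lambda>x. f x * g x) x = cdir a v b w f x * g x + f x * cdir a v b w g x"
  using has_derivative_imp_ddir[OF has_derivative_mult[OF assms[THEN smooth_on_has_derivative[OF _ S x]]]]
  by (simp add: cdir_def algebra_simps)

lemma cdir_sum:
  assumes "\<And>i. i \<in> I \<Longrightarrow> smooth_on S (f i)"
  shows "cdir a v b w (\<lambda>x. \<Sum>i\<in>I. f i x) x = (\<Sum>i\<in>I. cdir a v b w (f i) x)"
  using assms
proof (induction I rule: infinite_finite_induct)
  case (insert i I)
  have "cdir a v b w (\<lambda>x. \<Sum>i\<in>insert i I. f i x) x = cdir a v b w (\<lambda>x. f i x + (\<Sum>i\<in>I. f i x)) x"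
    using insert by simp
  also have "\<dots> = cdir a v b w (f i) x + cdir a v b w (\<lambda>x. \<Sum>i\<in>I. f i x) x"
    using insert by (intro cdir_add smooth_on_sum) auto
  finally show ?case using insert by simp
qed auto

lemma cdir_cnj:
  assumes "smooth_on S f"
  shows "cdir a v b w (\<lambda>x. cnj (f x)) x = cnj (cdir (cnj a) v (cnj b) w f x)"
  unfolding cdir_def
  by (simp add: ddir_bounded_linear[OF bounded_linear_cnj assms S x])

lemma cdir_commute:
  assumes "smooth_on S f"
  shows "cdir a v b w (cdir a' v' b' w' f) x = cdir a' v' b' w' (cdir a v b w f) x"
  unfolding cdir_def[of a v b w "cdir a' v' b' w' f"] cdir_def[of a' v' b' w' "cdir a v b w f"]
    ddir_cdir[OF S x assms]
  by (simp add: ddir_commute[OF assms S x] algebra_simps)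

end
end

section \<open>Positive definite Hermitian matrices\<close>

abbreviation index_sum :: "('n::finite \<Rightarrow> 'b::comm_monoid_add) \<Rightarrow> 'b" (binder "\<Sum>\<Sum>" 10) where
  "index_sum f \<equiv> sum f UNIV"

definition hermitian_pd :: "('n::finite \<Rightarrow> 'n \<Rightarrow> complex) \<Rightarrow> bool" where
  "hermitian_pd G \<longleftrightarrow> (\<forall>i j. cnj (G i j) = G j i) \<and>
     (\<forall>x. (\<exists>i. x i \<noteq> 0) \<longrightarrow> 0 < Re (\<Sum>\<Sum>i j. x i * cnj (x j) * G i j))"

lemma hermitian_pd_nonneg:
  assumes "hermitian_pd G"
  shows "0 \<le> Re (\<Sum>\<Sum>i j. x i * cnj (x j) * G i j)"
proof (cases "\<exists>i. x i \<noteq> 0")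
  case True
  with assms show ?thesis unfolding hermitian_pd_def by (auto intro: less_imp_le)
next
  case False
  then show ?thesis by simp
qed

lemma hermitian_pd_flip:
  assumes "hermitian_pd H"
  shows "hermitian_pd (\<lambda>i j. H j i)"
  unfolding hermitian_pd_def
proof (intro conjI allI impI)
  show "cnj (H j i) = H i j" for i j using assms unfolding hermitian_pd_def by blast
  fix x :: "'a \<Rightarrow> complex" assume "\<exists>i. x i \<noteq> 0"
  then have "\<exists>i. cnj (x i) \<noteq> 0" by simp
  then have "0 < Re (\<Sum>\<Sum>i j. cnj (x i) * cnj (cnj (x j)) * H i j)"
    using assms unfolding hermitian_pd_def by (auto dest: spec[of _ "\<lambda>i. cnj (x i)"])
  also have "(\<Sum>\<Sum>i j. cnj (x i) * cnj (cnj (x j)) * H i j) = (\<Sum>\<Sum>i j. x i * cnj (x j) * H j i)"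
    by (subst sum.swap) (simp add: mult_ac)
  finally show "0 < Re (\<Sum>\<Sum>i j. x i * cnj (x j) * H j i)" .
qed

text \<open>Cholesky factorisation, by eliminating one index at a time: the Schur complement of the diagonal
  entry at \<open>s\<close> is again positive definite. It writes a contraction with \<open>H\<close> as a sum of
  contractions with rank-one forms, which is how positivity of all contractions below is seen.\<close>

lemma hermitian_pd_factor_on:
  fixes H :: "'i \<Rightarrow> 'i \<Rightarrow> complex"
  assumes "finite S" "\<And>i j. cnj (H i j) = H j i"
    "\<And>x. \<exists>i\<in>S. x i \<noteq> 0 \<Longrightarrow> 0 < Re (\<Sum>i\<in>S. \<Sum>j\<in>S. x i * cnj (x j) * H i j)"
  shows "\<exists>v. \<forall>i\<in>S. \<forall>j\<in>S. H i j = (\<Sum>a\<in>S. v a i * cnj (v a j))"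
  using assms
proof (induction S arbitrary: H rule: finite_induct)
  case empty
  then show ?case by simp
next
  case (insert s S H)
  note herm = insert.prems(1)
  define r where "r = Re (H s s)"
  have Hss: "H s s = complex_of_real r"
    using herm[of s s] by (simp add: r_def complex_eq_iff)
  have "r > 0"
  proof -
    define e where "e i = (if i = s then 1 else 0 :: complex)" for i
    have e: "e s = 1" "\<And>i. i \<in> S \<Longrightarrow> e i = 0" using insert.hyps by (auto simp: e_def)
    have "0 < Re (\<Sum>i\<in>insert s S. \<Sum>j\<in>insert s S. e i * cnj (e j) * H i j)"
      by (rule insert.prems(2)) (simp add: e)
    also have "(\<Sum>i\<in>insert s S. \<Sum>j\<in>insert s S. e i * cnj (e j) * H i j) = H s s"
      using insert.hyps by (simp add: e cong: sum.cong)
    finally show ?thesis by (simp add: r_def)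
  qed
  define H' where "H' i j = H i j - H i s * H s j / of_real r" for i j
  have "\<exists>v. \<forall>i\<in>S. \<forall>j\<in>S. H' i j = (\<Sum>a\<in>S. v a i * cnj (v a j))"
  proof (rule insert.IH)
    show "cnj (H' i j) = H' j i" for i j
      by (simp add: H'_def herm mult.commute)
    fix x :: "'i \<Rightarrow> complex"
    assume x: "\<exists>i\<in>S. x i \<noteq> 0"
    define T where "T = (\<Sum>i\<in>S. x i * H i s)"
    have T': "(\<Sum>j\<in>S. cnj (x j) * H s j) = cnj T"
      by (simp add: T_def herm)
    \<comment> \<open>The value at \<open>s\<close> minimising the quadratic form, which then equals the Schur complement.\<close>
    define t where "t = - T / of_real r"
    define y where "y = x(s := t)"
    have y: "y i = x i" if "i \<in> S" for i using that insert.hyps by (auto simp: y_def)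
    have ys: "y s = t" by (simp add: y_def)
    have "0 < Re (\<Sum>i\<in>insert s S. \<Sum>j\<in>insert s S. y i * cnj (y j) * H i j)"
      by (rule insert.prems(2)) (use x y in auto)
    also have "(\<Sum>i\<in>insert s S. \<Sum>j\<in>insert s S. y i * cnj (y j) * H i j)
       = t * cnj t * H s s + (\<Sum>j\<in>S. t * cnj (x j) * H s j)
         + ((\<Sum>i\<in>S. x i * cnj t * H i s) + (\<Sum>i\<in>S. \<Sum>j\<in>S. x i * cnj (x j) * H i j))"
      using insert.hyps by (simp add: sum.distrib y ys cong: sum.cong)
    also have "(\<Sum>j\<in>S. t * cnj (x j) * H s j) = t * cnj T"
      unfolding T'[symmetric] by (simp add: sum_distrib_left mult.assoc)
    also have "(\<Sum>i\<in>S. x i * cnj t * H i s) = cnj t * T"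
      unfolding T_def by (simp add: sum_distrib_left mult_ac)
    also have "t * cnj t * H s s + t * cnj T + (cnj t * T + (\<Sum>i\<in>S. \<Sum>j\<in>S. x i * cnj (x j) * H i j))
       = (\<Sum>i\<in>S. \<Sum>j\<in>S. x i * cnj (x j) * H i j) - T * cnj T / of_real r"
      using \<open>r > 0\<close> unfolding Hss t_def by (simp add: field_simps)
    also have "T * cnj T / of_real r = (\<Sum>i\<in>S. \<Sum>j\<in>S. x i * cnj (x j) * (H i s * H s j / of_real r))"
      unfolding T'[symmetric] unfolding T_def sum_product sum_divide_distrib
      by (intro sum.cong refl) (simp add: mult_ac)
    finally show "0 < Re (\<Sum>i\<in>S. \<Sum>j\<in>S. x i * cnj (x j) * H' i j)"
      by (simp add: H'_def right_diff_distrib sum_subtractf)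
  qed
  then obtain v where v: "\<And>i j. i \<in> S \<Longrightarrow> j \<in> S \<Longrightarrow> H' i j = (\<Sum>a\<in>S. v a i * cnj (v a j))"
    by blast
  define w where "w a i = (if a = s then H i s / of_real (sqrt r) else if i = s then 0 else v a i)" for a i
  have sq: "complex_of_real (sqrt r) * complex_of_real (sqrt r) = of_real r"
    using \<open>r > 0\<close> by (simp flip: of_real_mult)
  have ws: "w s i * cnj (w s j) = H i s * H s j / of_real r" for i j
    using \<open>r > 0\<close> by (simp add: w_def herm flip: sq)
  have wS: "(\<Sum>a\<in>S. w a i * cnj (w a j)) = (if i = s \<or> j = s then 0 else \<Sum>a\<in>S. v a i * cnj (v a j))" for i j
    using insert.hyps by (auto simp: w_def intro!: sum.neutral sum.cong)
  have "H i j = (\<Sum>a\<in>insert s S. w a i * cnj (w a j))" if "i \<in> insert s S" "j \<in> insert s S" for i j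
    using that insert.hyps \<open>r > 0\<close> v[of i j]
    by (auto simp: ws wS Hss H'_def algebra_simps)
  then show ?case by blast
qed

lemma hermitian_pd_factor:
  fixes H :: "'n::finite \<Rightarrow> 'n \<Rightarrow> complex"
  assumes "hermitian_pd H"
  shows "\<exists>v :: 'n \<Rightarrow> 'n \<Rightarrow> complex. \<forall>i j. H i j = (\<Sum>a\<in>UNIV. v a i * cnj (v a j))"
proof -
  have "\<exists>v :: 'n \<Rightarrow> 'n \<Rightarrow> complex. \<forall>i\<in>UNIV. \<forall>j\<in>UNIV. H i j = (\<Sum>a\<in>UNIV. v a i * cnj (v a j))"
    by (rule hermitian_pd_factor_on) (use assms in \<open>simp_all add: hermitian_pd_def\<close>)
  then show ?thesis by simp
qed

lemma hermitian_pd_invertible: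
  fixes G :: "'n::finite \<Rightarrow> 'n \<Rightarrow> complex"
  assumes "hermitian_pd G"
  shows "invertible ((\<chi> k l. G k l) :: complex^'n^'n)"
proof -
  have "x = 0" if "(\<chi> k l. G k l) *v x = 0" for x :: "complex^'n"
  proof (rule ccontr)
    assume "x \<noteq> 0"
    then have "\<exists>i. cnj (x $ i) \<noteq> 0" by (auto simp: vec_eq_iff)
    then have "0 < Re (\<Sum>\<Sum>i j. cnj (x $ i) * cnj (cnj (x $ j)) * G i j)"
      using assms unfolding hermitian_pd_def by (auto dest: spec[of _ "\<lambda>i. cnj (x $ i)"])
    also have "(\<Sum>\<Sum>i j. cnj (x $ i) * cnj (cnj (x $ j)) * G i j)
         = (\<Sum>i\<in>UNIV. cnj (x $ i) * ((\<chi> k l. G k l) *v x) $ i)"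
      by (simp add: matrix_vector_mult_def sum_distrib_left mult_ac)
    also have "\<dots> = 0" using that by simp
    finally show False by simp
  qed
  then show ?thesis
    by (metis invertible_left_inverse matrix_left_invertible_ker)
qed

text \<open>The transpose matches the index convention of \<open>inv_comp\<close>, so that
  \<open>minv G i j\<close> is \<open>g\<^bsup>i j-bar\<^esup>\<close>.\<close>

definition minv :: "('n::finite \<Rightarrow> 'n \<Rightarrow> complex) \<Rightarrow> 'n \<Rightarrow> 'n \<Rightarrow> complex" where
  "minv G i j = matrix_inv (\<chi> k l. G k l) $ j $ i"

lemma matrix_inv_both:
  fixes M :: "'a::field^'n::finite^'n"
  assumes "invertible M"
  shows "M ** matrix_inv M = mat 1" "matrix_inv M ** M = mat 1"
proof -
  have "M ** matrix_inv M = mat 1 \<and> matrix_inv M ** M = mat 1"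
    using assms unfolding invertible_def matrix_inv_def by (rule someI_ex)
  then show "M ** matrix_inv M = mat 1" "matrix_inv M ** M = mat 1" by auto
qed

lemma minv_right:
  assumes "hermitian_pd G"
  shows "(\<Sum>j\<in>UNIV. minv G i j * G k j) = (if i = k then 1 else 0)"
  using arg_cong[OF matrix_inv_both(1)[OF hermitian_pd_invertible[OF assms]], of "\<lambda>M. M $ k $ i"]
  by (simp add: matrix_matrix_mult_def minv_def mat_def mult.commute eq_commute)

lemma minv_left:
  assumes "hermitian_pd G"
  shows "(\<Sum>i\<in>UNIV. minv G i j * G i l) = (if j = l then 1 else 0)"
  using arg_cong[OF matrix_inv_both(2)[OF hermitian_pd_invertible[OF assms]], of "\<lambda>M. M $ j $ l"]
  by (simp add: matrix_matrix_mult_def minv_def mat_def)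

lemma det_nonzero_pd: "hermitian_pd G \<Longrightarrow> det ((\<chi> k l. G k l) :: complex^'n::finite^'n) \<noteq> 0"
  using hermitian_pd_invertible invertible_det_nz by blast

lemma minv_cramer:
  fixes G :: "'n::finite \<Rightarrow> 'n \<Rightarrow> complex"
  assumes "hermitian_pd G"
  shows "minv G i j = det ((\<chi> k l. if l = j then (if k = i then 1 else 0) else G k l) :: complex^'n^'n)
     / det ((\<chi> k l. G k l) :: complex^'n^'n)"
proof -
  let ?A = "(\<chi> k l. G k l) :: complex^'n^'n"
  let ?x = "\<chi> j. matrix_inv ?A $ j $ i"
  let ?d = "(\<chi> k. if k = i then 1 else 0) :: complex^'n"
  have "?A *v ?x = ?d"
    using matrix_inv_both(1)[OF hermitian_pd_invertible[OF assms]]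
    by (auto simp: vec_eq_iff matrix_vector_mult_def matrix_matrix_mult_def mat_def)
  then have "?x = (\<chi> k. det (\<chi> i j. if j = k then ?d $ i else ?A $ i $ j) / det ?A)"
    using cramer[OF det_nonzero_pd[OF assms]] by blast
  from arg_cong[OF this, of "\<lambda>v. v $ j"] show ?thesis
    by (simp add: minv_def if_distrib cong: if_cong)
qed

lemma smooth_on_det:
  fixes F :: "'n::finite \<Rightarrow> 'n \<Rightarrow> 'a::real_normed_vector \<Rightarrow> complex"
  assumes "\<And>i j. smooth_on S (F i j)"
  shows "smooth_on S (\<lambda>x. det ((\<chi> i j. F i j x) :: complex^'n^'n))"
  unfolding det_def by (intro smooth_on_intros smooth_on_prod) (simp add: assms)

text \<open>By Cramer's rule the entries of the inverse are quotients of determinants.\<close>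

lemma smooth_on_minv:
  fixes G :: "'n::finite \<Rightarrow> 'n \<Rightarrow> 'a::real_normed_vector \<Rightarrow> complex"
  assumes "\<And>i j. smooth_on S (G i j)" "\<And>x. x \<in> S \<Longrightarrow> hermitian_pd (\<lambda>i j. G i j x)"
  shows "smooth_on S (\<lambda>x. minv (\<lambda>i j. G i j x) i j)"
proof (rule smooth_on_cong)
  let ?q = "\<lambda>x. det ((\<chi> k l. if l = j then (if k = i then 1 else 0) else G k l x) :: complex^'n^'n)
     / det ((\<chi> k l. G k l x) :: complex^'n^'n)"
  show "?q x = minv (\<lambda>i j. G i j x) i j" if "x \<in> S" for x
    using minv_cramer[OF assms(2)[OF that]] by simp
  have "smooth_on S (\<lambda>x. if l = j then (if k = i then 1 else 0) else G k l x)" for k l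
    using assms(1) by (cases "l = j") auto
  then show "smooth_on S ?q"
    by (intro smooth_on_divide smooth_on_det det_nonzero_pd assms)
qed

lemma sum_delta_mult:
  fixes f :: "'n::finite \<Rightarrow> complex"
  shows "(\<Sum>i\<in>UNIV. (if i = k then 1 else 0) * f i) = f k" "(\<Sum>i\<in>UNIV. (if k = i then 1 else 0) * f i) = f k"
   "(\<Sum>i\<in>UNIV. f i * (if i = k then 1 else 0)) = f k" "(\<Sum>i\<in>UNIV. f i * (if k = i then 1 else 0)) = f k"
  by (simp_all add: if_distrib if_distribR cong: if_cong)

lemma minv_hermitian:
  assumes G: "hermitian_pd G"
  shows "cnj (minv G i j) = minv G j i"
proof -
  have herm: "cnj (G i j) = G j i" for i j using G unfolding hermitian_pd_def by blast
  have 1: "(\<Sum>l\<in>UNIV. cnj (minv G i l) * G l k) = (if i = k then 1 else 0)" for k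
    using arg_cong[OF minv_right[OF G, of i k], of cnj] by (simp add: herm if_distrib cong: if_cong)
  have "cnj (minv G i j) = (\<Sum>l\<in>UNIV. cnj (minv G i l) * (\<Sum>k\<in>UNIV. minv G j k * G l k))"
    unfolding minv_right[OF G] by (simp add: sum_delta_mult)
  also have "\<dots> = (\<Sum>k\<in>UNIV. (\<Sum>l\<in>UNIV. cnj (minv G i l) * G l k) * minv G j k)"
    unfolding sum_distrib_left sum_distrib_right by (subst sum.swap) (simp add: mult_ac)
  also have "\<dots> = minv G j i" unfolding 1 by (simp add: sum_delta_mult)
  finally show ?thesis .
qed

lemma hermitian_pd_minv:
  assumes G: "hermitian_pd G"
  shows "hermitian_pd (minv G)"
  unfolding hermitian_pd_def
proof (intro conjI allI impI)
  show "cnj (minv G i j) = minv G j i" for i j using minv_hermitian[OF G] .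
  have herm: "cnj (G i j) = G j i" for i j using G unfolding hermitian_pd_def by blast
  fix x :: "'a \<Rightarrow> complex"
  assume x: "\<exists>i. x i \<noteq> 0"
  define y where "y j = (\<Sum>i\<in>UNIV. x i * minv G i j)" for j
  have xy: "x k = (\<Sum>j\<in>UNIV. G k j * y j)" for k
  proof -
    have "(\<Sum>j\<in>UNIV. G k j * y j) = (\<Sum>i\<in>UNIV. x i * (\<Sum>j\<in>UNIV. minv G i j * G k j))"
      unfolding y_def sum_distrib_left by (subst sum.swap) (simp add: mult_ac)
    then show ?thesis unfolding minv_right[OF G] by (simp add: sum_delta_mult)
  qed
  have "\<exists>i. cnj (y i) \<noteq> 0" by (rule ccontr) (use x xy in simp)
  then have "0 < Re (\<Sum>\<Sum>i j. cnj (y i) * cnj (cnj (y j)) * G i j)"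
    using G unfolding hermitian_pd_def by (auto dest: spec[of _ "\<lambda>i. cnj (y i)"])
  also have "(\<Sum>\<Sum>i j. cnj (y i) * cnj (cnj (y j)) * G i j) = (\<Sum>j\<in>UNIV. y j * cnj (x j))"
    unfolding xy by (subst sum.swap) (simp add: sum_distrib_left herm mult_ac)
  also have "\<dots> = (\<Sum>\<Sum>i j. x i * cnj (x j) * minv G i j)"
    unfolding y_def sum_distrib_right by (subst sum.swap) (simp add: mult_ac)
  finally show "0 < Re (\<Sum>\<Sum>i j. x i * cnj (x j) * minv G i j)" .
qed

text \<open>With \<open>H = \<Sum>\<^sub>a v\<^sub>a v\<^sub>a\<^sup>*\<close> the sum becomes \<open>\<Sum>\<^sub>a |v\<^sub>a K|\<^sup>2\<close> in the norm of \<open>G\<close>.\<close>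

lemma hermitian_pd_tensor_nonneg:
  assumes H: "hermitian_pd H" and G: "hermitian_pd G"
  shows "0 \<le> Re (\<Sum>\<Sum>m n p l. H m n * G p l * K m l * cnj (K n p))"
proof -
  from hermitian_pd_factor[OF H] obtain v :: "'a \<Rightarrow> 'a \<Rightarrow> complex"
    where v: "\<forall>i j. H i j = (\<Sum>a\<in>UNIV. v a i * cnj (v a j))" ..
  define y where "y a l = (\<Sum>m\<in>UNIV. v a m * K m l)" for a l
  have "(\<Sum>\<Sum>m n p l. H m n * G p l * K m l * cnj (K n p))
     = (\<Sum>\<Sum>m n p l a. cnj (v a n * K n p) * (v a m * K m l) * G p l)"
    unfolding v[rule_format] sum_distrib_right by (simp add: mult_ac)
  also have "\<dots> = (\<Sum>\<Sum>a p l m n. cnj (v a n * K n p) * (v a m * K m l) * G p l)"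
    (is "(\<Sum>\<Sum>m n p l a. ?f m n p l a) = _")
    unfolding sum.cartesian_product
    by (rule sum.reindex_bij_witness[where i="\<lambda>(a,p,l,m,n). (m,n,p,l,a)" and j="\<lambda>(m,n,p,l,a). (a,p,l,m,n)"]) auto
  also have "\<dots> = (\<Sum>\<Sum>a p l. cnj (y a p) * cnj (cnj (y a l)) * G p l)"
    unfolding y_def by (simp add: sum_distrib_left sum_distrib_right)
  finally have *: "(\<Sum>\<Sum>m n p l. H m n * G p l * K m l * cnj (K n p))
     = (\<Sum>\<Sum>a p l. cnj (y a p) * cnj (cnj (y a l)) * G p l)" .
  show ?thesis unfolding * Re_sum[of "\<lambda>a. \<Sum>\<Sum>p l. cnj (y a p) * cnj (cnj (y a l)) * G p l"]
    by (intro sum_nonneg hermitian_pd_nonneg[OF G])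
qed

lemma trace_transpose: "trace (transpose A) = trace A"
  by (simp add: trace_def transpose_def)

lemma matrix_sub_ldistrib': "A ** (B - C) = A ** B - A ** (C::'a::comm_ring_1^'n::finite^'m::finite)"
  for A :: "'a::comm_ring_1^'m::finite^'k::finite"
  by (vector matrix_matrix_mult_def sum_subtractf[symmetric] field_simps)

lemma matrix_sub_rdistrib': "(B - C) ** A = B ** A - C ** A"
  for A :: "'a::comm_ring_1^'m::finite^'k::finite"
  by (vector matrix_matrix_mult_def sum_subtractf[symmetric] field_simps)

lemma matrix_add_rdistrib': "(B + C) ** A = B ** A + C ** A"
  for A :: "'a::comm_ring_1^'m::finite^'k::finite"
  by (vector matrix_matrix_mult_def sum.distrib[symmetric] field_simps)

lemma matrix_neg_left: "(- A) ** B = - (A ** B)"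
  for A :: "'a::comm_ring_1^'m::finite^'k::finite"
  by (vector matrix_matrix_mult_def sum_negf[symmetric])

lemma matrix_neg_right: "A ** (- B) = - (A ** B)"
  for A :: "'a::comm_ring_1^'m::finite^'k::finite"
  by (vector matrix_matrix_mult_def sum_negf[symmetric])

lemma matrix_inv_unique:
  fixes A :: "'a::field^'n::finite^'n"
  assumes "A ** B = mat 1"
  shows "matrix_inv A = B"
proof -
  have "invertible A" using assms matrix_left_right_inverse unfolding invertible_def by metis
  then have "matrix_inv A ** (A ** B) = B" by (simp add: matrix_mul_assoc matrix_inv_both)
  with assms show ?thesis by simp
qed

lemma sandwich_nth:
  "(transpose A ** X ** B) $ k $ l = (\<Sum>\<Sum>a b. A $ a $ k * B $ b $ l * X $ a $ b)"
  for A B X :: "complex^'n::finite^'n"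
proof -
  have "(transpose A ** X ** B) $ k $ l = (\<Sum>\<Sum>b a. A $ a $ k * B $ b $ l * X $ a $ b)"
    by (simp add: matrix_matrix_mult_def transpose_def sum_distrib_left sum_distrib_right mult_ac)
  then show ?thesis by (subst sum.swap)
qed

text \<open>In a unitary frame this is \<open>Re (\<Sum> M\<^sub>m\<^sub>n cnj M\<^sub>n\<^sub>m) \<le> \<Sum> |M\<^sub>m\<^sub>n|\<^sup>2\<close>, the difference being
  \<open>\<Sum> |M\<^sub>m\<^sub>n - M\<^sub>n\<^sub>m|\<^sup>2 / 2\<close>. Without choosing a frame, the transpose of \<open>M\<close> is \<open>G M\<^sup>T H\<close>, an
  isometry for the Hermitian form \<open>\<Psi>\<close> on the right-hand side, and
  \<open>\<Psi> (M - G M\<^sup>T H) = 2 \<Psi> M - 2 Re (tr (M cnj M))\<close>.\<close>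

lemma contraction_le_norm:
  fixes G :: "'n::finite \<Rightarrow> 'n \<Rightarrow> complex"
  assumes G: "hermitian_pd G" and H_def: "H = minv G"
  shows "Re (\<Sum>\<Sum>m n. M m n * cnj (M n m))
     \<le> Re (\<Sum>\<Sum>m n p l. H m n * G p l * M m l * cnj (M n p))"
proof -
  let ?mat = "\<lambda>X. (\<chi> i j. X i j) :: complex^'n^'n"
  define g h m mb where "g = ?mat G" "h = ?mat H" "m = ?mat M" "mb = ?mat (\<lambda>i j. cnj (M i j))"
  define N where "N i j = (m - g ** transpose m ** h) $ i $ j" for i j
  have H: "hermitian_pd H" using hermitian_pd_minv[OF G] H_def by simp
  have herm: "cnj (G i j) = G j i" "cnj (H i j) = H j i" for i j
    using G H unfolding hermitian_pd_def by blast+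
  have r: "h ** transpose g = mat 1"
    using minv_right[OF G] by (simp add: g_h_m_mb_def H_def matrix_matrix_mult_def mat_def transpose_def vec_eq_iff)
  have l: "transpose h ** g = mat 1"
    using minv_left[OF G] by (simp add: g_h_m_mb_def H_def matrix_matrix_mult_def mat_def transpose_def vec_eq_iff)
  have r': "g ** transpose h = mat 1" using arg_cong[OF r, of transpose] by (simp add: matrix_transpose_mul)
  have l': "transpose g ** h = mat 1" using arg_cong[OF l, of transpose] by (simp add: matrix_transpose_mul)
  have tr: "(\<Sum>\<Sum>m n p l. H m n * G p l * X m l * cnj (X n p))
     = trace (?mat X ** transpose g ** transpose (?mat (\<lambda>i j. cnj (X i j))) ** transpose h)" for X
  proof -
    have "trace (?mat X ** transpose g ** transpose (?mat (\<lambda>i j. cnj (X i j))) ** transpose h)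
      = (\<Sum>\<Sum>m n p l. X m l * G p l * cnj (X n p) * H m n)"
      by (simp add: trace_def matrix_matrix_mult_def transpose_def g_h_m_mb_def sum_distrib_right)
    then show ?thesis by (simp add: mult_ac)
  qed
  have N: "?mat N = m - g ** transpose m ** h"
    by (simp add: N_def vec_eq_iff)
  have N': "transpose (?mat (\<lambda>i j. cnj (N i j))) = transpose mb - h ** mb ** g"
  proof -
    have "cnj (N j i) = mb $ j $ i - (h ** mb ** g) $ i $ j" for i j
      unfolding N_def
      by (simp add: g_h_m_mb_def matrix_matrix_mult_def transpose_def herm sum_distrib_left sum_distrib_right)
         (subst sum.swap, simp add: mult_ac)
    then show ?thesis by (simp add: vec_eq_iff transpose_def)
  qed
  note assoc = matrix_mul_assoc[symmetric]
  have t1: "trace (m ** transpose g ** (h ** mb ** g) ** transpose h) = trace (m ** mb)"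
    by (metis assoc r' l' matrix_mul_rid matrix_mul_lid)
  have t2: "trace (g ** transpose m ** h ** transpose g ** transpose mb ** transpose h) = trace (m ** mb)"
  proof -
    have "trace (g ** transpose m ** h ** transpose g ** transpose mb ** transpose h)
      = trace (g ** (transpose m ** transpose mb ** transpose h))"
      by (metis assoc r matrix_mul_lid)
    also have "\<dots> = trace (transpose m ** transpose mb ** (transpose h ** g))"
      by (subst trace_mul_sym) (simp add: assoc)
    also have "\<dots> = trace (transpose (mb ** m))" by (simp add: l matrix_transpose_mul)
    also have "\<dots> = trace (m ** mb)" by (simp only: trace_transpose trace_mul_sym[of mb m])
    finally show ?thesis .
  qed
  have t3: "trace (g ** transpose m ** h ** transpose g ** (h ** mb ** g) ** transpose h)
      = trace (m ** transpose g ** transpose mb ** transpose h)"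
  proof -
    have "trace (g ** transpose m ** h ** transpose g ** (h ** mb ** g) ** transpose h) = trace (g ** transpose m ** h ** mb)"
      by (metis assoc r r' matrix_mul_lid matrix_mul_rid)
    also have "\<dots> = trace (transpose (g ** transpose m ** h ** mb))" by (simp only: trace_transpose)
    also have "\<dots> = trace ((transpose mb ** transpose h) ** (m ** transpose g))"
      by (simp add: matrix_transpose_mul assoc)
    also have "\<dots> = trace (m ** transpose g ** transpose mb ** transpose h)"
      by (subst trace_mul_sym) (simp add: assoc)
    finally show ?thesis .
  qed
  have "0 \<le> Re (trace (?mat N ** transpose g ** transpose (?mat (\<lambda>i j. cnj (N i j))) ** transpose h))"
    using hermitian_pd_tensor_nonneg[OF H G, of N] unfolding tr .
  also have "trace (?mat N ** transpose g ** transpose (?mat (\<lambda>i j. cnj (N i j))) ** transpose h)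
     = 2 * trace (m ** transpose g ** transpose mb ** transpose h) - 2 * trace (m ** mb)"
    unfolding N N' matrix_sub_ldistrib' matrix_sub_rdistrib' trace_sub
    unfolding t1 t2 t3 by simp
  finally have "Re (trace (m ** mb)) \<le> Re (trace (m ** transpose g ** transpose mb ** transpose h))"
    by simp
  moreover have "(\<Sum>\<Sum>m n. M m n * cnj (M n m)) = trace (m ** mb)"
    by (simp add: trace_def matrix_matrix_mult_def g_h_m_mb_def)
  ultimately show ?thesis unfolding tr by (simp add: g_h_m_mb_def)
qed

section \<open>Holomorphic functions of several variables\<close>

text \<open>The scalar version of \<open>holomorphic_map_on\<close>, applied to the components of a chart change.\<close>

definition cholomorphic_on :: "(complex^'n::finite \<Rightarrow> complex) \<Rightarrow> (complex^'n) set \<Rightarrow> bool" where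
  "cholomorphic_on \<phi> U \<longleftrightarrow>
     (\<forall>z\<in>U. \<exists>D. (\<phi> has_derivative D) (at z) \<and> (\<forall>a v. D (a *s v) = a * D v))"

lemma cholomorphic_onD:
  assumes "cholomorphic_on \<phi> U" "z \<in> U"
  shows "(\<phi> has_derivative (\<lambda>v. ddir v \<phi> z)) (at z)" "ddir (a *s v) \<phi> z = a * ddir v \<phi> z"
proof -
  obtain D where D: "(\<phi> has_derivative D) (at z)" "\<forall>a v. D (a *s v) = a * D v"
    using assms unfolding cholomorphic_on_def by blast
  have "D v = ddir v \<phi> z" for v using has_derivative_imp_ddir[OF D(1)] by simp
  then have "D = (\<lambda>v. ddir v \<phi> z)" by auto
  with D show "(\<phi> has_derivative (\<lambda>v. ddir v \<phi> z)) (at z)" "ddir (a *s v) \<phi> z = a * ddir v \<phi> z" by auto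
qed

lemma cholomorphic_on_continuous: "cholomorphic_on \<phi> U \<Longrightarrow> continuous_on U \<phi>"
  by (meson cholomorphic_onD(1) continuous_at_imp_continuous_on has_derivative_continuous)

lemma norm_cscale: "norm (a *s v) = norm a * norm (v :: complex^'n::finite)"
  unfolding norm_vec_def by (simp add: norm_mult L2_set_right_distrib)

lemma bounded_linear_cscale_left: "bounded_linear (\<lambda>a. a *s (v :: complex^'n::finite))"
  by (intro bounded_linear_intro[where K = "norm v"])
     (simp_all add: norm_cscale vec_eq_iff algebra_simps)

lemma continuous_on_cscale [continuous_intros]:
  "continuous_on S f \<Longrightarrow> continuous_on S (\<lambda>x. f x *s (v :: complex^'n::finite))"
  by (rule bounded_linear.continuous_on[OF bounded_linear_cscale_left])

abbreviation ucirc :: "real \<Rightarrow> complex" where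
  "ucirc t \<equiv> exp (2 * of_real pi * \<i> * of_real t)"

lemma norm_ucirc [simp]: "norm (ucirc t) = 1"
  using norm_exp_i_times[of "2 * pi * t"] by (simp add: mult_ac)

text \<open>The derivative in direction \<open>w\<close> as an average of \<open>\<phi>\<close> over a circle in the complex line through
  \<open>z\<close>. Its right-hand side involves no derivative, and so can itself be differentiated in \<open>z\<close>.\<close>

lemma cauchy_derivative_formula:
  fixes \<phi> :: "complex^'n::finite \<Rightarrow> complex"
  assumes hol: "cholomorphic_on \<phi> U" and r: "0 < r" and disc: "\<And>\<zeta>. norm \<zeta> \<le> r \<Longrightarrow> z + \<zeta> *s w \<in> U"
  shows "ddir w \<phi> z = integral (cbox 0 1) (\<lambda>t. \<phi> (z + (of_real r * ucirc t) *s w) / (of_real r * ucirc t))"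
proof -
  define f where "f \<zeta> = \<phi> (z + \<zeta> *s w)" for \<zeta>
  have der: "(f has_field_derivative ddir w \<phi> (z + \<zeta> *s w)) (at \<zeta>)" if "norm \<zeta> \<le> r" for \<zeta>
  proof -
    have 1: "((\<lambda>\<zeta>. z + \<zeta> *s w) has_derivative (\<lambda>h. h *s w)) (at \<zeta>)"
      using bounded_linear_imp_has_derivative[OF bounded_linear_cscale_left[of w]]
      by (auto intro!: derivative_eq_intros)
    show ?thesis
      using has_derivative_compose[OF 1 cholomorphic_onD(1)[OF hol disc[OF that]]]
      unfolding f_def has_field_derivative_def
      by (simp only: cholomorphic_onD(2)[OF hol disc[OF that]] mult.commute[of _ "ddir _ _ _"])
  qed
  have "continuous_on (cball 0 r) f"
    by (rule DERIV_continuous_on) (use der in \<open>auto intro: has_field_derivative_at_within\<close>)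
  moreover have "f holomorphic_on ball 0 r"
    unfolding holomorphic_on_def field_differentiable_def
    by (intro ballI exI, rule has_field_derivative_at_within, rule der) auto
  ultimately have "(f has_field_derivative (1 / (2 * of_real pi * \<i>) *
        contour_integral (circlepath 0 r) (\<lambda>u. f u / (u - 0)^2))) (at 0)"
    by (rule Cauchy_derivative_integral_circlepath) (use r in simp)
  moreover have "(f has_field_derivative ddir w \<phi> z) (at 0)"
    using der[of 0] r by simp
  ultimately have "ddir w \<phi> z = 1 / (2 * of_real pi * \<i>) *
        contour_integral (circlepath 0 r) (\<lambda>u. f u / (u - 0)^2)"
    using DERIV_unique by blast
  also have "\<dots> = integral {0..1} (\<lambda>t. 1 / (2 * of_real pi * \<i>) * (f (circlepath 0 r t) / (circlepath 0 r t)\<^sup>2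
         * vector_derivative (circlepath 0 r) (at t)))"
    by (simp only: contour_integral_integral integral_mult_right diff_zero)
  also have "\<dots> = integral {0..1} (\<lambda>t. f (of_real r * ucirc t) / (of_real r * ucirc t))"
    unfolding vector_derivative_circlepath using r
    by (intro integral_cong) (simp add: circlepath field_simps power2_eq_square)
  finally show ?thesis by (simp add: f_def)
qed

lemma cholomorphic_on_small_discs:
  fixes U :: "(complex^'n::finite) set"
  assumes "open U" "z0 \<in> U"
  obtains \<delta> r where "0 < \<delta>" "0 < r" "\<And>z \<zeta>. z \<in> ball z0 \<delta> \<Longrightarrow> norm \<zeta> \<le> r \<Longrightarrow> z + \<zeta> *s w \<in> U"
proof -
  obtain \<rho> where \<rho>: "\<rho> > 0" "ball z0 \<rho> \<subseteq> U" using assms openE by blast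
  define r where "r = \<rho> / (2 * (norm w + 1))"
  have w: "norm w + 1 > 0" by (smt (verit) norm_ge_zero)
  have r: "r > 0" using \<rho> w by (simp add: r_def)
  have "z + \<zeta> *s w \<in> U" if "z \<in> ball z0 (\<rho>/2)" "norm \<zeta> \<le> r" for z \<zeta>
  proof -
    have "norm (\<zeta> *s w) \<le> r * norm w" unfolding norm_cscale using that by (intro mult_right_mono) auto
    also have "\<dots> \<le> r * (norm w + 1)" using r by simp
    also have "\<dots> = \<rho> / 2" using w by (simp add: r_def field_simps)
    finally have "norm (\<zeta> *s w) \<le> \<rho> / 2" .
    moreover have "dist z0 (z + \<zeta> *s w) \<le> dist z0 z + norm (\<zeta> *s w)"
      using dist_triangle[of z0 "z + \<zeta> *s w" z] by (simp add: dist_norm)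
    moreover have "dist z0 z < \<rho> / 2" using that by simp
    ultimately have "z + \<zeta> *s w \<in> ball z0 \<rho>" by simp
    then show ?thesis using \<rho> by blast
  qed
  then show ?thesis using that[of "\<rho>/2" r] \<rho> r by simp
qed

lemma cholomorphic_on_continuous_ddir:
  fixes U :: "(complex^'n::finite) set"
  assumes hol: "cholomorphic_on \<phi> U" and U: "open U"
  shows "continuous_on U (ddir w \<phi>)"
proof (rule continuous_at_imp_continuous_on, rule ballI)
  fix z0 assume "z0 \<in> U"
  then obtain \<delta> r where dr: "0 < \<delta>" "0 < r" "\<And>z \<zeta>. z \<in> ball z0 \<delta> \<Longrightarrow> norm \<zeta> \<le> r \<Longrightarrow> z + \<zeta> *s w \<in> U"
    using cholomorphic_on_small_discs[OF U] by metis
  have "continuous_on (ball z0 \<delta> \<times> cbox 0 1) (\<lambda>(z, t). \<phi> (z + (of_real r * ucirc t) *s w) / (of_real r * ucirc t))"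
    unfolding case_prod_beta
    by (intro continuous_intros continuous_on_compose2[OF cholomorphic_on_continuous[OF hol]])
       (use dr in \<open>auto simp: norm_mult\<close>)
  then have "continuous_on (ball z0 \<delta>) (\<lambda>z. integral (cbox 0 1) (\<lambda>t. \<phi> (z + (of_real r * ucirc t) *s w) / (of_real r * ucirc t)))"
    by (rule integral_continuous_on_param)
  then have "continuous_on (ball z0 \<delta>) (ddir w \<phi>)"
    by (rule continuous_on_eq) (rule cauchy_derivative_formula[OF hol dr(2) dr(3), symmetric])
  then show "isCont (ddir w \<phi>) z0"
    using dr(1) by (simp add: continuous_on_eq_continuous_at)
qed

text \<open>Differentiating the averages over circles under the integral sign. This requires
  continuous first derivatives, which the same formula provides.\<close>

lemma cholomorphic_on_ddir:
  fixes U :: "(complex^'n::finite) set"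
  assumes hol: "cholomorphic_on \<phi> U" and U: "open U"
  shows "cholomorphic_on (ddir w \<phi>) U"
  unfolding cholomorphic_on_def
proof
  fix z0 assume z0: "z0 \<in> U"
  obtain \<delta> r where dr: "0 < \<delta>" "0 < r" "\<And>z \<zeta>. z \<in> ball z0 \<delta> \<Longrightarrow> norm \<zeta> \<le> r \<Longrightarrow> z + \<zeta> *s w \<in> U"
    using cholomorphic_on_small_discs[OF U z0] by metis
  define a where "a t = of_real r * ucirc t" for t
  have a0: "a t \<noteq> 0" for t using dr by (simp add: a_def)
  have aU: "z + a t *s w \<in> U" if "z \<in> ball z0 \<delta>" for z t
    using dr(2) dr(3)[OF that] by (simp add: a_def norm_mult)
  have bl: "bounded_linear (\<lambda>v. ddir v \<phi> y / a t)" if "y \<in> U" for y t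
    using has_derivative_bounded_linear[OF cholomorphic_onD(1)[OF hol that]]
    by (intro bounded_linear_divide[THEN bounded_linear_compose])
  define fx where "fx z t = Blinfun (\<lambda>v. ddir v \<phi> (z + a t *s w) / a t)" for z t
  have fx: "blinfun_apply (fx z t) v = ddir v \<phi> (z + a t *s w) / a t" if "z \<in> ball z0 \<delta>" for z t v
    unfolding fx_def by (subst bounded_linear_Blinfun_apply[OF bl[OF aU[OF that]]]) simp
  have cont_a: "continuous_on S a" for S
    unfolding a_def by (intro continuous_intros)
  have cont: "continuous_on (ball z0 \<delta> \<times> cbox 0 1) (\<lambda>(z, t). fx z t)"
    unfolding case_prod_beta
  proof (rule continuous_on_blinfun_componentwise)
    fix v :: "complex^'n"
    have "continuous_on (ball z0 \<delta> \<times> cbox 0 1) (\<lambda>p. ddir v \<phi> (fst p + a (snd p) *s w) / a (snd p))"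
      by (intro continuous_intros continuous_on_compose2[OF cholomorphic_on_continuous_ddir[OF hol U]]
           continuous_on_compose2[OF cont_a[of UNIV]])
         (use aU a0 in auto)
    then show "continuous_on (ball z0 \<delta> \<times> cbox 0 1) (\<lambda>p. fx (fst p) (snd p) v)"
      by (rule continuous_on_eq) (auto simp: fx)
  qed
  have int: "(\<lambda>t. \<phi> (z + a t *s w) / a t) integrable_on cbox 0 1" if "z \<in> ball z0 \<delta>" for z
    by (intro integrable_continuous continuous_intros cont_a a0 ballI
          continuous_on_compose2[OF cholomorphic_on_continuous[OF hol]])
       (use aU that in auto)
  have "((\<lambda>z. integral (cbox 0 1) (\<lambda>t. \<phi> (z + a t *s w) / a t)) has_derivative
          integral (cbox 0 1) (fx z0)) (at z0 within ball z0 \<delta>)"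
  proof (rule leibniz_rule[OF _ int cont])
    fix z t assume z: "z \<in> ball z0 \<delta>"
    have 1: "((\<lambda>z. z + a t *s w) has_derivative (\<lambda>h. h)) (at z)"
      by (auto intro!: derivative_eq_intros)
    have "((\<lambda>z. \<phi> (z + a t *s w) / a t) has_derivative (\<lambda>v. ddir v \<phi> (z + a t *s w) / a t)) (at z)"
      using bounded_linear.has_derivative[OF bounded_linear_divide
          has_derivative_compose[OF 1 cholomorphic_onD(1)[OF hol aU[OF z]]]] .
    moreover have "blinfun_apply (fx z t) = (\<lambda>v. ddir v \<phi> (z + a t *s w) / a t)" using fx[OF z] by auto
    ultimately show "((\<lambda>z. \<phi> (z + a t *s w) / a t) has_derivative blinfun_apply (fx z t)) (at z within ball z0 \<delta>)"
      by (simp add: has_derivative_at_withinI)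
  qed (use dr in auto)
  then have "((\<lambda>z. integral (cbox 0 1) (\<lambda>t. \<phi> (z + a t *s w) / a t)) has_derivative
          integral (cbox 0 1) (fx z0)) (at z0)"
    using dr(1) by (simp add: at_within_open[of z0 "ball z0 \<delta>"])
  then have der: "(ddir w \<phi> has_derivative integral (cbox 0 1) (fx z0)) (at z0)"
  proof (rule has_derivative_transform_within_open)
    show "integral (cbox 0 1) (\<lambda>t. \<phi> (z + a t *s w) / a t) = ddir w \<phi> z" if "z \<in> ball z0 \<delta>" for z
      using cauchy_derivative_formula[OF hol dr(2) dr(3)[OF that]] by (simp add: a_def)
  qed (use dr in auto)
  have intfx: "fx z0 integrable_on cbox 0 1"
  proof (intro integrable_continuous)
    have "continuous_on (cbox 0 1) ((\<lambda>(z, t). fx z t) \<circ> (\<lambda>t. (z0, t)))"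
      by (rule continuous_on_compose[OF _ continuous_on_subset[OF cont]]) (use dr in \<open>auto intro!: continuous_intros\<close>)
    then show "continuous_on (cbox 0 1) (fx z0)" by (simp add: o_def)
  qed
  have "blinfun_apply (integral (cbox 0 1) (fx z0)) (c *s v) = c * blinfun_apply (integral (cbox 0 1) (fx z0)) v" for c v
  proof -
    have "fx z0 t (c *s v) = c * fx z0 t v" for t
      using dr(1) by (simp add: fx cholomorphic_onD(2)[OF hol aU])
    then show ?thesis
      unfolding blinfun_apply_integral[OF intfx] by (simp add: integral_mult_right)
  qed
  with der show "\<exists>D. (ddir w \<phi> has_derivative D) (at z0) \<and> (\<forall>a v. D (a *s v) = a * D v)"
    by blast
qed

lemma cholomorphic_on_smooth:
  fixes U :: "(complex^'n::finite) set"
  assumes "cholomorphic_on \<phi> U" and U: "open U"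
  shows "smooth_on U \<phi>"
  unfolding smooth_on_def
proof
  show "Ck_on k U \<phi>" for k
    using assms(1)
  proof (induction k arbitrary: \<phi>)
    case 0
    then show ?case by (simp add: cholomorphic_on_continuous)
  next
    case (Suc k)
    have "(\<phi> has_derivative (\<lambda>v. ddir v \<phi> z)) (at z within U)" if "z \<in> U" for z
      using cholomorphic_onD(1)[OF Suc.prems that] by (rule has_derivative_at_withinI)
    moreover have "Ck_on k U (\<lambda>z. ddir v \<phi> z)" for v
      using Suc.IH[OF cholomorphic_on_ddir[OF Suc.prems U]] .
    ultimately show ?case by (auto intro!: exI[of _ "\<lambda>z v. ddir v \<phi> z"])
  qed
qed

lemma wirtinger_cdir: "wirtinger i = cdir (1/2) (axis i 1) (- \<i>/2) (axis i \<i>)"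
  by (simp add: fun_eq_iff wirtinger_def cdir_def ddir_def field_simps)

lemma wirtinger_bar_cdir: "wirtinger_bar i = cdir (1/2) (axis i 1) (\<i>/2) (axis i \<i>)"
  by (simp add: fun_eq_iff wirtinger_bar_def cdir_def ddir_def field_simps)

lemma axis_i_scale: "axis i \<i> = \<i> *s (axis i 1 :: complex^'n::finite)"
  by (simp add: vec_eq_iff axis_def)

lemma cholomorphic_wirtinger:
  assumes "cholomorphic_on \<phi> U" "z \<in> U"
  shows "wirtinger i \<phi> z = ddir (axis i 1) \<phi> z" "wirtinger_bar i \<phi> z = 0"
proof -
  have "ddir (axis i \<i>) \<phi> z = \<i> * ddir (axis i 1) \<phi> z"
    using cholomorphic_onD(2)[OF assms, of \<i> "axis i 1"] by (simp add: axis_i_scale)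
  then show "wirtinger i \<phi> z = ddir (axis i 1) \<phi> z" "wirtinger_bar i \<phi> z = 0"
    by (simp_all add: wirtinger_cdir wirtinger_bar_cdir cdir_def field_simps)
qed

lemma cvec_expand: "(u :: complex^'n::finite) = (\<Sum>i\<in>UNIV. Re (u $ i) *\<^sub>R axis i 1 + Im (u $ i) *\<^sub>R axis i \<i>)"
proof -
  have "(\<Sum>i\<in>UNIV. Re (u $ i) *\<^sub>R axis i 1 + Im (u $ i) *\<^sub>R axis i \<i>) $ j = u $ j" for j
  proof -
    have "(\<Sum>i\<in>UNIV. Re (u $ i) *\<^sub>R axis i 1 + Im (u $ i) *\<^sub>R axis i \<i>) $ j
       = (\<Sum>i\<in>UNIV. if i = j then u $ i else 0)"
      unfolding sum_component by (intro sum.cong refl) (auto simp: axis_def complex_eq_iff)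
    then show ?thesis by simp
  qed
  then show ?thesis by (simp add: vec_eq_iff)
qed

text \<open>The splitting \<open>df = \<partial>f + \<partial>-bar f\<close>. It is stated for a linear map \<open>L\<close> because it is applied both to
  differentials on \<open>\<complex>\<^sup>n\<close> and to spatial parts of differentials on space-time.\<close>

lemma linear_wirtinger_expand:
  fixes L :: "complex^'n::finite \<Rightarrow> complex"
  assumes "linear L"
  shows "L u = (\<Sum>i\<in>UNIV. u $ i * ((L (axis i 1) - \<i> * L (axis i \<i>)) / 2) + cnj (u $ i) * ((L (axis i 1) + \<i> * L (axis i \<i>)) / 2))"
proof -
  have "L u = (\<Sum>i\<in>UNIV. Re (u $ i) *\<^sub>R L (axis i 1) + Im (u $ i) *\<^sub>R L (axis i \<i>))"
    by (subst cvec_expand) (simp add: linear_sum[OF assms] linear_add[OF assms] linear_cmul[OF assms])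
  also have "\<dots> = (\<Sum>i\<in>UNIV. u $ i * ((L (axis i 1) - \<i> * L (axis i \<i>)) / 2) + cnj (u $ i) * ((L (axis i 1) + \<i> * L (axis i \<i>)) / 2))"
    by (intro sum.cong refl) (auto simp: complex_eq_iff field_simps)
  finally show ?thesis .
qed

lemma ddir_wirtinger:
  fixes f :: "complex^'n::finite \<Rightarrow> complex"
  assumes "smooth_on S f" "open S" "z \<in> S"
  shows "ddir u f z = (\<Sum>i\<in>UNIV. u $ i * wirtinger i f z + cnj (u $ i) * wirtinger_bar i f z)"
  using linear_wirtinger_expand[OF bounded_linear.linear[OF has_derivative_bounded_linear[OF smooth_on_has_derivative[OF assms]]], of u]
  by (simp add: wirtinger_cdir wirtinger_bar_cdir cdir_def diff_divide_distrib add_divide_distrib)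

lemma smooth_on_wirtinger: "open S \<Longrightarrow> smooth_on S f \<Longrightarrow> smooth_on S (wirtinger i f)"
  unfolding wirtinger_cdir by (rule smooth_on_cdir)

lemma smooth_on_wirtinger_bar: "open S \<Longrightarrow> smooth_on S f \<Longrightarrow> smooth_on S (wirtinger_bar i f)"
  unfolding wirtinger_bar_cdir by (rule smooth_on_cdir)

context
  fixes \<psi> :: "complex^'n::finite \<Rightarrow> complex^'m::finite" and U T
  assumes \<psi>: "\<And>a. cholomorphic_on (\<lambda>z. \<psi> z $ a) U" and U: "open U" and T: "open T" and maps: "\<psi> ` U \<subseteq> T"
begin

lemma has_derivative_cholomorphic_comp:
  fixes f :: "complex^'m \<Rightarrow> complex"
  assumes f: "smooth_on T f" and z: "z \<in> U"
  shows "((\<lambda>z. f (\<psi> z)) has_derivative (\<lambda>v. \<Sum>a\<in>UNIV. ddir v (\<lambda>z. \<psi> z $ a) z * wirtinger a f (\<psi> z)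
           + cnj (ddir v (\<lambda>z. \<psi> z $ a) z) * wirtinger_bar a f (\<psi> z))) (at z)"
proof -
  have 1: "(\<psi> has_derivative (\<lambda>v. \<chi> a. ddir v (\<lambda>z. \<psi> z $ a) z)) (at z)"
    using cholomorphic_onD(1)[OF \<psi> z]
    by (subst has_derivative_componentwise_within)
       (auto simp: Basis_vec_def inner_axis intro: has_derivative_inner_left)
  have "\<psi> z \<in> T" using z maps by blast
  from has_derivative_compose[OF 1 smooth_on_has_derivative[OF f T this]]
  show ?thesis by (simp add: ddir_wirtinger[OF f T \<open>\<psi> z \<in> T\<close>])
qed

lemma smooth_on_cholomorphic_comp:
  fixes f :: "complex^'m \<Rightarrow> complex"
  assumes "smooth_on T f"
  shows "smooth_on U (\<lambda>z. f (\<psi> z))"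
  unfolding smooth_on_def
proof
  show "Ck_on k U (\<lambda>z. f (\<psi> z))" for k
    using assms
  proof (induction k arbitrary: f)
    case 0
    have "continuous_on U (\<lambda>z. f (\<psi> z))"
      by (rule continuous_at_imp_continuous_on)
         (blast intro: has_derivative_continuous has_derivative_cholomorphic_comp[OF 0])
    then show ?case by simp
  next
    case (Suc k)
    let ?D = "\<lambda>z v. \<Sum>a\<in>UNIV. ddir v (\<lambda>z. \<psi> z $ a) z * wirtinger a f (\<psi> z)
           + cnj (ddir v (\<lambda>z. \<psi> z $ a) z) * wirtinger_bar a f (\<psi> z)"
    have J: "smooth_on U (\<lambda>z. ddir v (\<lambda>z. \<psi> z $ a) z)" for v a
      using cholomorphic_on_smooth[OF cholomorphic_on_ddir[OF \<psi> U] U] .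
    have J: "Ck_on k U (\<lambda>z. ddir v (\<lambda>z. \<psi> z $ a) z)" "Ck_on k U (\<lambda>z. cnj (ddir v (\<lambda>z. \<psi> z $ a) z))" for v a
      using J smooth_on_cnj[OF J] unfolding smooth_on_def by blast+
    have sum: "Ck_on k U (\<lambda>z. \<Sum>a\<in>I. F a z)" if "\<And>a. Ck_on k U (F a)" for F :: "'m \<Rightarrow> complex^'n \<Rightarrow> complex" and I
      by (induction I rule: infinite_finite_induct) (auto intro: that Ck_on_add Ck_on_const)
    have "Ck_on k U (\<lambda>z. ?D z v)" for v
      by (intro sum Ck_on_add Ck_on_mult J Suc.IH smooth_on_wirtinger smooth_on_wirtinger_bar T Suc.prems)
    moreover have "((\<lambda>z. f (\<psi> z)) has_derivative ?D z) (at z within U)" if "z \<in> U" for z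
      by (rule has_derivative_at_withinI[OF has_derivative_cholomorphic_comp[OF Suc.prems that]])
    ultimately show ?case by (auto intro!: exI[of _ ?D])
  qed
qed

lemma wirtinger_cholomorphic_comp:
  fixes f :: "complex^'m \<Rightarrow> complex"
  assumes f: "smooth_on T f" and z: "z \<in> U"
  shows "wirtinger i (\<lambda>z. f (\<psi> z)) z = (\<Sum>a\<in>UNIV. ddir (axis i 1) (\<lambda>z. \<psi> z $ a) z * wirtinger a f (\<psi> z))"
    and "wirtinger_bar i (\<lambda>z. f (\<psi> z)) z = (\<Sum>a\<in>UNIV. cnj (ddir (axis i 1) (\<lambda>z. \<psi> z $ a) z) * wirtinger_bar a f (\<psi> z))"
proof -
  have *: "ddir (axis i \<i>) (\<lambda>z. \<psi> z $ a) z = \<i> * ddir (axis i 1) (\<lambda>z. \<psi> z $ a) z" for a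
    using cholomorphic_onD(2)[OF \<psi> z, of \<i> "axis i 1"] by (simp add: axis_i_scale)
  note D = has_derivative_imp_ddir[OF has_derivative_cholomorphic_comp[OF f z]]
  show "wirtinger i (\<lambda>z. f (\<psi> z)) z = (\<Sum>a\<in>UNIV. ddir (axis i 1) (\<lambda>z. \<psi> z $ a) z * wirtinger a f (\<psi> z))"
    unfolding wirtinger_cdir cdir_def[of _ _ _ _ "\<lambda>z. f (\<psi> z)"] D *
    unfolding sum_distrib_left sum.distrib[symmetric]
    by (intro sum.cong refl) (simp add: algebra_simps)
  show "wirtinger_bar i (\<lambda>z. f (\<psi> z)) z = (\<Sum>a\<in>UNIV. cnj (ddir (axis i 1) (\<lambda>z. \<psi> z $ a) z) * wirtinger_bar a f (\<psi> z))"
    unfolding wirtinger_bar_cdir cdir_def[of _ _ _ _ "\<lambda>z. f (\<psi> z)"] D *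
    unfolding sum_distrib_left sum.distrib[symmetric]
    by (intro sum.cong refl) (simp add: algebra_simps)
qed

end

section \<open>The curvature under holomorphic changes of coordinates\<close>

text \<open>The curvature and its contraction for an arbitrary matrix of functions, detached from charts. This
  lets them be compared both across chart changes and with their space-time versions.\<close>

definition curv :: "('n::finite \<Rightarrow> 'n \<Rightarrow> complex^'n \<Rightarrow> complex) \<Rightarrow> 'n \<Rightarrow> 'n \<Rightarrow> 'n \<Rightarrow> 'n \<Rightarrow> complex^'n \<Rightarrow> complex" where
  "curv G i j k l z = - wirtinger i (wirtinger_bar j (G k l)) z
     + (\<Sum>\<Sum>p s. minv (\<lambda>k l. G k l z) p s * wirtinger_bar j (G p l) z * wirtinger i (G k s) z)"

definition scal :: "('n::finite \<Rightarrow> 'n \<Rightarrow> complex^'n \<Rightarrow> complex) \<Rightarrow> complex^'n \<Rightarrow> complex" where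
  "scal G z = (\<Sum>\<Sum>i j k l. minv (\<lambda>k l. G k l z) i l * minv (\<lambda>k l. G k l z) k j * curv G i j k l z)"

lemma inv_comp_minv: "inv_comp h c i j z = minv (\<lambda>k l. metric_comp h c k l z) i j"
  by (simp add: inv_comp_def minv_def transpose_def)

lemma chern_curv_curv: "chern_curv h c i j k l z = curv (metric_comp h c) i j k l z"
  by (simp add: chern_curv_def curv_def inv_comp_minv)

lemma second_scalar_scal: "second_scalar_in_chart h c z = scal (metric_comp h c) z"
  by (simp add: second_scalar_in_chart_def scal_def inv_comp_minv chern_curv_curv)

context
  fixes \<psi> :: "complex^'n::finite \<Rightarrow> complex^'n" and U T
    and G G' :: "'n \<Rightarrow> 'n \<Rightarrow> complex^'n \<Rightarrow> complex"
    and J :: "'n \<Rightarrow> 'n \<Rightarrow> complex^'n \<Rightarrow> complex"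
  assumes \<psi>: "\<And>a. cholomorphic_on (\<lambda>z. \<psi> z $ a) U" and U: "open U" and T: "open T" and maps: "\<psi> ` U \<subseteq> T"
    and smooth: "\<And>a b. smooth_on T (G' a b)"
    and J_def: "\<And>a k. J a k = ddir (axis k 1) (\<lambda>z. \<psi> z $ a)"
    and trans: "\<And>k l z. z \<in> U \<Longrightarrow> G k l z = (\<Sum>\<Sum>a b. J a k z * cnj (J b l z) * G' a b (\<psi> z))"
    and pd: "\<And>z. z \<in> U \<Longrightarrow> hermitian_pd (\<lambda>k l. G k l z)"
begin

lemma cholomorphic_J: "cholomorphic_on (J a k) U"
  unfolding J_def by (rule cholomorphic_on_ddir[OF \<psi> U])

lemma smooth_J: "smooth_on U (J a k)" "smooth_on U (\<lambda>z. cnj (J a k z))"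
  using cholomorphic_on_smooth[OF cholomorphic_J U] smooth_on_cnj by blast+

lemma smooth_pullback: "smooth_on U (\<lambda>z. G' a b (\<psi> z))"
  by (rule smooth_on_cholomorphic_comp[OF \<psi> U T maps smooth])

lemma wirtinger_cnj_J:
  assumes "z \<in> U"
  shows "wirtinger i (\<lambda>z. cnj (J a k z)) z = 0" "wirtinger_bar i (\<lambda>z. cnj (J a k z)) z = cnj (wirtinger i (J a k) z)"
  using cdir_cnj[OF U assms smooth_J(1)] cholomorphic_wirtinger(2)[OF cholomorphic_J assms]
  by (simp_all add: wirtinger_cdir wirtinger_bar_cdir)

lemma wirtinger_product3:
  assumes "z \<in> U" "smooth_on U f" "smooth_on U g" "smooth_on U k"
  shows "wirtinger i (\<lambda>z. f z * g z * k z) z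
      = wirtinger i f z * g z * k z + f z * wirtinger i g z * k z + f z * g z * wirtinger i k z"
    "wirtinger_bar i (\<lambda>z. f z * g z * k z) z
      = wirtinger_bar i f z * g z * k z + f z * wirtinger_bar i g z * k z + f z * g z * wirtinger_bar i k z"
  unfolding wirtinger_cdir wirtinger_bar_cdir
  by (simp_all add: cdir_mult[OF U assms(1)] smooth_on_mult assms(2-) algebra_simps)

lemma wirtinger_sum2:
  fixes F :: "'n \<Rightarrow> 'n \<Rightarrow> complex^'n \<Rightarrow> complex"
  assumes "z \<in> U" "\<And>a b. smooth_on U (F a b)"
  shows "wirtinger i (\<lambda>z. \<Sum>\<Sum>a b. F a b z) z = (\<Sum>\<Sum>a b. wirtinger i (F a b) z)"
    "wirtinger_bar i (\<lambda>z. \<Sum>\<Sum>a b. F a b z) z = (\<Sum>\<Sum>a b. wirtinger_bar i (F a b) z)"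
  unfolding wirtinger_cdir wirtinger_bar_cdir
  by (simp_all add: cdir_sum[OF U assms(1)] smooth_on_sum assms(2))

lemma wirtinger_trans:
  assumes z: "z \<in> U"
  shows "wirtinger i (G k l) z = (\<Sum>\<Sum>a b. wirtinger i (J a k) z * cnj (J b l z) * G' a b (\<psi> z) + J a k z * cnj (J b l z) * wirtinger i (\<lambda>z. G' a b (\<psi> z)) z)"
    and "wirtinger_bar i (G k l) z = (\<Sum>\<Sum>a b. J a k z * cnj (wirtinger i (J b l) z) * G' a b (\<psi> z) + J a k z * cnj (J b l z) * wirtinger_bar i (\<lambda>z. G' a b (\<psi> z)) z)"
proof -
  have "wirtinger i (G k l) z = wirtinger i (\<lambda>z. \<Sum>\<Sum>a b. J a k z * cnj (J b l z) * G' a b (\<psi> z)) z"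
    "wirtinger_bar i (G k l) z = wirtinger_bar i (\<lambda>z. \<Sum>\<Sum>a b. J a k z * cnj (J b l z) * G' a b (\<psi> z)) z"
    unfolding wirtinger_cdir wirtinger_bar_cdir
    by (intro cdir_cong[OF U z] trans; assumption)+
  then show "wirtinger i (G k l) z = (\<Sum>\<Sum>a b. wirtinger i (J a k) z * cnj (J b l z) * G' a b (\<psi> z) + J a k z * cnj (J b l z) * wirtinger i (\<lambda>z. G' a b (\<psi> z)) z)"
    "wirtinger_bar i (G k l) z = (\<Sum>\<Sum>a b. J a k z * cnj (wirtinger i (J b l) z) * G' a b (\<psi> z) + J a k z * cnj (J b l z) * wirtinger_bar i (\<lambda>z. G' a b (\<psi> z)) z)"
    by (simp_all add: wirtinger_sum2[OF z] wirtinger_product3[OF z] smooth_on_mult smooth_J smooth_pullback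
          wirtinger_cnj_J[OF z] cholomorphic_wirtinger(2)[OF cholomorphic_J z])
qed

lemma wirtinger_wirtinger_bar_trans:
  assumes z: "z \<in> U"
  shows "wirtinger i (wirtinger_bar j (G k l)) z = (\<Sum>\<Sum>a b. (wirtinger i (J a k) z * cnj (wirtinger j (J b l) z) * G' a b (\<psi> z)
        + J a k z * cnj (wirtinger j (J b l) z) * wirtinger i (\<lambda>z. G' a b (\<psi> z)) z)
       + (wirtinger i (J a k) z * cnj (J b l z) * wirtinger_bar j (\<lambda>z. G' a b (\<psi> z)) z
        + J a k z * cnj (J b l z) * wirtinger i (wirtinger_bar j (\<lambda>z. G' a b (\<psi> z))) z))"
proof -
  have hJ: "cholomorphic_on (wirtinger j (J a k)) U" for a k
  proof -
    have "cholomorphic_on (ddir (axis j 1) (J a k)) U" by (rule cholomorphic_on_ddir[OF cholomorphic_J U])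
    moreover have "ddir (axis j 1) (J a k) z = wirtinger j (J a k) z" if "z \<in> U" for z
      using cholomorphic_wirtinger(1)[OF cholomorphic_J that] by simp
    ultimately show ?thesis
      unfolding cholomorphic_on_def using has_derivative_transform_within_open[OF _ U] by metis
  qed
  have sJ: "smooth_on U (wirtinger j (J a k))" "smooth_on U (\<lambda>z. cnj (wirtinger j (J a k) z))" for a k
    using cholomorphic_on_smooth[OF hJ U] smooth_on_cnj by blast+
  have wJ: "wirtinger i (\<lambda>z. cnj (wirtinger j (J a k) z)) z = 0" for a k
    using cdir_cnj[OF U z sJ(1)] cholomorphic_wirtinger(2)[OF hJ z]
    by (simp add: wirtinger_cdir wirtinger_bar_cdir)
  have add: "wirtinger i (\<lambda>z. f z + g z) z = wirtinger i f z + wirtinger i g z"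
    if "smooth_on U f" "smooth_on U g" for f g
    unfolding wirtinger_cdir by (rule cdir_add[OF U z that])
  have "wirtinger i (wirtinger_bar j (G k l)) z = wirtinger i (\<lambda>z. \<Sum>\<Sum>a b. J a k z * cnj (wirtinger j (J b l) z) * G' a b (\<psi> z) + J a k z * cnj (J b l z) * wirtinger_bar j (\<lambda>z. G' a b (\<psi> z)) z) z"
    unfolding wirtinger_cdir[of i] by (intro cdir_cong[OF U z] wirtinger_trans; assumption)
  then show ?thesis
    by (simp add: wirtinger_sum2[OF z] wirtinger_product3[OF z] add smooth_on_mult smooth_on_add smooth_J sJ smooth_pullback wJ
          wirtinger_cnj_J[OF z] smooth_on_wirtinger_bar U)
qed

text \<open>From \<open>G = J\<^sup>T G' cnj J\<close> and \<open>G K = 1\<close> follows \<open>J\<^sup>T (G' cnj J K) = 1\<close>; the square factors may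
  be interchanged, which gives \<open>G' (cnj J K J\<^sup>T) = 1\<close>.\<close>

lemma minv_trans:
  assumes z: "z \<in> U"
  shows "minv (\<lambda>k l. G' k l (\<psi> z)) a b = (\<Sum>\<Sum>i j. J a i z * cnj (J b j z) * minv (\<lambda>k l. G k l z) i j)"
    and "matrix_inv (\<chi> a b. G' a b (\<psi> z)) =
      (\<chi> a k. cnj (J a k z)) ** matrix_inv (\<chi> k l. G k l z) ** transpose (\<chi> a k. J a k z)"
    and "matrix_inv (\<chi> a b. G' a b (\<psi> z)) ** (\<chi> a b. G' a b (\<psi> z)) = mat 1"
    and "(\<chi> a b. G' a b (\<psi> z)) ** matrix_inv (\<chi> a b. G' a b (\<psi> z)) = mat 1"
proof -
  define j jb where "j = (\<chi> a k. J a k z)" "jb = (\<chi> a k. cnj (J a k z))"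
  define g g' where "g = (\<chi> k l. G k l z)" "g' = (\<chi> a b. G' a b (\<psi> z))"
  define K where "K = matrix_inv g"
  have g: "g = transpose j ** g' ** jb"
    by (simp add: vec_eq_iff sandwich_nth) (simp add: j_jb_def g_g'_def trans[OF z])
  have "g ** K = mat 1"
    unfolding K_def g_g'_def by (rule matrix_inv_both[OF hermitian_pd_invertible[OF pd[OF z]]])
  then have "transpose j ** (g' ** jb ** K) = mat 1" by (simp add: g matrix_mul_assoc)
  then have r: "g' ** (jb ** K ** transpose j) = mat 1"
    using matrix_left_right_inverse by (metis matrix_mul_assoc)
  have K': "matrix_inv g' = jb ** K ** transpose j"
    by (rule matrix_inv_unique[OF r])
  then show "matrix_inv (\<chi> a b. G' a b (\<psi> z)) =
      (\<chi> a k. cnj (J a k z)) ** matrix_inv (\<chi> k l. G k l z) ** transpose (\<chi> a k. J a k z)"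
    by (simp add: j_jb_def g_g'_def K_def)
  show "(\<chi> a b. G' a b (\<psi> z)) ** matrix_inv (\<chi> a b. G' a b (\<psi> z)) = mat 1"
    using r by (simp add: K' flip: g_g'_def)
  then show "matrix_inv (\<chi> a b. G' a b (\<psi> z)) ** (\<chi> a b. G' a b (\<psi> z)) = mat 1"
    using matrix_left_right_inverse by blast
  have "minv (\<lambda>k l. G' k l (\<psi> z)) a b = (transpose (transpose jb) ** K ** transpose j) $ b $ a"
    unfolding minv_def using K' by (simp add: g_g'_def)
  also have "\<dots> = (\<Sum>\<Sum>j i. J a i z * cnj (J b j z) * minv (\<lambda>k l. G k l z) i j)"
    unfolding sandwich_nth by (simp add: minv_def j_jb_def transpose_def K_def g_g'_def mult_ac)
  finally show "minv (\<lambda>k l. G' k l (\<psi> z)) a b = (\<Sum>\<Sum>i j. J a i z * cnj (J b j z) * minv (\<lambda>k l. G k l z) i j)"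
    by (subst sum.swap)
qed

text \<open>Fix the form indices and regard \<open>G\<close> as a matrix, \<open>G = J\<^sup>T X cnj J\<close> with \<open>X = G' \<circ> \<psi>\<close>. As \<open>J\<close> is
  holomorphic, each of the derivatives \<open>\<partial>G\<close> and \<open>\<partial>-bar G\<close> contains one term with a derivative of \<open>J\<close>.
  In \<open>\<partial>G G\<^sup>-\<^sup>1 \<partial>-bar G - \<partial> \<partial>-bar G\<close> all terms with derivatives of \<open>J\<close> cancel, which leaves
  \<open>J\<^sup>T (\<partial>X X\<^sup>-\<^sup>1 \<partial>-bar X - \<partial> \<partial>-bar X) cnj J\<close>; the chain rule then transforms the form indices.\<close>

lemma curv_trans:
  assumes z: "z \<in> U"
  shows "curv G i j k l z = (\<Sum>\<Sum>a b e f. J a k z * cnj (J b l z) * J e i z * cnj (J f j z) * curv G' e f a b (\<psi> z))"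
proof -
  have z': "\<psi> z \<in> T" using z maps by blast
  define m mb where "m = (\<chi> a k. J a k z)" "mb = (\<chi> a k. cnj (J a k z))"
  define mi mj where "mi = (\<chi> a k. wirtinger i (J a k) z)" "mj = (\<chi> a k. cnj (wirtinger j (J a k) z))"
  define g' where "g' = (\<chi> a b. G' a b (\<psi> z))"
  define xi where "xi = (\<chi> a b. wirtinger i (\<lambda>z. G' a b (\<psi> z)) z)"
  define xj where "xj = (\<chi> a b. wirtinger_bar j (\<lambda>z. G' a b (\<psi> z)) z)"
  define xij where "xij = (\<chi> a b. wirtinger i (wirtinger_bar j (\<lambda>z. G' a b (\<psi> z))) z)"
  define K where "K = matrix_inv (\<chi> k l. G k l z)"
  define K' where "K' = matrix_inv g'"
  define gi where "gi = (\<chi> k l. wirtinger i (G k l) z)"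
  define gj where "gj = (\<chi> k l. wirtinger_bar j (G k l) z)"
  define gij where "gij = (\<chi> k l. wirtinger i (wirtinger_bar j (G k l)) z)"
  note defs = m_mb_def mi_mj_def g'_def xi_def xj_def xij_def
  have gi: "gi = transpose mi ** g' ** mb + transpose m ** xi ** mb"
    by (simp add: vec_eq_iff sandwich_nth) (simp add: gi_def defs wirtinger_trans[OF z] sum.distrib)
  have gj: "gj = transpose m ** g' ** mj + transpose m ** xj ** mb"
    by (simp add: vec_eq_iff sandwich_nth) (simp add: gj_def defs wirtinger_trans[OF z] sum.distrib)
  have gij: "gij = (transpose mi ** g' ** mj + transpose m ** xi ** mj) + (transpose mi ** xj ** mb + transpose m ** xij ** mb)"
    by (simp add: vec_eq_iff sandwich_nth) (simp add: gij_def defs wirtinger_wirtinger_bar_trans[OF z] sum.distrib)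
  have K': "K' = mb ** K ** transpose m" "K' ** g' = mat 1" "g' ** K' = mat 1"
    using minv_trans(2-4)[OF z] by (simp_all add: K'_def g'_def K_def m_mb_def)
  have "gi ** K ** gj = (transpose mi ** g' + transpose m ** xi) ** K' ** (g' ** mj + xj ** mb)"
    unfolding gi gj K' by (simp add: matrix_add_ldistrib matrix_add_rdistrib' matrix_mul_assoc)
  also have "\<dots> = transpose mi ** (g' ** K') ** g' ** mj + transpose m ** xi ** (K' ** g') ** mj
      + (transpose mi ** (g' ** K') ** xj ** mb + transpose m ** xi ** K' ** xj ** mb)"
    by (simp only: matrix_add_ldistrib matrix_add_rdistrib' matrix_mul_assoc)
  finally have om: "gi ** K ** gj - gij = transpose m ** (xi ** K' ** xj - xij) ** mb"
    unfolding K'(2,3) gij by (simp add: matrix_sub_ldistrib' matrix_sub_rdistrib' matrix_mul_assoc)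
  have "curv G i j k l z = (gi ** K ** gj - gij) $ k $ l"
  proof -
    have "(gi ** K ** gj) $ k $ l = (\<Sum>\<Sum>p s. minv (\<lambda>k l. G k l z) p s * wirtinger_bar j (G p l) z * wirtinger i (G k s) z)"
      by (simp add: matrix_matrix_mult_def gi_def gj_def K_def minv_def sum_distrib_left sum_distrib_right mult_ac)
    then show ?thesis by (simp add: curv_def gij_def)
  qed
  also have "\<dots> = (\<Sum>\<Sum>a b. J a k z * cnj (J b l z) * (xi ** K' ** xj - xij) $ a $ b)"
    unfolding om sandwich_nth by (simp add: m_mb_def)
  finally have step: "curv G i j k l z = (\<Sum>\<Sum>a b. J a k z * cnj (J b l z) * (xi ** K' ** xj - xij) $ a $ b)" .
  have mid: "(xi ** K' ** xj - xij) $ a $ b = (\<Sum>\<Sum>e f. J e i z * cnj (J f j z) * curv G' e f a b (\<psi> z))" for a b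
  proof -
    have xi: "xi $ a $ b = (\<Sum>e\<in>UNIV. J e i z * wirtinger e (G' a b) (\<psi> z))" for a b
      by (simp add: xi_def wirtinger_cholomorphic_comp(1)[OF \<psi> U T maps smooth z] J_def)
    have xj': "wirtinger_bar j (\<lambda>z. G' a b (\<psi> z)) z = (\<Sum>f\<in>UNIV. cnj (J f j z) * wirtinger_bar f (G' a b) (\<psi> z))"
      if "z \<in> U" for a b z
      by (simp add: wirtinger_cholomorphic_comp(2)[OF \<psi> U T maps smooth that] J_def)
    have xj: "xj $ a $ b = (\<Sum>f\<in>UNIV. cnj (J f j z) * wirtinger_bar f (G' a b) (\<psi> z))" for a b
      using xj'[OF z] by (simp add: xj_def)
    have sm: "smooth_on U (\<lambda>z. wirtinger_bar f (G' a b) (\<psi> z))" for f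
      by (rule smooth_on_cholomorphic_comp[OF \<psi> U T maps smooth_on_wirtinger_bar[OF T smooth]])
    have "xij $ a $ b = wirtinger i (\<lambda>z. \<Sum>f\<in>UNIV. cnj (J f j z) * wirtinger_bar f (G' a b) (\<psi> z)) z"
      unfolding xij_def by (simp add: wirtinger_cdir[of i]) (intro cdir_cong[OF U z] xj'; assumption)
    also have "\<dots> = (\<Sum>f\<in>UNIV. cnj (J f j z) * wirtinger i (\<lambda>z. wirtinger_bar f (G' a b) (\<psi> z)) z)"
      using wirtinger_cnj_J(1)[OF z, of i] unfolding wirtinger_cdir[of i]
      by (simp add: cdir_sum[OF U z] smooth_on_mult smooth_J sm cdir_mult[OF U z])
    also have "\<dots> = (\<Sum>\<Sum>f e. J e i z * cnj (J f j z) * wirtinger e (wirtinger_bar f (G' a b)) (\<psi> z))"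
      by (simp add: wirtinger_cholomorphic_comp(1)[OF \<psi> U T maps smooth_on_wirtinger_bar[OF T smooth] z] J_def
            sum_distrib_left mult_ac)
    also have "\<dots> = (\<Sum>\<Sum>e f. J e i z * cnj (J f j z) * wirtinger e (wirtinger_bar f (G' a b)) (\<psi> z))"
      by (rule sum.swap)
    finally have xij: "xij $ a $ b = (\<Sum>\<Sum>e f. J e i z * cnj (J f j z) * wirtinger e (wirtinger_bar f (G' a b)) (\<psi> z))" .
    have "(xi ** K' ** xj) $ a $ b = (\<Sum>\<Sum>p s. xi $ a $ s * K' $ s $ p * xj $ p $ b)"
      by (simp add: matrix_matrix_mult_def sum_distrib_right)
    also have "\<dots> = (\<Sum>\<Sum>p s e f. J e i z * cnj (J f j z) * (K' $ s $ p * wirtinger_bar f (G' p b) (\<psi> z) * wirtinger e (G' a s) (\<psi> z)))"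
      unfolding xi xj by (simp add: sum_distrib_left sum_distrib_right mult_ac)
    also have "\<dots> = (\<Sum>\<Sum>e f p s. J e i z * cnj (J f j z) * (K' $ s $ p * wirtinger_bar f (G' p b) (\<psi> z) * wirtinger e (G' a s) (\<psi> z)))"
      unfolding sum.cartesian_product
      by (rule sum.reindex_bij_witness[where i="\<lambda>(e,f,p,s). (p,s,e,f)" and j="\<lambda>(p,s,e,f). (e,f,p,s)"]) auto
    finally show ?thesis
      by (simp add: xij curv_def minv_def K'_def g'_def algebra_simps sum_distrib_left sum.distrib sum_subtractf)
  qed
  show ?thesis unfolding step mid by (simp add: sum_distrib_left mult.assoc)
qed

lemma scal_trans:
  assumes z: "z \<in> U"
  shows "scal G z = scal G' (\<psi> z)"
proof -
  let ?H = "minv (\<lambda>k l. G k l z)"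
  define C where "C e f a b = curv G' e f a b (\<psi> z)" for e f a b
  have "scal G z = (\<Sum>\<Sum>i j k l a b e f. (J e i z * cnj (J b l z) * ?H i l) * (J a k z * cnj (J f j z) * ?H k j) * C e f a b)"
    unfolding scal_def curv_trans[OF z] C_def by (simp add: sum_distrib_left mult_ac)
  also have "\<dots> = (\<Sum>\<Sum>e f a b k j i l. (J e i z * cnj (J b l z) * ?H i l) * (J a k z * cnj (J f j z) * ?H k j) * C e f a b)"
    unfolding sum.cartesian_product
    by (rule sum.reindex_bij_witness[where i="\<lambda>(e,f,a,b,k,j,i,l). (i,j,k,l,a,b,e,f)" and j="\<lambda>(i,j,k,l,a,b,e,f). (e,f,a,b,k,j,i,l)"]) auto
  also have "\<dots> = (\<Sum>\<Sum>e f a b. (\<Sum>\<Sum>i l. J e i z * cnj (J b l z) * ?H i l) * (\<Sum>\<Sum>k j. J a k z * cnj (J f j z) * ?H k j) * C e f a b)"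
    by (simp only: sum_distrib_left sum_distrib_right)
  also have "\<dots> = scal G' (\<psi> z)"
    unfolding scal_def minv_trans(1)[OF z, symmetric] C_def ..
  finally show ?thesis .
qed

end

section \<open>Chart independence of the second scalar curvature\<close>

definition J_bilinear :: "(complex^'n::finite \<Rightarrow> complex^'n \<Rightarrow> real) \<Rightarrow> bool" where
  "J_bilinear B \<longleftrightarrow> bilinear B \<and> (\<forall>u v. B u v = B v u) \<and> (\<forall>u v. B (\<i> *s u) (\<i> *s v) = B u v)"

text \<open>The form that is complex linear in the first and antilinear in the second argument; its values
  on the standard basis are the components \<open>metric_comp\<close>, whose transformation law and positivity
  are inherited from \<open>B\<close>.\<close>

definition herm_of :: "(complex^'n::finite \<Rightarrow> complex^'n \<Rightarrow> real) \<Rightarrow> complex^'n \<Rightarrow> complex^'n \<Rightarrow> complex" where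
  "herm_of B u v = (of_real (B u v) + \<i> * of_real (B u (\<i> *s v))) / 2"

context
  fixes B :: "complex^'n::finite \<Rightarrow> complex^'n \<Rightarrow> real"
  assumes B: "J_bilinear B"
begin

lemma J_bilinear_rules:
  "B (u + u') v = B u v + B u' v" "B v (u + u') = B v u + B v u'"
  "B (r *\<^sub>R u) v = r * B u v" "B v (r *\<^sub>R u) = r * B v u"
  "B (- u) v = - B u v" "B v (- u) = - B v u"
  "B (\<i> *s u) (\<i> *s v) = B u v"
proof -
  have bl: "bilinear B" using B unfolding J_bilinear_def by blast
  show "B (u + u') v = B u v + B u' v" "B v (u + u') = B v u + B v u'"
    "B (r *\<^sub>R u) v = r * B u v" "B v (r *\<^sub>R u) = r * B v u"
    "B (- u) v = - B u v" "B v (- u) = - B v u"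
    using bilinear_ladd[OF bl] bilinear_radd[OF bl] bilinear_lmul[OF bl] bilinear_rmul[OF bl]
      bilinear_lneg[OF bl] bilinear_rneg[OF bl] by simp_all
  show "B (\<i> *s u) (\<i> *s v) = B u v" using B unfolding J_bilinear_def by blast
qed

lemma J_bilinear_sym: "B u v = B v u"
  using B unfolding J_bilinear_def by blast

lemma ii_scale: "\<i> *s (\<i> *s u) = - (u :: complex^'n)"
  by (simp add: vec_eq_iff)

lemma J_bilinear_i_left: "B (\<i> *s u) v = - B u (\<i> *s v)"
  using J_bilinear_rules(7)[of u "\<i> *s v"] by (simp add: ii_scale J_bilinear_rules)

lemma herm_of_herm: "cnj (herm_of B u v) = herm_of B v u"
proof -
  have "B u (\<i> *s v) = - B v (\<i> *s u)"
    using J_bilinear_i_left[of v u] J_bilinear_sym[of u "\<i> *s v"] by linarith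
  then show ?thesis using J_bilinear_sym[of u v] by (simp add: herm_of_def)
qed

lemma cscale_expand: "a *s u = Re a *\<^sub>R u + Im a *\<^sub>R (\<i> *s (u :: complex^'n))"
  by (simp add: vec_eq_iff complex_eq_iff)

lemma herm_of_add_left: "herm_of B (u + u') v = herm_of B u v + herm_of B u' v"
  by (simp add: herm_of_def J_bilinear_rules add_divide_distrib algebra_simps)

lemma herm_of_scale_left: "herm_of B (a *s u) v = a * herm_of B u v"
  unfolding herm_of_def cscale_expand[of a u]
  by (simp add: J_bilinear_rules J_bilinear_i_left ii_scale) (simp add: complex_eq_iff algebra_simps)

lemma herm_of_zero_left: "herm_of B 0 v = 0"
  using herm_of_scale_left[of 0 0 v] by simp

lemma herm_of_sum_left: "herm_of B (\<Sum>i\<in>I. f i) v = (\<Sum>i\<in>I. herm_of B (f i) v)"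
  by (induction I rule: infinite_finite_induct) (auto simp: herm_of_zero_left herm_of_add_left)

lemma herm_of_sum_right: "herm_of B v (\<Sum>i\<in>I. f i) = (\<Sum>i\<in>I. herm_of B v (f i))"
  using arg_cong[OF herm_of_sum_left[of f I v], of cnj] by (simp add: herm_of_herm)

lemma herm_of_scale_right: "herm_of B v (a *s u) = cnj a * herm_of B v u"
  using arg_cong[OF herm_of_scale_left[of a u v], of cnj] by (simp add: herm_of_herm)

lemma herm_of_expand:
  "herm_of B u v = (\<Sum>\<Sum>i j. u $ i * cnj (v $ j) * herm_of B (axis i 1) (axis j 1))"
proof -
  have "herm_of B u v = herm_of B (\<Sum>i\<in>UNIV. u $ i *s axis i 1) (\<Sum>j\<in>UNIV. v $ j *s axis j 1)"
    by (simp only: basis_expansion)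
  also have "\<dots> = (\<Sum>\<Sum>j i. u $ i * cnj (v $ j) * herm_of B (axis i 1) (axis j 1))"
    by (simp add: herm_of_sum_left herm_of_sum_right herm_of_scale_left herm_of_scale_right sum_distrib_left mult_ac)
  finally show ?thesis by (subst (asm) sum.swap)
qed

lemma herm_of_axis:
  "(complex_of_real (B (axis i 1) (axis j 1)) + complex_of_real (B (axis i \<i>) (axis j \<i>))
       + \<i> * (complex_of_real (B (axis i 1) (axis j \<i>))
              - complex_of_real (B (axis i \<i>) (axis j 1)))) / 4 = herm_of B (axis i 1) (axis j 1)"
  by (simp add: axis_i_scale J_bilinear_rules J_bilinear_i_left herm_of_def)

lemma herm_of_diag: "herm_of B u u = of_real (B u u) / 2"
proof -
  have "B u (\<i> *s u) = 0"
    using J_bilinear_i_left[of u u] J_bilinear_sym[of u "\<i> *s u"] by linarith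
  then show ?thesis by (simp add: herm_of_def)
qed

lemma herm_of_pd:
  assumes "\<And>v. v \<noteq> 0 \<Longrightarrow> B v v > 0"
  shows "hermitian_pd (\<lambda>i j. herm_of B (axis i 1) (axis j 1))"
  unfolding hermitian_pd_def
proof (intro conjI allI impI)
  show "cnj (herm_of B (axis i 1) (axis j 1)) = herm_of B (axis j 1) (axis i 1)" for i j
    by (rule herm_of_herm)
  fix x :: "'n \<Rightarrow> complex" assume x: "\<exists>i. x i \<noteq> 0"
  let ?x = "\<chi> i. x i"
  have "?x \<noteq> 0" using x by (simp add: vec_eq_iff)
  then have "0 < Re (herm_of B ?x ?x)" unfolding herm_of_diag using assms by simp
  then show "0 < Re (\<Sum>\<Sum>i j. x i * cnj (x j) * herm_of B (axis i 1) (axis j 1))"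
    by (subst (asm) herm_of_expand) simp
qed

end

lemma hermitian_metric_J_bilinear:
  assumes "hermitian_metric A h" "c \<in> A" "p \<in> chart_dom c"
  shows "J_bilinear (h c p)" "v \<noteq> 0 \<Longrightarrow> h c p v v > 0"
proof -
  note * = bspec[OF bspec[OF conjunct1[OF assms(1)[unfolded hermitian_metric_def]] assms(2)] assms(3)]
  show "J_bilinear (h c p)" unfolding J_bilinear_def using * by blast
  show "v \<noteq> 0 \<Longrightarrow> h c p v v > 0" using * by blast
qed

lemma chart_inv_in_dom: "z \<in> chart_image c \<Longrightarrow> chart_inv c z \<in> chart_dom c"
  by (rule inv_into_into)

lemma metric_comp_herm_of:
  assumes "hermitian_metric A h" "c \<in> A" "z \<in> chart_image c"
  shows "metric_comp h c i j z = herm_of (h c (chart_inv c z)) (axis i 1) (axis j 1)"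
  unfolding metric_comp_def Let_def
  by (rule herm_of_axis[OF hermitian_metric_J_bilinear(1)[OF assms(1,2) chart_inv_in_dom[OF assms(3)]]])

lemma metric_comp_pd:
  assumes "hermitian_metric A h" "c \<in> A" "z \<in> chart_image c"
  shows "hermitian_pd (\<lambda>k l. metric_comp h c k l z)"
  unfolding metric_comp_herm_of[OF assms]
  by (rule herm_of_pd) (rule hermitian_metric_J_bilinear[OF assms(1,2) chart_inv_in_dom[OF assms(3)]], assumption?)+

lemma metric_comp_smooth:
  assumes "hermitian_metric A h" "c \<in> A"
  shows "smooth_on (chart_image c) (metric_comp h c i j)"
proof -
  have sm: "smooth_on (chart_image c) (\<lambda>z. h c (chart_inv c z) u v)" for u v
    using assms unfolding hermitian_metric_def by blast
  show ?thesis
    unfolding metric_comp_def[abs_def] Let_def divide_inverse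
    by (intro smooth_on_intros sm)
qed

lemma chart_inv_apply:
  "is_chart c \<Longrightarrow> p \<in> chart_dom c \<Longrightarrow> chart_inv c (chart_coord c p) = p"
  unfolding is_chart_def by (meson homeomorphism_apply1)

lemma open_overlap:
  assumes "is_chart c" "is_chart d"
  shows "open (chart_coord c ` (chart_dom c \<inter> chart_dom d))"
proof -
  have *: "open (chart_dom c)" "open (chart_image c)" "open (chart_dom d)"
    "homeomorphism (chart_dom c) (chart_image c) (chart_coord c) (chart_inv c)"
    using assms unfolding is_chart_def by auto
  have "openin (top_of_set (chart_dom c)) (chart_dom c \<inter> chart_dom d)"
    using * by (simp add: openin_open_Int)
  then have "openin (top_of_set (chart_image c)) (chart_coord c ` (chart_dom c \<inter> chart_dom d))"
    using homeomorphism_imp_open_map[OF *(4)] by blast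
  then show ?thesis using *(2) openin_open_trans by blast
qed

theorem scal_chart_independent:
  assumes A: "complex_atlas A" and h: "hermitian_metric A h"
    and c: "c \<in> A" and d: "d \<in> A" and p: "p \<in> chart_dom c \<inter> chart_dom d"
  shows "scal (metric_comp h c) (chart_coord c p) = scal (metric_comp h d) (chart_coord d p)"
proof -
  let ?U = "chart_coord c ` (chart_dom c \<inter> chart_dom d)"
  let ?\<psi> = "chart_change c d"
  have ic: "is_chart c" "is_chart d" using A c d unfolding complex_atlas_def by auto
  have hol: "holomorphic_map_on ?\<psi> ?U" using A c d unfolding complex_atlas_def by blast
  have hola: "cholomorphic_on (\<lambda>z. ?\<psi> z $ a) ?U" for a
    unfolding cholomorphic_on_def
  proof
    fix z assume "z \<in> ?U"
    then obtain D where D: "(?\<psi> has_derivative D) (at z)" "\<forall>a v. D (a *s v) = a *s D v"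
      using hol unfolding holomorphic_map_on_def by blast
    have "((\<lambda>z. ?\<psi> z $ a) has_derivative (\<lambda>v. D v $ a)) (at z)"
      by (rule bounded_linear.has_derivative[OF bounded_linear_vec_nth D(1)])
    then show "\<exists>D. ((\<lambda>z. ?\<psi> z $ a) has_derivative D) (at z) \<and> (\<forall>a v. D (a *s v) = a * D v)"
      using D(2) by (intro exI[of _ "\<lambda>v. D v $ a"]) simp
  qed
  have \<psi>c: "?\<psi> (chart_coord c q) = chart_coord d q" if "q \<in> chart_dom c" for q
    using chart_inv_apply[OF ic(1) that] by simp
  have maps: "?\<psi> ` ?U \<subseteq> chart_image d" using \<psi>c by auto
  have T: "open (chart_image d)" using ic(2) unfolding is_chart_def by blast
  define J where "J a k = ddir (axis k 1) (\<lambda>z. ?\<psi> z $ a)" for a k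
  have trans: "metric_comp h c k l z = (\<Sum>\<Sum>a b. J a k z * cnj (J b l z) * metric_comp h d a b (?\<psi> z))"
    if z: "z \<in> ?U" for k l z
  proof -
    obtain q where q: "q \<in> chart_dom c" "q \<in> chart_dom d" "z = chart_coord c q" using z by blast
    let ?D = "frechet_derivative ?\<psi> (at z)"
    obtain D where D: "(?\<psi> has_derivative D) (at z)" "\<forall>a v. D (a *s v) = a *s D v"
      using hol z unfolding holomorphic_map_on_def by blast
    have DD: "?D = D" using frechet_derivative_at[OF D(1)] by simp
    have J: "J a k z = ?D (axis k 1) $ a" for a k
      unfolding J_def DD
      by (rule has_derivative_imp_ddir[OF bounded_linear.has_derivative[OF bounded_linear_vec_nth D(1)]])
    have hcd: "h c q u v = h d q (?D u) (?D v)" for u v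
      using h c d q unfolding hermitian_metric_def by blast
    have zc: "z \<in> chart_image c" "chart_inv c z = q" and zd: "?\<psi> z \<in> chart_image d" "chart_inv d (?\<psi> z) = q"
      using q \<psi>c[of q] chart_inv_apply[OF ic(1)] chart_inv_apply[OF ic(2)] by auto
    have "metric_comp h c k l z = herm_of (h c q) (axis k 1) (axis l 1)"
      using metric_comp_herm_of[OF h c zc(1)] zc by simp
    also have "\<dots> = herm_of (h d q) (?D (axis k 1)) (?D (axis l 1))"
      unfolding herm_of_def hcd DD D(2)[rule_format] ..
    also have "\<dots> = (\<Sum>\<Sum>a b. J a k z * cnj (J b l z) * metric_comp h d a b (?\<psi> z))"
      unfolding metric_comp_herm_of[OF h d zd(1)] zd(2) J
      by (rule herm_of_expand[OF hermitian_metric_J_bilinear(1)[OF h d q(2)]])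
    finally show ?thesis .
  qed
  have pd: "hermitian_pd (\<lambda>k l. metric_comp h c k l z)" if "z \<in> ?U" for z
    using metric_comp_pd[OF h c] that by blast
  have "chart_coord c p \<in> ?U" using p by blast
  from scal_trans[OF hola open_overlap[OF ic] T maps metric_comp_smooth[OF h d] J_def trans pd this]
  have "scal (metric_comp h c) (chart_coord c p) = scal (metric_comp h d) (?\<psi> (chart_coord c p))" .
  then show ?thesis using \<psi>c p by simp
qed

lemma second_scalar_curvature_chart:
  assumes A: "complex_atlas A" and h: "hermitian_metric A h" and c: "c \<in> A" "p \<in> chart_dom c"
  shows "second_scalar_curvature A h p = Re (scal (metric_comp h c) (chart_coord c p))"
proof -
  define d where "d = (SOME c. c \<in> A \<and> p \<in> chart_dom c)"
  have "d \<in> A \<and> p \<in> chart_dom d"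
    unfolding d_def by (rule someI[of _ c]) (use c in simp)
  then have "scal (metric_comp h c) (chart_coord c p) = scal (metric_comp h d) (chart_coord d p)"
    using scal_chart_independent[OF A h] c by blast
  then show ?thesis
    unfolding second_scalar_curvature_def Let_def d_def[symmetric] second_scalar_scal by simp
qed

section \<open>The flow in terms of the inverse metric\<close>

definition fo_op :: "(('a::real_normed_vector \<Rightarrow> complex) \<Rightarrow> 'a \<Rightarrow> complex) \<Rightarrow> bool" where
  "fo_op P \<longleftrightarrow> (\<exists>a v b w. P = cdir a v b w)"

text \<open>Packages the calculus of one operator on a domain, to be instantiated by \<open>\<partial>\<^sub>i\<close>, \<open>\<partial>-bar\<^sub>i\<close> and
  \<open>\<partial>\<^sub>t\<close>, and by arbitrary pairs of them when the inverse matrix is differentiated.\<close>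

locale first_order_op =
  fixes S :: "'a::real_normed_vector set" and P :: "('a \<Rightarrow> complex) \<Rightarrow> 'a \<Rightarrow> complex"
  assumes S: "open S" and P: "fo_op P"
begin

lemma smooth: "smooth_on S f \<Longrightarrow> smooth_on S (P f)"
  using P smooth_on_cdir[OF S] unfolding fo_op_def by blast

lemma cong: "x \<in> S \<Longrightarrow> (\<And>y. y \<in> S \<Longrightarrow> f y = g y) \<Longrightarrow> P f x = P g x"
  using P cdir_cong[OF S, of x f g] unfolding fo_op_def by fastforce

lemma const: "P (\<lambda>_. c) x = 0"
  using P unfolding fo_op_def by (auto simp: cdir_def has_derivative_imp_ddir[OF has_derivative_const])

lemma add: "x \<in> S \<Longrightarrow> smooth_on S f \<Longrightarrow> smooth_on S g \<Longrightarrow> P (\<lambda>x. f x + g x) x = P f x + P g x"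
  using P cdir_add[OF S, of x f g] unfolding fo_op_def by fastforce

lemma diff: "x \<in> S \<Longrightarrow> smooth_on S f \<Longrightarrow> smooth_on S g \<Longrightarrow> P (\<lambda>x. f x - g x) x = P f x - P g x"
  using P cdir_diff[OF S, of x f g] unfolding fo_op_def by fastforce

lemma mult: "x \<in> S \<Longrightarrow> smooth_on S f \<Longrightarrow> smooth_on S g \<Longrightarrow> P (\<lambda>x. f x * g x) x = P f x * g x + f x * P g x"
  using P cdir_mult[OF S, of x f g] unfolding fo_op_def by fastforce

lemma cmult: "x \<in> S \<Longrightarrow> smooth_on S f \<Longrightarrow> P (\<lambda>x. c * f x) x = c * P f x"
  by (simp add: mult const)

lemma sum: "x \<in> S \<Longrightarrow> (\<And>i. smooth_on S (F i)) \<Longrightarrow> P (\<lambda>x. \<Sum>i\<in>I. F i x) x = (\<Sum>i\<in>I. P (F i) x)"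
  using P cdir_sum[OF S, of x I F] unfolding fo_op_def by fastforce

lemmas rules = add diff mult sum cmult const

end

lemma fo_op_commute:
  assumes "fo_op P" "fo_op Q" "open S" "x \<in> S" "smooth_on S f"
  shows "P (Q f) x = Q (P f) x"
  using assms(1,2) cdir_commute[OF assms(3-5)] unfolding fo_op_def by fastforce

text \<open>Here \<open>\<partial>\<^sub>i\<close>, \<open>\<partial>-bar\<^sub>i\<close> and \<open>\<partial>\<^sub>t\<close> act on functions of time and space jointly, so that they
  commute with each other on smooth functions.\<close>

definition wz :: "'n \<Rightarrow> (real \<times> (complex^'n::finite) \<Rightarrow> complex) \<Rightarrow> real \<times> (complex^'n) \<Rightarrow> complex" where
  "wz i = cdir (1/2) (0, axis i 1) (- \<i>/2) (0, axis i \<i>)"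

definition wb :: "'n \<Rightarrow> (real \<times> (complex^'n::finite) \<Rightarrow> complex) \<Rightarrow> real \<times> (complex^'n) \<Rightarrow> complex" where
  "wb i = cdir (1/2) (0, axis i 1) (\<i>/2) (0, axis i \<i>)"

definition dt :: "(real \<times> (complex^'n::finite) \<Rightarrow> complex) \<Rightarrow> real \<times> (complex^'n) \<Rightarrow> complex" where
  "dt = cdir 1 (1, 0) 0 (1, 0)"

lemma fo_ops [simp]: "fo_op (wz i)" "fo_op (wb i)" "fo_op dt"
  unfolding fo_op_def wz_def wb_def dt_def by blast+

text \<open>A time-dependent metric in one chart. Within the locale, \<open>H i j\<close> is the inverse \<open>h\<^bsup>i j-bar\<^esup>\<close>.\<close>

locale spacetime_metric =
  fixes S :: "(real \<times> (complex^'n::finite)) set" and G :: "'n \<Rightarrow> 'n \<Rightarrow> real \<times> (complex^'n) \<Rightarrow> complex"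
  assumes open_S: "open S" and smooth_G: "\<And>i j. smooth_on S (G i j)"
    and pd: "\<And>x. x \<in> S \<Longrightarrow> hermitian_pd (\<lambda>i j. G i j x)"
begin

sublocale wz: first_order_op S "wz i" for i by unfold_locales (simp_all add: open_S)
sublocale wb: first_order_op S "wb i" for i by unfold_locales (simp_all add: open_S)
sublocale dt: first_order_op S dt by unfold_locales (simp_all add: open_S)

lemma cnj_wz: "x \<in> S \<Longrightarrow> smooth_on S f \<Longrightarrow> wz i (\<lambda>x. cnj (f x)) x = cnj (wb i f x)"
  unfolding wz_def wb_def using cdir_cnj[OF open_S] by fastforce

lemma cnj_wb: "x \<in> S \<Longrightarrow> smooth_on S f \<Longrightarrow> wb i (\<lambda>x. cnj (f x)) x = cnj (wz i f x)"
  unfolding wz_def wb_def using cdir_cnj[OF open_S] by fastforce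

lemma cnj_dt: "x \<in> S \<Longrightarrow> smooth_on S f \<Longrightarrow> dt (\<lambda>x. cnj (f x)) x = cnj (dt f x)"
  unfolding dt_def using cdir_cnj[OF open_S] by fastforce

definition H :: "'n \<Rightarrow> 'n \<Rightarrow> real \<times> (complex^'n) \<Rightarrow> complex" where
  "H i j x = minv (\<lambda>k l. G k l x) i j"

lemma smooth_H: "smooth_on S (H i j)"
  unfolding H_def[abs_def] by (rule smooth_on_minv[OF smooth_G pd])

lemma H_right: "x \<in> S \<Longrightarrow> (\<Sum>j\<in>UNIV. H i j x * G k j x) = (if i = k then 1 else 0)"
  unfolding H_def by (rule minv_right[OF pd])

lemma H_left: "x \<in> S \<Longrightarrow> (\<Sum>i\<in>UNIV. H i j x * G i l x) = (if j = l then 1 else 0)"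
  unfolding H_def by (rule minv_left[OF pd])

lemma H_herm: "x \<in> S \<Longrightarrow> cnj (H i j x) = H j i x"
  unfolding H_def by (rule minv_hermitian[OF pd])

lemma G_herm: "x \<in> S \<Longrightarrow> cnj (G i j x) = G j i x"
  using pd unfolding hermitian_pd_def by blast

lemmas smooths = smooth_G smooth_H wz.smooth wb.smooth dt.smooth smooth_on_sum smooth_on_mult smooth_on_add smooth_on_diff smooth_on_cnj

lemma wb_H: "x \<in> S \<Longrightarrow> wb n (H i j) x = cnj (wz n (H j i) x)"
  using wb.cong[of x "H i j" "\<lambda>y. cnj (H j i y)"] cnj_wb[OF _ smooth_H] H_herm by simp

text \<open>With matrices, the index bookkeeping for differentiating an inverse disappears: \<open>Gmat P\<close> and
  \<open>Kmat P\<close> are \<open>P\<close> applied entrywise to \<open>G\<close> and to \<open>K = G\<^sup>-\<^sup>1\<close>, and \<open>P = id\<close> gives the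
  matrices themselves. The entries of \<open>K\<close> are those of \<open>H\<close> transposed.\<close>

definition Gmat :: "((real \<times> (complex^'n) \<Rightarrow> complex) \<Rightarrow> real \<times> (complex^'n) \<Rightarrow> complex) \<Rightarrow> real \<times> (complex^'n) \<Rightarrow> complex^'n^'n" where
  "Gmat P x = (\<chi> k l. P (G k l) x)"

definition Kmat :: "((real \<times> (complex^'n) \<Rightarrow> complex) \<Rightarrow> real \<times> (complex^'n) \<Rightarrow> complex) \<Rightarrow> real \<times> (complex^'n) \<Rightarrow> complex^'n^'n" where
  "Kmat P x = (\<chi> j i. P (H i j) x)"

lemma Kmat_Gmat:
  assumes "x \<in> S"
  shows "Kmat id x ** Gmat id x = mat 1" "Gmat id x ** Kmat id x = mat 1"
proof -
  show "Kmat id x ** Gmat id x = mat 1"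
    using H_left[OF assms] by (simp add: Kmat_def Gmat_def matrix_matrix_mult_def mat_def vec_eq_iff)
  then show "Gmat id x ** Kmat id x = mat 1" using matrix_left_right_inverse by blast
qed

lemma inverse_deriv1:
  assumes x: "x \<in> S" and P: "fo_op P"
  shows "Kmat P x ** Gmat id x + Kmat id x ** Gmat P x = 0"
proof -
  interpret P: first_order_op S P by unfold_locales (simp_all add: open_S P)
  have "(\<Sum>i\<in>UNIV. P (H i j) x * G i l x) + (\<Sum>i\<in>UNIV. H i j x * P (G i l) x) = 0" for j l
  proof -
    have "P (\<lambda>x. \<Sum>i\<in>UNIV. H i j x * G i l x) x = P (\<lambda>_. if j = l then 1 else 0) x"
      by (intro P.cong x H_left)
    then show ?thesis
      by (simp add: P.rules x smooths sum.distrib)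
  qed
  then show ?thesis by (simp add: Kmat_def Gmat_def matrix_matrix_mult_def vec_eq_iff)
qed

lemma inverse_deriv2:
  assumes x: "x \<in> S" and P: "fo_op P" and Q: "fo_op Q"
  shows "Kmat (\<lambda>f. P (Q f)) x ** Gmat id x + Kmat Q x ** Gmat P x + Kmat P x ** Gmat Q x + Kmat id x ** Gmat (\<lambda>f. P (Q f)) x = 0"
proof -
  interpret P: first_order_op S P by unfold_locales (simp_all add: open_S P)
  interpret Q: first_order_op S Q by unfold_locales (simp_all add: open_S Q)
  have "(\<Sum>i\<in>UNIV. P (Q (H i j)) x * G i l x) + (\<Sum>i\<in>UNIV. Q (H i j) x * P (G i l) x)
     + (\<Sum>i\<in>UNIV. P (H i j) x * Q (G i l) x) + (\<Sum>i\<in>UNIV. H i j x * P (Q (G i l)) x) = 0" for j l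
  proof -
    have "Q (\<lambda>x. \<Sum>i\<in>UNIV. H i j x * G i l x) y = Q (\<lambda>_. if j = l then 1 else 0) y" if "y \<in> S" for y
      by (intro Q.cong that H_left)
    then have "(\<Sum>i\<in>UNIV. Q (H i j) y * G i l y + H i j y * Q (G i l) y) = 0" if "y \<in> S" for y
      using that by (simp add: Q.rules smooths)
    then have "P (\<lambda>y. \<Sum>i\<in>UNIV. Q (H i j) y * G i l y + H i j y * Q (G i l) y) x = P (\<lambda>_. 0) x"
      by (intro P.cong x)
    then show ?thesis
      by (simp add: P.rules x smooths Q.smooth sum.distrib add.assoc)
  qed
  then show ?thesis by (simp add: Kmat_def Gmat_def matrix_matrix_mult_def vec_eq_iff)
qed

lemma inverse_conj_deriv1:
  assumes x: "x \<in> S" and P: "fo_op P"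
  shows "Gmat P x ** Kmat id x = - (Gmat id x ** Kmat P x)" "Kmat id x ** Gmat P x = - (Kmat P x ** Gmat id x)"
    "Kmat id x ** Gmat P x ** Kmat id x = - Kmat P x"
proof -
  note inv = Kmat_Gmat[OF x]
  show 1: "Kmat id x ** Gmat P x = - (Kmat P x ** Gmat id x)"
    using inverse_deriv1[OF x P] by (simp add: eq_neg_iff_add_eq_0 add.commute)
  have "Gmat P x ** Kmat id x = Gmat id x ** (Kmat id x ** Gmat P x) ** Kmat id x"
    by (simp add: matrix_mul_assoc inv)
  also have "\<dots> = - (Gmat id x ** Kmat P x ** (Gmat id x ** Kmat id x))"
    unfolding 1 by (simp only: matrix_neg_left matrix_neg_right matrix_mul_assoc)
  finally show "Gmat P x ** Kmat id x = - (Gmat id x ** Kmat P x)" by (simp add: inv)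
  show "Kmat id x ** Gmat P x ** Kmat id x = - Kmat P x"
    unfolding 1 by (simp only: matrix_neg_left matrix_mul_assoc[symmetric] inv matrix_mul_rid)
qed

text \<open>Differentiating \<open>K G = 1\<close> twice yields \<open>- K (P Q G) K = P Q K\<close> up to two quadratic terms, one for each
  order of the factors \<open>P K\<close> and \<open>Q K\<close>. The quadratic term of the curvature cancels one of them.\<close>

lemma raised_curvature_matrix:
  assumes x: "x \<in> S" and P: "fo_op P" and Q: "fo_op Q"
  shows "Kmat id x ** (Gmat P x ** Kmat id x ** Gmat Q x - Gmat (\<lambda>f. P (Q f)) x) ** Kmat id x
     = Kmat (\<lambda>f. P (Q f)) x - Kmat Q x ** Gmat id x ** Kmat P x"
proof -
  define K g where "K = Kmat id x" "g = Gmat id x"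
  define A B C a b e where "A = Kmat P x" "B = Kmat Q x" "C = Kmat (\<lambda>f. P (Q f)) x"
    "a = Gmat P x" "b = Gmat Q x" "e = Gmat (\<lambda>f. P (Q f)) x"
  note defs = K_g_def A_B_C_a_b_e_def
  have inv: "K ** g = mat 1" "g ** K = mat 1" using Kmat_Gmat[OF x] by (simp_all add: defs)
  have 1: "a ** K = - (g ** A)" "b ** K = - (g ** B)" "K ** a = - (A ** g)"
    using inverse_conj_deriv1[OF x P] inverse_conj_deriv1[OF x Q] by (simp_all add: defs)
  have 2: "C ** g + B ** a + A ** b + K ** e = 0"
    using inverse_deriv2[OF x P Q] by (simp add: defs)
  then have e: "K ** e = - (C ** g + B ** a + A ** b)"
    by (simp only: eq_neg_iff_add_eq_0 add.commute[of "K ** e"])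
  have "K ** (a ** K ** b - e) ** K = (K ** a) ** K ** (b ** K) - K ** e ** K"
    by (simp only: matrix_sub_ldistrib' matrix_sub_rdistrib' matrix_mul_assoc)
  also have "\<dots> = A ** (g ** K) ** g ** B + (C ** (g ** K) + B ** a ** K + A ** b ** K)"
    unfolding e unfolding 1(3) 1(2)
    by (simp only: matrix_neg_left matrix_neg_right matrix_mul_assoc matrix_add_rdistrib' minus_minus diff_minus_eq_add)
  also have "\<dots> = C - B ** g ** A"
    unfolding inv matrix_mul_assoc[of B a K, symmetric] matrix_mul_assoc[of A b K, symmetric] 1
    by (simp add: matrix_neg_right matrix_mul_assoc)
  finally show ?thesis by (simp add: defs)
qed

definition Om :: "'n \<Rightarrow> 'n \<Rightarrow> 'n \<Rightarrow> 'n \<Rightarrow> real \<times> (complex^'n) \<Rightarrow> complex" where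
  "Om m n i j x = - wz m (wb n (G i j)) x + (\<Sum>\<Sum>p s. H p s x * wb n (G p j) x * wz m (G i s) x)"

lemma Om_matrix: "(\<chi> i j. Om m n i j x) = Gmat (wz m) x ** Kmat id x ** Gmat (wb n) x - Gmat (\<lambda>f. wz m (wb n f)) x"
proof -
  have "(Gmat (wz m) x ** Kmat id x ** Gmat (wb n) x) $ i $ j
     = (\<Sum>\<Sum>p s. H p s x * wb n (G p j) x * wz m (G i s) x)" for i j
    by (simp add: matrix_matrix_mult_def Gmat_def Kmat_def sum_distrib_left sum_distrib_right mult_ac)
  then show ?thesis by (simp add: vec_eq_iff Om_def) (simp add: Gmat_def)
qed

lemma conj_entry: "(Kmat id x ** (\<chi> i j. X i j) ** Kmat id x) $ b $ a = (\<Sum>\<Sum>i j. H i b x * X i j * H a j x)"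
proof -
  have "(Kmat id x ** (\<chi> i j. X i j) ** Kmat id x) $ b $ a = (\<Sum>\<Sum>j i. H i b x * X i j * H a j x)"
    by (simp add: matrix_matrix_mult_def Kmat_def sum_distrib_right)
  then show ?thesis by (subst sum.swap)
qed

lemma raised_Om:
  assumes x: "x \<in> S"
  shows "(\<Sum>\<Sum>i j. H i b x * Om m n i j x * H a j x)
     = wz m (wb n (H a b)) x - (\<Sum>\<Sum>p s. wb n (H p b) x * G p s x * wz m (H a s) x)"
proof -
  have "(Kmat (wb n) x ** Gmat id x ** Kmat (wz m) x) $ b $ a
     = (\<Sum>\<Sum>s p. wb n (H p b) x * G p s x * wz m (H a s) x)"
    by (simp add: matrix_matrix_mult_def Kmat_def Gmat_def sum_distrib_right)
  also have "\<dots> = (\<Sum>\<Sum>p s. wb n (H p b) x * G p s x * wz m (H a s) x)"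
    by (rule sum.swap)
  finally show ?thesis
    unfolding conj_entry[symmetric] Om_matrix raised_curvature_matrix[OF x fo_ops(1,2)]
    by (simp add: Kmat_def)
qed

definition T :: "'n \<Rightarrow> 'n \<Rightarrow> 'n \<Rightarrow> real \<times> (complex^'n) \<Rightarrow> complex" where
  "T m p j x = wz m (G p j) x - wz p (G m j) x"

definition S2 :: "'n \<Rightarrow> 'n \<Rightarrow> real \<times> (complex^'n) \<Rightarrow> complex" where
  "S2 i j x = (\<Sum>\<Sum>m n. H m n x * Om m n i j x)"

definition Q :: "'n \<Rightarrow> 'n \<Rightarrow> real \<times> (complex^'n) \<Rightarrow> complex" where
  "Q i j x = (1/2) * (\<Sum>\<Sum>m n p s. H m n x * H p s x * T m p j x * cnj (T n s i x))"

text \<open>With the Christoffel symbols \<open>C\<close> the torsion is \<open>C m a p - C p a m\<close>. Of the four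
  products in the square of the torsion two and two agree by symmetry. The first kind is the quadratic term
  of the curvature from \<open>raised_Om\<close>, the second kind becomes a product of first derivatives of \<open>h\<close>
  because \<open>C\<close> contracted with \<open>h\<close> is \<open>- \<partial>h\<close>.\<close>

lemma raised_Q:
  assumes x: "x \<in> S"
  shows "(\<Sum>\<Sum>i j. H i b x * Q i j x * H a j x)
     = (\<Sum>\<Sum>m n. H m n x * (\<Sum>\<Sum>p s. wb n (H p b) x * G p s x * wz m (H a s) x))
      - (\<Sum>\<Sum>m s. wz m (H a s) x * wb s (H m b) x)"
proof -
  define C where "C m a p = (\<Sum>j\<in>UNIV. H a j x * wz m (G p j) x)" for m a p
  have C1: "(\<Sum>p\<in>UNIV. H p s x * C m a p) = - wz m (H a s) x" for m a s
  proof -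
    have "(\<Sum>p\<in>UNIV. H p s x * C m a p) = (Kmat id x ** Gmat (wz m) x ** Kmat id x) $ s $ a"
      unfolding Gmat_def conj_entry C_def by (simp add: sum_distrib_left mult_ac)
    also have "\<dots> = - wz m (H a s) x"
      unfolding inverse_conj_deriv1(3)[OF x fo_ops(1)] by (simp add: Kmat_def)
    finally show ?thesis .
  qed
  have C2: "C m a p = - (\<Sum>s\<in>UNIV. G p s x * wz m (H a s) x)" for m a p
  proof -
    have "C m a p = (Gmat (wz m) x ** Kmat id x) $ p $ a"
      by (simp add: C_def matrix_matrix_mult_def Gmat_def Kmat_def mult.commute)
    also have "\<dots> = - (\<Sum>s\<in>UNIV. G p s x * wz m (H a s) x)"
      unfolding inverse_conj_deriv1(1)[OF x fo_ops(1)]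
      by (simp add: matrix_matrix_mult_def Gmat_def Kmat_def)
    finally show ?thesis .
  qed
  have CT: "C m a p - C p a m = (\<Sum>j\<in>UNIV. H a j x * T m p j x)" for m a p
    by (simp add: C_def T_def right_diff_distrib sum_subtractf)
  have CT': "cnj (C n b s - C s b n) = (\<Sum>i\<in>UNIV. H i b x * cnj (T n s i x))" for n s
    unfolding CT by (simp add: H_herm[OF x])
  define X where "X m n p s = H m n x * H p s x * C m a p * cnj (C n b s)" for m n p s
  define Y where "Y m n p s = H m n x * H p s x * C m a p * cnj (C s b n)" for m n p s
  have sw: "(\<Sum>\<Sum>m n p s. F p s m n) = (\<Sum>\<Sum>m n p s. F m n p s)"
    for F :: "'n \<Rightarrow> 'n \<Rightarrow> 'n \<Rightarrow> 'n \<Rightarrow> complex"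
    unfolding sum.cartesian_product
    by (rule sum.reindex_bij_witness[where i="\<lambda>(m,n,p,s). (p,s,m,n)" and j="\<lambda>(m,n,p,s). (p,s,m,n)"]) auto
  have "(\<Sum>\<Sum>i j. H i b x * Q i j x * H a j x)
     = (\<Sum>\<Sum>i j m n p s. (1/2) * (H m n x * H p s x * ((H a j x * T m p j x) * (H i b x * cnj (T n s i x)))))"
    unfolding Q_def by (simp add: sum_distrib_left sum_distrib_right mult_ac)
  also have "\<dots> = (\<Sum>\<Sum>m n p s j i. (1/2) * (H m n x * H p s x * ((H a j x * T m p j x) * (H i b x * cnj (T n s i x)))))"
    unfolding sum.cartesian_product
    by (rule sum.reindex_bij_witness[where i="\<lambda>(m,n,p,s,j,i). (i,j,m,n,p,s)" and j="\<lambda>(i,j,m,n,p,s). (m,n,p,s,j,i)"]) auto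
  also have "\<dots> = (\<Sum>\<Sum>m n p s. (1/2) * (H m n x * H p s x * ((C m a p - C p a m) * cnj (C n b s - C s b n))))"
    unfolding CT' unfolding CT sum_product by (simp only: sum_distrib_left)
  also have "\<dots> = (\<Sum>\<Sum>m n p s. (1/2) * ((X m n p s + X p s m n) - (Y m n p s + Y p s m n)))"
    by (intro sum.cong refl) (simp add: X_def Y_def algebra_simps)
  also have "\<dots> = (\<Sum>\<Sum>m n p s. X m n p s) - (\<Sum>\<Sum>m n p s. Y m n p s)"
    unfolding sum_distrib_left[symmetric] sum_subtractf sum.distrib sw[of X] sw[of Y] by simp
  also have "(\<Sum>\<Sum>m n p s. X m n p s)
     = (\<Sum>\<Sum>m n. H m n x * (\<Sum>s\<in>UNIV. (\<Sum>p\<in>UNIV. H p s x * C m a p) * cnj (C n b s)))"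
  proof -
    have "(\<Sum>\<Sum>p s. X m n p s) = (\<Sum>\<Sum>s p. X m n p s)" for m n by (rule sum.swap)
    then show ?thesis by (simp add: X_def sum_distrib_left sum_distrib_right mult_ac)
  qed
  also have "\<dots> = (\<Sum>\<Sum>m n. H m n x * (\<Sum>\<Sum>p s. wb n (H p b) x * G p s x * wz m (H a s) x))"
  proof -
    have "(\<Sum>s\<in>UNIV. (\<Sum>p\<in>UNIV. H p s x * C m a p) * cnj (C n b s))
      = (\<Sum>\<Sum>s p. wb n (H p b) x * G p s x * wz m (H a s) x)" for m n
      unfolding C1 unfolding C2 by (simp add: G_herm[OF x] wb_H[OF x] sum_distrib_left sum_negf mult_ac)
    moreover have "(\<Sum>\<Sum>s p. wb n (H p b) x * G p s x * wz m (H a s) x) = (\<Sum>\<Sum>p s. wb n (H p b) x * G p s x * wz m (H a s) x)" for m n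
      by (rule sum.swap)
    ultimately show ?thesis by simp
  qed
  also have "(\<Sum>\<Sum>m n p s. Y m n p s)
     = (\<Sum>\<Sum>m s. (\<Sum>p\<in>UNIV. H p s x * C m a p) * cnj (\<Sum>n\<in>UNIV. H n m x * C s b n))"
  proof -
    have "(\<Sum>\<Sum>n p s. Y m n p s) = (\<Sum>\<Sum>s p n. Y m n p s)" for m
      unfolding sum.cartesian_product
      by (rule sum.reindex_bij_witness[where i="\<lambda>(s,p,n). (n,p,s)" and j="\<lambda>(n,p,s). (s,p,n)"]) auto
    then show ?thesis by (simp add: Y_def sum_product H_herm[OF x] mult_ac)
  qed
  also have "\<dots> = (\<Sum>\<Sum>m s. wz m (H a s) x * wb s (H m b) x)"
    unfolding C1 by (simp add: wb_H[OF x])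
  finally show ?thesis .
qed

end

locale spacetime_HCF = spacetime_metric +
  assumes flow: "\<And>x i j. x \<in> S \<Longrightarrow> dt (G i j) x = - S2 i j x - Q i j x"
begin

text \<open>As \<open>\<partial>\<^sub>t K = - K (\<partial>\<^sub>t G) K\<close>, the right-hand side is the sum of the raised tensors \<open>S\<^sup>(\<^sup>2\<^sup>)\<close> and
  \<open>Q\<close>. The quadratic term of the first cancels against one half of the second; this is what
  distinguishes this particular choice of \<open>Q\<close>.\<close>

lemma flow_H:
  assumes x: "x \<in> S"
  shows "dt (H a b) x = (\<Sum>\<Sum>m n. H m n x * wz m (wb n (H a b)) x)
           - (\<Sum>\<Sum>m s. wz m (H a s) x * wb s (H m b) x)"
proof -
  have "dt (H a b) x = - ((Kmat id x ** Gmat dt x ** Kmat id x) $ b $ a)"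
    unfolding inverse_conj_deriv1(3)[OF x fo_ops(3)] by (simp add: Kmat_def)
  also have "\<dots> = (\<Sum>\<Sum>i j. H i b x * S2 i j x * H a j x) + (\<Sum>\<Sum>i j. H i b x * Q i j x * H a j x)"
    unfolding Gmat_def conj_entry by (simp add: flow[OF x] algebra_simps sum.distrib sum_subtractf sum_negf)
  also have "(\<Sum>\<Sum>i j. H i b x * S2 i j x * H a j x)
     = (\<Sum>\<Sum>m n. H m n x * (\<Sum>\<Sum>i j. H i b x * Om m n i j x * H a j x))"
  proof -
    have "(\<Sum>\<Sum>i j. H i b x * S2 i j x * H a j x)
      = (\<Sum>\<Sum>i j m n. H m n x * (H i b x * Om m n i j x * H a j x))"
      by (simp add: S2_def sum_distrib_left sum_distrib_right mult_ac)
    also have "\<dots> = (\<Sum>\<Sum>m n i j. H m n x * (H i b x * Om m n i j x * H a j x))"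
      unfolding sum.cartesian_product
      by (rule sum.reindex_bij_witness[where i="\<lambda>(m,n,i,j). (i,j,m,n)" and j="\<lambda>(i,j,m,n). (m,n,i,j)"]) auto
    finally show ?thesis by (simp add: sum_distrib_left)
  qed
  finally show ?thesis
    unfolding raised_Om[OF x] raised_Q[OF x]
    by (simp add: right_diff_distrib sum_subtractf)
qed

end

section \<open>Evolution of the second scalar curvature\<close>

lemma sum_pull3: "(\<Sum>q\<in>UNIV. c q * (\<Sum>\<Sum>m n. F q m n)) = (\<Sum>\<Sum>m n q. c q * (F q m n :: complex))"
  for F :: "'n::finite \<Rightarrow> 'n \<Rightarrow> 'n \<Rightarrow> complex"
proof -
  have "(\<Sum>q\<in>UNIV. c q * (\<Sum>\<Sum>m n. F q m n)) = (\<Sum>\<Sum>q m n. c q * F q m n)"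
    by (simp add: sum_distrib_left)
  also have "\<dots> = (\<Sum>\<Sum>m n q. c q * F q m n)"
    unfolding sum.cartesian_product
    by (rule sum.reindex_bij_witness[where i="\<lambda>(m,n,q). (q,m,n)" and j="\<lambda>(q,m,n). (m,n,q)"]) auto
  finally show ?thesis .
qed

lemma sum_rot3: "(\<Sum>\<Sum>q m n. F q m n) = (\<Sum>\<Sum>m n q. (F q m n :: complex))"
  for F :: "'n::finite \<Rightarrow> 'n \<Rightarrow> 'n \<Rightarrow> complex"
  using sum_pull3[of "\<lambda>_. 1" F] by simp

lemma sum_rev3: "(\<Sum>\<Sum>q m n. F q m n) = (\<Sum>\<Sum>n m q. (F q m n :: complex))"
  for F :: "'n::finite \<Rightarrow> 'n \<Rightarrow> 'n \<Rightarrow> complex"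
  unfolding sum.cartesian_product
  by (rule sum.reindex_bij_witness[where i="\<lambda>(n,m,q). (q,m,n)" and j="\<lambda>(q,m,n). (n,m,q)"]) auto

context spacetime_metric
begin

text \<open>The divergence of \<open>h\<close> in its first index, its conjugate, and the double divergence.
  Derivatives of \<open>h\<close> enter the second scalar curvature only in these combinations.\<close>

definition D :: "'n \<Rightarrow> real \<times> (complex^'n) \<Rightarrow> complex" where
  "D j x = (\<Sum>i\<in>UNIV. wz i (H i j) x)"

definition Db :: "'n \<Rightarrow> real \<times> (complex^'n) \<Rightarrow> complex" where
  "Db i x = (\<Sum>j\<in>UNIV. wb j (H i j) x)"

definition DD :: "real \<times> (complex^'n) \<Rightarrow> complex" where
  "DD x = (\<Sum>j\<in>UNIV. wb j (D j) x)"

definition lap :: "(real \<times> (complex^'n) \<Rightarrow> complex) \<Rightarrow> real \<times> (complex^'n) \<Rightarrow> complex" where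
  "lap f x = (\<Sum>\<Sum>m n. H m n x * wz m (wb n f) x)"

definition heat :: "(real \<times> (complex^'n) \<Rightarrow> complex) \<Rightarrow> real \<times> (complex^'n) \<Rightarrow> complex" where
  "heat f x = dt f x - lap f x"

lemma smooth_D: "smooth_on S (D j)"
  unfolding D_def[abs_def] by (intro smooths)

lemma smooth_Db: "smooth_on S (Db i)"
  unfolding Db_def[abs_def] by (intro smooths)

lemma smooth_DD: "smooth_on S DD"
  unfolding DD_def[abs_def] by (intro smooths smooth_D)

lemmas commute = fo_op_commute[OF fo_ops(1) fo_ops(1) open_S] fo_op_commute[OF fo_ops(2) fo_ops(2) open_S]
  fo_op_commute[OF fo_ops(2) fo_ops(1) open_S] fo_op_commute[OF fo_ops(3) fo_ops(1) open_S] fo_op_commute[OF fo_ops(3) fo_ops(2) open_S]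

lemma Db_cnj: "x \<in> S \<Longrightarrow> Db i x = cnj (D i x)"
  by (simp add: D_def Db_def wb_H)

lemma wz_wb_D:
  assumes x: "x \<in> S"
  shows "wz m (wb n (D j)) x = (\<Sum>i\<in>UNIV. wz i (wz m (wb n (H i j))) x)"
proof -
  have "wb n (D j) y = (\<Sum>i\<in>UNIV. wz i (wb n (H i j)) y)" if "y \<in> S" for y
    unfolding D_def[abs_def] by (simp add: wb.rules that smooths commute(3)[OF that])
  then have "wz m (wb n (D j)) x = wz m (\<lambda>y. \<Sum>i\<in>UNIV. wz i (wb n (H i j)) y) x"
    by (intro wz.cong x)
  also have "\<dots> = (\<Sum>i\<in>UNIV. wz m (wz i (wb n (H i j))) x)"
    by (simp add: wz.rules x smooths)
  also have "\<dots> = (\<Sum>i\<in>UNIV. wz i (wz m (wb n (H i j))) x)"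
    by (intro sum.cong refl commute(1) x smooths)
  finally show ?thesis .
qed

lemma wz_D:
  assumes x: "x \<in> S"
  shows "wz m (D j) x = (\<Sum>i\<in>UNIV. wz i (wz m (H i j)) x)"
proof -
  have "wz m (D j) x = (\<Sum>i\<in>UNIV. wz m (wz i (H i j)) x)"
    unfolding D_def[abs_def] by (simp add: wz.rules x smooths)
  also have "\<dots> = (\<Sum>i\<in>UNIV. wz i (wz m (H i j)) x)"
    by (intro sum.cong refl commute(1) x smooths)
  finally show ?thesis .
qed

lemma wb_Db:
  assumes x: "x \<in> S"
  shows "wb n (Db m) x = (\<Sum>j\<in>UNIV. wb j (wb n (H m j)) x)"
proof -
  have "wb n (Db m) x = (\<Sum>j\<in>UNIV. wb n (wb j (H m j)) x)"
    unfolding Db_def[abs_def] by (simp add: wb.rules x smooths)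
  also have "\<dots> = (\<Sum>j\<in>UNIV. wb j (wb n (H m j)) x)"
    by (intro sum.cong refl commute(2) x smooths)
  finally show ?thesis .
qed

lemma wz_wb_DD:
  assumes x: "x \<in> S"
  shows "wz m (wb n DD) x = (\<Sum>j\<in>UNIV. wb j (wz m (wb n (D j))) x)"
proof -
  have "wb n DD y = (\<Sum>j\<in>UNIV. wb j (wb n (D j)) y)" if "y \<in> S" for y
    unfolding DD_def[abs_def]
    by (simp add: wb.rules that smooths smooth_D commute(2)[OF that, of _ n])
  then have "wz m (wb n DD) x = wz m (\<lambda>y. \<Sum>j\<in>UNIV. wb j (wb n (D j)) y) x"
    by (intro wz.cong x)
  also have "\<dots> = (\<Sum>j\<in>UNIV. wz m (wb j (wb n (D j))) x)"
    by (simp add: wz.rules x smooths smooth_D)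
  also have "\<dots> = (\<Sum>j\<in>UNIV. wb j (wz m (wb n (D j))) x)"
    by (intro sum.cong refl commute(3)[symmetric] x smooths smooth_D)
  finally show ?thesis .
qed

lemma wz_wb_rules:
  assumes x: "x \<in> S"
  shows "smooth_on S f \<Longrightarrow> smooth_on S g \<Longrightarrow> wz m (wb n (\<lambda>x. f x + g x)) x = wz m (wb n f) x + wz m (wb n g) x"
    "smooth_on S f \<Longrightarrow> smooth_on S g \<Longrightarrow> wz m (wb n (\<lambda>x. f x - g x)) x = wz m (wb n f) x - wz m (wb n g) x"
    "smooth_on S f \<Longrightarrow> wz m (wb n (\<lambda>x. c * f x)) x = c * wz m (wb n f) x"
    "(\<And>i. smooth_on S (F i)) \<Longrightarrow> wz m (wb n (\<lambda>x. \<Sum>i\<in>I. F i x)) x = (\<Sum>i\<in>I. wz m (wb n (F i)) x)"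
proof -
  assume f: "smooth_on S f"
  show "wz m (wb n (\<lambda>x. c * f x)) x = c * wz m (wb n f) x"
    using wz.cong[OF x wb.cmult[OF _ f]] wz.cmult[OF x wb.smooth[OF f]] by simp
  assume g: "smooth_on S g"
  show "wz m (wb n (\<lambda>x. f x + g x)) x = wz m (wb n f) x + wz m (wb n g) x"
    using wz.cong[OF x wb.add[OF _ f g]] wz.add[OF x wb.smooth[OF f] wb.smooth[OF g]] by simp
  show "wz m (wb n (\<lambda>x. f x - g x)) x = wz m (wb n f) x - wz m (wb n g) x"
    using wz.cong[OF x wb.diff[OF _ f g]] wz.diff[OF x wb.smooth[OF f] wb.smooth[OF g]] by simp
next
  assume F: "\<And>i. smooth_on S (F i)"
  show "wz m (wb n (\<lambda>x. \<Sum>i\<in>I. F i x)) x = (\<Sum>i\<in>I. wz m (wb n (F i)) x)"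
  proof -
    have "wz m (wb n (\<lambda>x. \<Sum>i\<in>I. F i x)) x = wz m (\<lambda>y. \<Sum>i\<in>I. wb n (F i) y) x"
      by (intro wz.cong x wb.sum F)
    also have "\<dots> = (\<Sum>i\<in>I. wz m (wb n (F i)) x)"
      by (intro wz.sum x wb.smooth F)
    finally show ?thesis .
  qed
qed

lemma heat_rules:
  assumes x: "x \<in> S"
  shows "smooth_on S f \<Longrightarrow> smooth_on S g \<Longrightarrow> heat (\<lambda>x. f x + g x) x = heat f x + heat g x"
    "smooth_on S f \<Longrightarrow> smooth_on S g \<Longrightarrow> heat (\<lambda>x. f x - g x) x = heat f x - heat g x"
    "smooth_on S f \<Longrightarrow> heat (\<lambda>x. c * f x) x = c * heat f x"
  unfolding heat_def lap_def
  by (simp_all add: dt.rules x wz_wb_rules sum.distrib sum_subtractf algebra_simps sum_distrib_left)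

lemma heat_sum:
  assumes x: "x \<in> S" and F: "\<And>i. smooth_on S (F i)"
  shows "heat (\<lambda>x. \<Sum>i\<in>I. F i x) x = (\<Sum>i\<in>I. heat (F i) x)"
proof (induction I rule: infinite_finite_induct)
  case (insert i I)
  then show ?case using heat_rules(1)[OF x F smooth_on_sum[of I S F, OF F]] by simp
qed (simp_all add: heat_def lap_def dt.const wb.const[abs_def] wz.const)

lemma heat_cnj:
  assumes x: "x \<in> S" and f: "smooth_on S f"
  shows "heat (\<lambda>x. cnj (f x)) x = cnj (heat f x)"
proof -
  have "wz m (wb n (\<lambda>x. cnj (f x))) x = cnj (wz n (wb m f) x)" for m n
  proof -
    have "wz m (wb n (\<lambda>x. cnj (f x))) x = wz m (\<lambda>x. cnj (wz n f x)) x"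
      by (intro wz.cong x cnj_wb f)
    also have "\<dots> = cnj (wz n (wb m f) x)"
      by (simp add: cnj_wz x wz.smooth f commute(3))
    finally show ?thesis .
  qed
  then have "lap (\<lambda>x. cnj (f x)) x = (\<Sum>\<Sum>m n. cnj (H n m x * wz n (wb m f) x))"
    by (simp add: lap_def H_herm[OF x])
  also have "\<dots> = cnj (lap f x)" unfolding lap_def by (subst sum.swap) simp
  finally show ?thesis by (simp add: heat_def cnj_dt x f)
qed

lemma heat_cong:
  assumes x: "x \<in> S" and "\<And>y. y \<in> S \<Longrightarrow> f y = g y"
  shows "heat f x = heat g x"
proof -
  have "wz m (wb n f) x = wz m (wb n g) x" for m n
    by (intro wz.cong wb.cong x assms)
  then show ?thesis unfolding heat_def lap_def using dt.cong[OF x assms(2)] by simp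
qed

definition sc :: "real \<times> (complex^'n) \<Rightarrow> complex" where
  "sc x = (\<Sum>\<Sum>i j k l. H i l x * H k j x * Om i j k l x)"

text \<open>The second scalar curvature contracts the form indices of \<open>\<Omega>\<close> with its endomorphism indices, so
  that in \<open>raised_Om\<close> every derivative of \<open>h\<close> is contracted with an index of \<open>h\<close>.\<close>

lemma sc_divergence:
  assumes x: "x \<in> S"
  shows "sc x = DD x - (\<Sum>\<Sum>p l. G p l x * D l x * Db p x)"
proof -
  have "sc x = (\<Sum>\<Sum>i j k l. H k j x * Om i j k l x * H i l x)"
    unfolding sc_def by (simp add: mult_ac)
  also have "\<dots> = (\<Sum>\<Sum>i j. wz i (wb j (H i j)) x)
     - (\<Sum>\<Sum>i j p s. wb j (H p j) x * G p s x * wz i (H i s) x)"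
    unfolding raised_Om[OF x] by (simp add: sum_subtractf)
  also have "(\<Sum>\<Sum>i j. wz i (wb j (H i j)) x) = DD x"
  proof -
    have "wb j (D j) x = (\<Sum>i\<in>UNIV. wz i (wb j (H i j)) x)" for j
      unfolding D_def[abs_def] by (simp add: wb.rules x smooths commute(3)[OF x])
    then show ?thesis unfolding DD_def by (subst sum.swap) simp
  qed
  also have "(\<Sum>\<Sum>i j p s. wb j (H p j) x * G p s x * wz i (H i s) x)
     = (\<Sum>\<Sum>p s j i. G p s x * wz i (H i s) x * wb j (H p j) x)"
    unfolding sum.cartesian_product
    by (rule sum.reindex_bij_witness[where i="\<lambda>(p,s,j,i). (i,j,p,s)" and j="\<lambda>(i,j,p,s). (p,s,j,i)"]) auto
  also have "\<dots> = (\<Sum>\<Sum>p l. G p l x * D l x * Db p x)"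
    by (simp add: D_def Db_def sum_distrib_left sum_distrib_right)
  finally show ?thesis .
qed

text \<open>For a constant covector \<open>c\<close>, \<open>E c\<close> is the divergence of \<open>h\<close> twisted by \<open>c\<close>, that is \<open>D - c h\<close>, and
  \<open>Phi c\<close> is the correspondingly twisted double divergence. The twist plays the role of a change of
  holomorphic coordinates: a quadratic change alters \<open>D\<close> at a point by such a term and can make it
  vanish there.\<close>

definition E :: "('n \<Rightarrow> complex) \<Rightarrow> 'n \<Rightarrow> real \<times> (complex^'n) \<Rightarrow> complex" where
  "E c l x = D l x - (\<Sum>p\<in>UNIV. c p * H p l x)"

definition Eb :: "('n \<Rightarrow> complex) \<Rightarrow> 'n \<Rightarrow> real \<times> (complex^'n) \<Rightarrow> complex" where
  "Eb c p x = Db p x - (\<Sum>r\<in>UNIV. cnj (c r) * H p r x)"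

definition Phi :: "('n \<Rightarrow> complex) \<Rightarrow> real \<times> (complex^'n) \<Rightarrow> complex" where
  "Phi c x = DD x - (\<Sum>q\<in>UNIV. c q * Db q x) - (\<Sum>r\<in>UNIV. cnj (c r) * D r x)
     + (\<Sum>q\<in>UNIV. c q * (\<Sum>r\<in>UNIV. cnj (c r) * H q r x))"

lemma smooth_E: "smooth_on S (E c l)" "smooth_on S (Eb c l)"
  unfolding E_def[abs_def] Eb_def[abs_def] by (intro smooths smooth_D smooth_Db smooth_on_const)+

lemma smooth_Phi: "smooth_on S (Phi c)"
  unfolding Phi_def[abs_def] by (intro smooths smooth_D smooth_Db smooth_DD smooth_on_const)

lemma Eb_cnj: "x \<in> S \<Longrightarrow> Eb c p x = cnj (E c p x)"
  by (simp add: E_def Eb_def Db_cnj H_herm)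

text \<open>Completing the square in \<open>|D|\<^sup>2 = |E + c h|\<^sup>2\<close>; the mixed terms simplify because \<open>g\<close> is inverse to
  \<open>h\<close>.\<close>

lemma sc_complete_square:
  assumes x: "x \<in> S"
  shows "sc x = Phi c x - (\<Sum>\<Sum>p l. G p l x * E c l x * Eb c p x)"
proof -
  define \<alpha> where "\<alpha> l = (\<Sum>p\<in>UNIV. c p * H p l x)" for l
  define \<beta> where "\<beta> p = (\<Sum>r\<in>UNIV. cnj (c r) * H p r x)" for p
  have 1: "(\<Sum>l\<in>UNIV. G p l x * \<alpha> l) = c p" for p
  proof -
    have "(\<Sum>l\<in>UNIV. G p l x * \<alpha> l) = (\<Sum>q\<in>UNIV. c q * (\<Sum>l\<in>UNIV. H q l x * G p l x))"
      unfolding \<alpha>_def sum_distrib_left by (subst sum.swap) (simp add: mult_ac)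
    then show ?thesis by (simp add: H_right[OF x] sum_delta_mult)
  qed
  have 2: "(\<Sum>p\<in>UNIV. G p l x * \<beta> p) = cnj (c l)" for l
  proof -
    have "(\<Sum>p\<in>UNIV. G p l x * \<beta> p) = (\<Sum>r\<in>UNIV. cnj (c r) * (\<Sum>p\<in>UNIV. H p r x * G p l x))"
      unfolding \<beta>_def sum_distrib_left by (subst sum.swap) (simp add: mult_ac)
    then show ?thesis by (simp add: H_left[OF x] sum_delta_mult)
  qed
  have "(\<Sum>\<Sum>p l. G p l x * E c l x * Eb c p x)
    = (\<Sum>\<Sum>p l. G p l x * D l x * Db p x) - (\<Sum>\<Sum>p l. (G p l x * \<alpha> l) * Db p x)
      - (\<Sum>\<Sum>p l. (G p l x * \<beta> p) * D l x) + (\<Sum>\<Sum>p l. (G p l x * \<alpha> l) * \<beta> p)"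
    unfolding E_def Eb_def \<alpha>_def[symmetric] \<beta>_def[symmetric]
    by (simp add: algebra_simps sum.distrib sum_subtractf)
  also have "(\<Sum>\<Sum>p l. (G p l x * \<alpha> l) * Db p x) = (\<Sum>p\<in>UNIV. c p * Db p x)"
    unfolding sum_distrib_right[symmetric] 1 ..
  also have "(\<Sum>\<Sum>p l. (G p l x * \<beta> p) * D l x) = (\<Sum>l\<in>UNIV. cnj (c l) * D l x)"
    by (subst sum.swap) (simp only: sum_distrib_right[symmetric] 2)
  also have "(\<Sum>\<Sum>p l. (G p l x * \<alpha> l) * \<beta> p) = (\<Sum>p\<in>UNIV. c p * \<beta> p)"
    unfolding sum_distrib_right[symmetric] 1 ..
  finally show ?thesis
    unfolding sc_divergence[OF x] Phi_def \<beta>_def by simp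
qed

lemma E_vanishes:
  assumes x: "x \<in> S"
  shows "E (\<lambda>p. \<Sum>l\<in>UNIV. G p l x * D l x) l x = 0"
proof -
  have "(\<Sum>p\<in>UNIV. (\<Sum>r\<in>UNIV. G p r x * D r x) * H p l x) = (\<Sum>r\<in>UNIV. (\<Sum>p\<in>UNIV. H p l x * G p r x) * D r x)"
    unfolding sum_distrib_right by (subst sum.swap) (simp add: mult_ac)
  then show ?thesis by (simp add: E_def H_left[OF x] sum_delta_mult)
qed

text \<open>A function with two factors vanishing at \<open>x\<close> has no first derivatives there, and its second
  derivatives involve only first derivatives of those factors.\<close>

lemma wz_wb_triple_product:
  assumes x: "x \<in> S" and sm: "smooth_on S f" "smooth_on S e" "smooth_on S k" and 0: "e x = 0" "k x = 0"
  shows "wz m (wb n (\<lambda>y. f y * e y * k y)) x = f x * (wz m e x * wb n k x) + f x * (wb n e x * wz m k x)"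
    and "dt (\<lambda>y. f y * e y * k y) x = 0"
proof -
  have "wz m (wb n (\<lambda>y. f y * e y * k y)) x = wz m (\<lambda>y. wb n f y * e y * k y + f y * wb n e y * k y + f y * e y * wb n k y) x"
    by (intro wz.cong x) (simp add: wb.rules sm smooths algebra_simps)
  then show "wz m (wb n (\<lambda>y. f y * e y * k y)) x = f x * (wz m e x * wb n k x) + f x * (wb n e x * wz m k x)"
    by (simp add: wz.rules x sm smooths 0)
  show "dt (\<lambda>y. f y * e y * k y) x = 0"
    by (simp add: dt.rules x sm smooths 0)
qed

end

context spacetime_HCF
begin

lemma heat_H:
  assumes x: "x \<in> S"
  shows "heat (H a b) x = - (\<Sum>\<Sum>m s. wz m (H a s) x * wb s (H m b) x)"
  using flow_H[OF x] by (simp add: heat_def lap_def)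

text \<open>Take the divergence of \<open>flow_H\<close>. The derivative falling on the coefficient \<open>h\<^bsup>m n-bar\<^esup>\<close> of the
  second-order term and the derivative falling on the second factor of the quadratic term are equal and
  cancel.\<close>

lemma dt_D:
  assumes x: "x \<in> S"
  shows "dt (D j) x = (\<Sum>\<Sum>m n. H m n x * wz m (wb n (D j)) x)
     - (\<Sum>\<Sum>m n. wz m (D n) x * wb n (H m j) x)"
proof -
  have "dt (D j) x = (\<Sum>i\<in>UNIV. dt (wz i (H i j)) x)"
    unfolding D_def[abs_def] by (simp add: dt.rules x smooths)
  also have "\<dots> = (\<Sum>i\<in>UNIV. wz i (dt (H i j)) x)"
    by (intro sum.cong refl commute(4) x smooths)
  also have "\<dots> = (\<Sum>i\<in>UNIV. wz i (\<lambda>y. (\<Sum>\<Sum>m n. H m n y * wz m (wb n (H i j)) y)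
           - (\<Sum>\<Sum>m s. wz m (H i s) y * wb s (H m j) y)) x)"
    by (intro sum.cong refl wz.cong x flow_H)
  also have "\<dots> = (\<Sum>\<Sum>i m n. wz i (H m n) x * wz m (wb n (H i j)) x)
      + (\<Sum>\<Sum>i m n. H m n x * wz i (wz m (wb n (H i j))) x)
      - ((\<Sum>\<Sum>i m s. wz i (wz m (H i s)) x * wb s (H m j) x)
        + (\<Sum>\<Sum>i m s. wz m (H i s) x * wz i (wb s (H m j)) x))"
    by (simp add: wz.rules x smooths sum.distrib sum_subtractf)
  also have "(\<Sum>\<Sum>i m s. wz m (H i s) x * wz i (wb s (H m j)) x)
     = (\<Sum>\<Sum>i m n. wz i (H m n) x * wz m (wb n (H i j)) x)"
    by (rule sum.swap)
  also have "(\<Sum>\<Sum>i m n. H m n x * wz i (wz m (wb n (H i j))) x)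
     = (\<Sum>\<Sum>m n. H m n x * wz m (wb n (D j)) x)"
    unfolding wz_wb_D[OF x] by (subst sum_rot3) (simp add: sum_distrib_left)
  also have "(\<Sum>\<Sum>i m s. wz i (wz m (H i s)) x * wb s (H m j) x)
     = (\<Sum>\<Sum>m n. wz m (D n) x * wb n (H m j) x)"
    unfolding wz_D[OF x] by (subst sum_rot3) (simp add: sum_distrib_right)
  finally show ?thesis by simp
qed

lemma heat_D:
  assumes x: "x \<in> S"
  shows "heat (D j) x = - (\<Sum>\<Sum>m n. wz m (D n) x * wb n (H m j) x)"
  using dt_D[OF x] by (simp add: heat_def lap_def)

lemma heat_Db:
  assumes x: "x \<in> S"
  shows "heat (Db i) x = - (\<Sum>\<Sum>m n. wz m (H i n) x * wb n (Db m) x)"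
proof -
  have 1: "wb n (Db m) x = cnj (wz n (D m) x)" for m n
    using wb.cong[of x "Db m" "\<lambda>x. cnj (D m x)" n] Db_cnj x cnj_wb[OF x smooth_D] by simp
  have 2: "wz m (H i n) x = cnj (wb m (H n i) x)" for m n
    by (simp add: wb_H[OF x])
  have "heat (Db i) x = cnj (heat (D i) x)"
    using heat_cong[of x "Db i" "\<lambda>x. cnj (D i x)"] Db_cnj x heat_cnj[OF x smooth_D] by simp
  also have "\<dots> = - (\<Sum>\<Sum>n m. wz m (H i n) x * wb n (Db m) x)"
    unfolding heat_D[OF x] 1 2 by (simp add: mult.commute)
  finally show ?thesis by (subst sum.swap)
qed

text \<open>The same cancellation as in \<open>dt_D\<close>, for the divergence in the second index.\<close>

lemma heat_DD:
  assumes x: "x \<in> S"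
  shows "heat DD x = - (\<Sum>\<Sum>m n. wz m (D n) x * wb n (Db m) x)"
proof -
  have "dt DD x = (\<Sum>j\<in>UNIV. dt (wb j (D j)) x)"
    unfolding DD_def[abs_def] by (simp add: dt.rules x smooths smooth_D)
  also have "\<dots> = (\<Sum>j\<in>UNIV. wb j (dt (D j)) x)"
    by (intro sum.cong refl commute(5) x smooth_D)
  also have "\<dots> = (\<Sum>j\<in>UNIV. wb j (\<lambda>y. (\<Sum>\<Sum>m n. H m n y * wz m (wb n (D j)) y)
     - (\<Sum>\<Sum>m n. wz m (D n) y * wb n (H m j) y)) x)"
    by (intro sum.cong refl wb.cong x dt_D)
  also have "\<dots> = (\<Sum>\<Sum>j m n. wb j (H m n) x * wz m (wb n (D j)) x)
      + (\<Sum>\<Sum>j m n. H m n x * wb j (wz m (wb n (D j))) x)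
      - ((\<Sum>\<Sum>j m n. wb j (wz m (D n)) x * wb n (H m j) x)
        + (\<Sum>\<Sum>j m n. wz m (D n) x * wb j (wb n (H m j)) x))"
    by (simp add: wb.rules x smooths smooth_D sum.distrib sum_subtractf)
  also have "(\<Sum>\<Sum>j m n. wb j (wz m (D n)) x * wb n (H m j) x)
     = (\<Sum>\<Sum>j m n. wb j (H m n) x * wz m (wb n (D j)) x)"
    by (subst sum_rev3) (simp add: commute(3)[OF x smooth_D] mult.commute)
  also have "(\<Sum>\<Sum>j m n. H m n x * wb j (wz m (wb n (D j))) x) = lap DD x"
    unfolding lap_def wz_wb_DD[OF x] by (subst sum_rot3) (simp add: sum_distrib_left)
  also have "(\<Sum>\<Sum>j m n. wz m (D n) x * wb j (wb n (H m j)) x)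
      = (\<Sum>\<Sum>m n. wz m (D n) x * wb n (Db m) x)"
    unfolding wb_Db[OF x] by (subst sum_rot3) (simp add: sum_distrib_left)
  finally show ?thesis by (simp add: heat_def)
qed

text \<open>The four evolution equations of \<open>DD\<close>, \<open>Db\<close>, \<open>D\<close> and \<open>h\<close> have quadratic terms which fit
  together to a single product.\<close>

lemma heat_Phi:
  assumes x: "x \<in> S"
  shows "heat (Phi c) x = - (\<Sum>\<Sum>m n. wz m (E c n) x * wb n (Eb c m) x)"
proof -
  have e: "wz m (E c n) x = wz m (D n) x - (\<Sum>p\<in>UNIV. c p * wz m (H p n) x)" for m n
    unfolding E_def[abs_def] by (simp add: wz.rules x smooths smooth_D)
  have eb: "wb n (Eb c m) x = wb n (Db m) x - (\<Sum>r\<in>UNIV. cnj (c r) * wb n (H m r) x)" for m n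
    unfolding Eb_def[abs_def] by (simp add: wb.rules x smooths smooth_Db)
  have "heat (Phi c) x = heat DD x - (\<Sum>q\<in>UNIV. c q * heat (Db q) x) - (\<Sum>r\<in>UNIV. cnj (c r) * heat (D r) x)
     + (\<Sum>q\<in>UNIV. c q * (\<Sum>r\<in>UNIV. cnj (c r) * heat (H q r) x))"
    unfolding Phi_def[abs_def] by (simp add: heat_rules heat_sum x smooths smooth_D smooth_Db smooth_DD)
  also have "\<dots> = - (\<Sum>\<Sum>m n. wz m (D n) x * wb n (Db m) x)
      + (\<Sum>\<Sum>m n q. c q * (wz m (H q n) x * wb n (Db m) x))
      + (\<Sum>\<Sum>m n r. cnj (c r) * (wz m (D n) x * wb n (H m r) x))
      - (\<Sum>\<Sum>m n q. c q * (\<Sum>r\<in>UNIV. cnj (c r) * (wz m (H q n) x * wb n (H m r) x)))"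
    unfolding heat_DD[OF x] heat_D[OF x] heat_Db[OF x] heat_H[OF x]
    unfolding sum_pull3[symmetric] by (simp add: sum_negf)
  also have "\<dots> = - (\<Sum>\<Sum>m n. wz m (E c n) x * wb n (Eb c m) x)"
  proof -
    have "wz m (E c n) x * wb n (Eb c m) x = wz m (D n) x * wb n (Db m) x
        - (\<Sum>q\<in>UNIV. c q * (wz m (H q n) x * wb n (Db m) x))
        - (\<Sum>r\<in>UNIV. cnj (c r) * (wz m (D n) x * wb n (H m r) x))
        + (\<Sum>q\<in>UNIV. c q * (\<Sum>r\<in>UNIV. cnj (c r) * (wz m (H q n) x * wb n (H m r) x)))" for m n
      unfolding e eb left_diff_distrib right_diff_distrib sum_product
      by (simp add: sum_distrib_left sum_distrib_right mult_ac)
    then show ?thesis by (simp add: sum.distrib sum_subtractf)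
  qed
  finally show ?thesis .
qed

text \<open>Choose the twist \<open>c\<close> such that \<open>E c\<close> vanishes at \<open>x\<close>, and put \<open>M\<^sub>m\<^sub>l = \<partial>\<^sub>m E\<^sub>l\<close>,
  \<open>N\<^sub>n\<^sub>l = \<partial>-bar\<^sub>n E\<^sub>l\<close>. At \<open>x\<close> the heat operator of \<open>sc = Phi - |E|\<^sup>2\<close> is then
  \<open>|M|\<^sup>2 + |N|\<^sup>2 - tr (M cnj M)\<close>, and the last term is dominated by the first.\<close>

theorem sc_supersolution:
  assumes x: "x \<in> S"
  shows "Re (lap sc x) \<le> Re (dt sc x)"
proof -
  \<comment> \<open>\<open>c\<close> is a constant: its value is fixed at \<open>x\<close> and it is not differentiated.\<close>
  define c where "c p = (\<Sum>l\<in>UNIV. G p l x * D l x)" for p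
  have E0: "E c l x = 0" for l unfolding c_def[abs_def] by (rule E_vanishes[OF x])
  have Eb0: "Eb c l x = 0" for l using Eb_cnj[OF x] E0 by simp
  define M where "M m l = wz m (E c l) x" for m l
  define N where "N n l = wb n (E c l) x" for n l
  have M': "wb n (Eb c p) x = cnj (M n p)" for n p
    unfolding M_def using wb.cong[of x "Eb c p" "\<lambda>x. cnj (E c p x)" n] Eb_cnj x cnj_wb[OF x smooth_E(1)] by simp
  have N': "wz m (Eb c p) x = cnj (N m p)" for m p
    unfolding N_def using wz.cong[of x "Eb c p" "\<lambda>x. cnj (E c p x)" m] Eb_cnj x cnj_wz[OF x smooth_E(1)] by simp
  have "heat (\<lambda>y. \<Sum>\<Sum>p l. G p l y * E c l y * Eb c p y) x
      = (\<Sum>\<Sum>p l. heat (\<lambda>y. G p l y * E c l y * Eb c p y) x)"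
    by (simp add: heat_sum x smooths smooth_E)
  also have "\<dots> = - (\<Sum>\<Sum>p l m n. H m n x * (G p l x * (M m l * cnj (M n p)) + G p l x * (N n l * cnj (N m p))))"
    unfolding heat_def lap_def
    by (simp add: wz_wb_triple_product[OF x smooth_G smooth_E E0 Eb0] M' N' M_def[symmetric] N_def[symmetric] sum_negf)
  also have "(\<Sum>\<Sum>p l m n. H m n x * (G p l x * (M m l * cnj (M n p)) + G p l x * (N n l * cnj (N m p))))
     = (\<Sum>\<Sum>m n p l. H m n x * (G p l x * (M m l * cnj (M n p)) + G p l x * (N n l * cnj (N m p))))"
    unfolding sum.cartesian_product
    by (rule sum.reindex_bij_witness[where i="\<lambda>(m,n,p,l). (p,l,m,n)" and j="\<lambda>(p,l,m,n). (m,n,p,l)"]) auto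
  also have "\<dots> = (\<Sum>\<Sum>m n p l. H m n x * G p l x * M m l * cnj (M n p))
      + (\<Sum>\<Sum>m n p l. H m n x * G p l x * N n l * cnj (N m p))"
    by (simp add: algebra_simps sum.distrib)
  also have "(\<Sum>\<Sum>m n p l. H m n x * G p l x * N n l * cnj (N m p))
      = (\<Sum>\<Sum>m n p l. H n m x * G p l x * N m l * cnj (N n p))"
    by (rule sum.swap)
  finally have quad: "heat (\<lambda>y. \<Sum>\<Sum>p l. G p l y * E c l y * Eb c p y) x
     = - ((\<Sum>\<Sum>m n p l. H m n x * G p l x * M m l * cnj (M n p))
      + (\<Sum>\<Sum>m n p l. H n m x * G p l x * N m l * cnj (N n p)))" .
  have "heat sc x = heat (\<lambda>y. Phi c y - (\<Sum>\<Sum>p l. G p l y * E c l y * Eb c p y)) x"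
    by (rule heat_cong[OF x sc_complete_square])
  also have "\<dots> = heat (Phi c) x - heat (\<lambda>y. \<Sum>\<Sum>p l. G p l y * E c l y * Eb c p y) x"
    by (intro heat_rules(2) x smooth_Phi smooths smooth_E)
  also have "heat (Phi c) x = - (\<Sum>\<Sum>m n. M m n * cnj (M n m))"
    unfolding heat_Phi[OF x] M' M_def ..
  finally have heat_sc: "heat sc x = (\<Sum>\<Sum>m n p l. H m n x * G p l x * M m l * cnj (M n p))
      - (\<Sum>\<Sum>m n. M m n * cnj (M n m))
      + (\<Sum>\<Sum>m n p l. H n m x * G p l x * N m l * cnj (N n p))"
    unfolding quad by simp
  have Hx: "(\<lambda>i j. H i j x) = minv (\<lambda>k l. G k l x)" by (simp add: H_def fun_eq_iff)
  have 1: "Re (\<Sum>\<Sum>m n. M m n * cnj (M n m))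
     \<le> Re (\<Sum>\<Sum>m n p l. H m n x * G p l x * M m l * cnj (M n p))"
    by (rule contraction_le_norm[OF pd[OF x] Hx])
  have "hermitian_pd (\<lambda>m n. H m n x)" unfolding Hx by (rule hermitian_pd_minv[OF pd[OF x]])
  then have "hermitian_pd (\<lambda>m n. H n m x)" by (rule hermitian_pd_flip)
  from hermitian_pd_tensor_nonneg[OF this pd[OF x], of N]
  have 2: "0 \<le> Re (\<Sum>\<Sum>m n p l. H n m x * G p l x * N m l * cnj (N n p))" .
  have "0 \<le> Re (heat sc x)" unfolding heat_sc using 1 2 by simp
  then show ?thesis by (simp add: heat_def)
qed

end

section \<open>Spatial minima and time slices\<close>

lemma second_deriv_nonneg_at_min:
  fixes \<phi> \<phi>' :: "real \<Rightarrow> real"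
  assumes \<delta>: "0 < \<delta>" and d1: "\<And>r. \<bar>r\<bar> < \<delta> \<Longrightarrow> (\<phi> has_real_derivative \<phi>' r) (at r)"
    and d2: "(\<phi>' has_real_derivative l) (at 0)" and min: "\<And>r. \<bar>r\<bar> < \<delta> \<Longrightarrow> \<phi> 0 \<le> \<phi> r"
  shows "0 \<le> l"
proof (rule ccontr)
  assume "\<not> 0 \<le> l"
  then obtain d where d: "d > 0" "\<And>h. 0 < h \<Longrightarrow> h < d \<Longrightarrow> \<phi>' h < \<phi>' 0"
    using DERIV_neg_dec_right[OF d2] by auto
  have "\<phi>' 0 = 0"
    by (rule DERIV_local_min[OF d1 \<delta>]) (use \<delta> min in auto)
  define h where "h = min d \<delta> / 2"
  have h: "0 < h" "h < d" "h < \<delta>" using d(1) \<delta> by (auto simp: h_def)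
  obtain z where z: "0 < z" "z < h" "\<phi> h - \<phi> 0 = (h - 0) * \<phi>' z"
    using MVT2[OF h(1), of \<phi> \<phi>'] d1 h by auto
  have "\<phi>' z < 0" using d(2)[of z] z h \<open>\<phi>' 0 = 0\<close> by simp
  then have "\<phi> h < \<phi> 0" using z h mult_pos_neg[of h "\<phi>' z"] by simp
  with min[of h] h show False by simp
qed

lemma ddir_ddir_nonneg_at_min:
  assumes S: "open S" "x \<in> S" and f: "smooth_on S f"
    and min: "\<And>y. y \<in> S \<Longrightarrow> y \<in> range (\<lambda>r. x + r *\<^sub>R v) \<Longrightarrow> Re (f x) \<le> Re (f y)"
  shows "0 \<le> Re (ddir v (ddir v f) x)"
proof -
  have "continuous_on UNIV (\<lambda>r. x + r *\<^sub>R v)" by (intro continuous_intros)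
  then have "open ((\<lambda>r. x + r *\<^sub>R v) -` S)" using S open_vimage by blast
  moreover have "0 \<in> (\<lambda>r. x + r *\<^sub>R v) -` S" using S by simp
  ultimately obtain \<delta> where \<delta>: "\<delta> > 0" "ball 0 \<delta> \<subseteq> (\<lambda>r. x + r *\<^sub>R v) -` S"
    using openE by blast
  have inS: "x + r *\<^sub>R v \<in> S" if "\<bar>r\<bar> < \<delta>" for r using \<delta>(2) that by (auto simp: subset_iff dist_real_def)
  have der: "((\<lambda>r. Re (F (x + r *\<^sub>R v))) has_real_derivative Re (ddir v F (x + r *\<^sub>R v))) (at r)"
    if F: "smooth_on S F" and r: "\<bar>r\<bar> < \<delta>" for F r
  proof -
    have 1: "((\<lambda>r. x + r *\<^sub>R v) has_derivative (\<lambda>h. h *\<^sub>R v)) (at r)"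
      by (auto intro!: derivative_eq_intros)
    note D = smooth_on_has_derivative[OF F S(1) inS[OF r]]
    have "((\<lambda>r. Re (F (x + r *\<^sub>R v))) has_derivative (\<lambda>h. Re (ddir (h *\<^sub>R v) F (x + r *\<^sub>R v)))) (at r)"
      by (rule bounded_linear.has_derivative[OF bounded_linear_Re has_derivative_compose[OF 1 D]])
    moreover have "(\<lambda>h. Re (ddir (h *\<^sub>R v) F (x + r *\<^sub>R v))) = (*) (Re (ddir v F (x + r *\<^sub>R v)))"
      using linear_cmul[OF bounded_linear.linear[OF has_derivative_bounded_linear[OF D]]]
      by (simp add: fun_eq_iff)
    ultimately show ?thesis by (simp add: has_field_derivative_def)
  qed
  show ?thesis
  proof (rule second_deriv_nonneg_at_min[OF \<delta>(1)])
    show "((\<lambda>r. Re (f (x + r *\<^sub>R v))) has_real_derivative Re (ddir v f (x + r *\<^sub>R v))) (at r)" if "\<bar>r\<bar> < \<delta>" for r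
      by (rule der[OF f that])
    show "((\<lambda>r. Re (ddir v f (x + r *\<^sub>R v))) has_real_derivative Re (ddir v (ddir v f) x)) (at 0)"
      using der[OF smooth_on_ddir[OF f S(1)], of 0] \<delta> by simp
    show "Re (f (x + 0 *\<^sub>R v)) \<le> Re (f (x + r *\<^sub>R v))" if "\<bar>r\<bar> < \<delta>" for r
      using min[OF inS[OF that] rangeI] by simp
  qed
qed

context spacetime_metric
begin

lemma wz_wb_direction:
  assumes x: "x \<in> S" and F: "smooth_on S F"
  shows "(\<Sum>m\<in>UNIV. u $ m * wz m F x) = cdir (1/2) (0, u) (- \<i>/2) (0, \<i> *s u) F x"
    "(\<Sum>n\<in>UNIV. cnj (u $ n) * wb n F x) = cdir (1/2) (0, u) (\<i>/2) (0, \<i> *s u) F x"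
proof -
  let ?L = "\<lambda>u. ddir (0, u) F x"
  have "linear (\<lambda>u. (0::real, u :: complex^'n))" by (rule linearI) auto
  then have L: "linear ?L"
    using linear_compose[OF _ bounded_linear.linear[OF has_derivative_bounded_linear[OF smooth_on_has_derivative[OF F open_S x]]]]
    by (simp add: o_def)
  have w: "wz i F x = (?L (axis i 1) - \<i> * ?L (axis i \<i>)) / 2" "wb i F x = (?L (axis i 1) + \<i> * ?L (axis i \<i>)) / 2" for i
    by (simp_all add: wz_def wb_def cdir_def field_simps)
  have Lu: "?L u = (\<Sum>i\<in>UNIV. u $ i * wz i F x) + (\<Sum>i\<in>UNIV. cnj (u $ i) * wb i F x)" for u
    unfolding w using linear_wirtinger_expand[OF L, of u] by (simp add: sum.distrib)
  have Liu: "?L (\<i> *s u) = \<i> * (\<Sum>i\<in>UNIV. u $ i * wz i F x) - \<i> * (\<Sum>i\<in>UNIV. cnj (u $ i) * wb i F x)"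
    unfolding Lu by (simp add: sum_distrib_left sum_negf mult.assoc)
  show "(\<Sum>m\<in>UNIV. u $ m * wz m F x) = cdir (1/2) (0, u) (- \<i>/2) (0, \<i> *s u) F x"
    "(\<Sum>n\<in>UNIV. cnj (u $ n) * wb n F x) = cdir (1/2) (0, u) (\<i>/2) (0, \<i> *s u) F x"
    unfolding cdir_def Liu unfolding Lu by (simp_all add: algebra_simps)
qed

text \<open>By the factorisation of \<open>h\<close>, the operator is a sum of terms \<open>\<partial>\<^sub>u \<partial>-bar\<^sub>u\<close>, and each of them
  is a quarter of the sum of the second derivatives in the real directions \<open>u\<close> and \<open>\<i> u\<close>.\<close>

lemma lap_nonneg_at_min:
  assumes x: "x \<in> S" and f: "smooth_on S f"
    and min: "\<And>y. y \<in> S \<Longrightarrow> fst y = fst x \<Longrightarrow> Re (f x) \<le> Re (f y)"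
  shows "0 \<le> Re (lap f x)"
proof -
  have "hermitian_pd (\<lambda>m n. H m n x)"
    using hermitian_pd_minv[OF pd[OF x]] by (simp add: H_def)
  from hermitian_pd_factor[OF this] obtain v :: "'n \<Rightarrow> 'n \<Rightarrow> complex"
    where v: "\<forall>m n. H m n x = (\<Sum>a\<in>UNIV. v a m * cnj (v a n))" ..
  define u where "u a = (\<chi> m. v a m)" for a
  have pos: "0 \<le> Re (\<Sum>\<Sum>m n. u $ m * cnj (u $ n) * wz m (wb n f) x)" for u
  proof -
    let ?P = "cdir (1/2) (0, u) (\<i>/2) (0, \<i> *s u) f"
    have sP: "smooth_on S ?P" by (rule smooth_on_cdir[OF open_S f])
    have "(\<Sum>n\<in>UNIV. u $ m * cnj (u $ n) * wz m (wb n f) x) = u $ m * wz m (\<lambda>y. \<Sum>n\<in>UNIV. cnj (u $ n) * wb n f y) x" for m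
      by (simp add: wz.rules x smooths f sum_distrib_left mult.assoc)
    moreover have "wz m (\<lambda>y. \<Sum>n\<in>UNIV. cnj (u $ n) * wb n f y) x = wz m ?P x" for m
      by (rule wz.cong[OF x wz_wb_direction(2)[OF _ f]])
    ultimately have "(\<Sum>\<Sum>m n. u $ m * cnj (u $ n) * wz m (wb n f) x)
       = cdir (1/2) (0, u) (- \<i>/2) (0, \<i> *s u) ?P x"
      by (simp add: wz_wb_direction(1)[OF x sP])
    also have "\<dots> = (ddir (0, u) (ddir (0, u) f) x + ddir (0, \<i> *s u) (ddir (0, \<i> *s u) f) x) / 4"
      unfolding cdir_def[of _ _ _ _ ?P] ddir_cdir[OF open_S x f] ddir_commute[OF f open_S x, of "(0, \<i> *s u)" "(0, u)"]
      by (simp add: algebra_simps)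
    finally have eq: "(\<Sum>\<Sum>m n. u $ m * cnj (u $ n) * wz m (wb n f) x)
       = (ddir (0, u) (ddir (0, u) f) x + ddir (0, \<i> *s u) (ddir (0, \<i> *s u) f) x) / 4" .
    have "0 \<le> Re (ddir (0, w) (ddir (0, w) f) x)" for w
    proof (rule ddir_ddir_nonneg_at_min[OF open_S x f])
      fix y assume "y \<in> S" "y \<in> range (\<lambda>r. x + r *\<^sub>R (0, w))"
      then show "Re (f x) \<le> Re (f y)" by (intro min) auto
    qed
    from this[of u] this[of "\<i> *s u"] show ?thesis unfolding eq by simp
  qed
  have lap: "lap f x = (\<Sum>\<Sum>a m n. u a $ m * cnj (u a $ n) * wz m (wb n f) x)"
    by (subst sum_rot3) (simp add: lap_def v[rule_format] u_def sum_distrib_right)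
  show ?thesis
    unfolding lap Re_sum[of "\<lambda>a. \<Sum>\<Sum>m n. u a $ m * cnj (u a $ n) * wz m (wb n f) x"]
    by (intro sum_nonneg pos)
qed

lemma smooth_sc: "smooth_on S sc"
  unfolding sc_def[abs_def] Om_def[abs_def]
  by (intro smooths smooth_on_minus)

lemma slice_derivative:
  assumes x: "(t, z) \<in> S" and F: "smooth_on S F"
  shows "wirtinger i (\<lambda>z. F (t, z)) z = wz i F (t, z)" "wirtinger_bar i (\<lambda>z. F (t, z)) z = wb i F (t, z)"
proof -
  have "((\<lambda>z. (t, z)) has_derivative (\<lambda>v. (0, v))) (at z)"
    by (auto intro!: derivative_eq_intros)
  from has_derivative_compose[OF this smooth_on_has_derivative[OF F open_S x]]
  have "frechet_derivative (\<lambda>z. F (t, z)) (at z) v = ddir (0, v) F (t, z)" for v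
    using has_derivative_imp_ddir[of "\<lambda>z. F (t, z)" _ z v] by (simp add: ddir_def)
  then show "wirtinger i (\<lambda>z. F (t, z)) z = wz i F (t, z)" "wirtinger_bar i (\<lambda>z. F (t, z)) z = wb i F (t, z)"
    by (simp_all add: wirtinger_def wirtinger_bar_def wz_def wb_def cdir_def field_simps)
qed

lemma slice_curvature:
  assumes x: "(t, z) \<in> S"
  shows "curv (\<lambda>k l z. G k l (t, z)) i j k l z = Om i j k l (t, z)"
    and "scal (\<lambda>k l z. G k l (t, z)) z = sc (t, z)"
proof -
  have "continuous_on UNIV (\<lambda>z. (t, z))" by (intro continuous_intros)
  then have V: "open ((\<lambda>z. (t, z)) -` S)" using open_S open_vimage by blast
  have "wirtinger i (wirtinger_bar j (\<lambda>z. G k l (t, z))) z = wz i (wb j (G k l)) (t, z)" for i j k l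
  proof -
    have "wirtinger i (wirtinger_bar j (\<lambda>z. G k l (t, z))) z = wirtinger i (\<lambda>z. wb j (G k l) (t, z)) z"
      unfolding wirtinger_cdir[of i]
      by (rule cdir_cong[OF V]) (use x slice_derivative(2)[OF _ smooth_G] in auto)
    then show ?thesis using slice_derivative(1)[OF x wb.smooth[OF smooth_G]] by simp
  qed
  then show curv: "curv (\<lambda>k l z. G k l (t, z)) i j k l z = Om i j k l (t, z)" for i j k l
    by (simp add: curv_def Om_def slice_derivative[OF x smooth_G] H_def)
  show "scal (\<lambda>k l z. G k l (t, z)) z = sc (t, z)"
    by (simp add: scal_def sc_def curv H_def)
qed

lemma has_vector_derivative_dt:
  assumes x: "(t, z) \<in> S" and F: "smooth_on S F"
  shows "((\<lambda>s. F (s, z)) has_vector_derivative dt F (t, z)) (at t)"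
proof -
  note D = smooth_on_has_derivative[OF F open_S x]
  have "((\<lambda>s. (s, z)) has_derivative (\<lambda>h. (h, 0))) (at t)"
    by (auto intro!: derivative_eq_intros)
  from has_derivative_compose[OF this D]
  have "((\<lambda>s. F (s, z)) has_derivative (\<lambda>h. ddir (h, 0) F (t, z))) (at t)" .
  moreover have "ddir (h, 0) F (t, z) = h *\<^sub>R dt F (t, z)" for h
    using linear_cmul[OF bounded_linear.linear[OF has_derivative_bounded_linear[OF D]], of h "(1, 0)"]
    by (simp add: dt_def cdir_def)
  ultimately show ?thesis by (simp add: has_vector_derivative_def)
qed

end

section \<open>Regularity up to time zero\<close>

text \<open>A purely spatial derivative at every time, including time zero, where the full differential is only
  taken within the half-open domain.\<close>

definition slice_ddir :: "'b \<Rightarrow> ('t \<times> 'b::real_normed_vector \<Rightarrow> 'c::real_normed_vector) \<Rightarrow> 't \<times> 'b \<Rightarrow> 'c" where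
  "slice_ddir v F x = frechet_derivative (\<lambda>z. F (fst x, z)) (at (snd x)) v"

text \<open>The spatial derivative is the differential within \<open>I \<times> V\<close> evaluated on \<open>(0, v)\<close>; it is unique
  since \<open>V\<close> is open.\<close>

lemma smooth_on_slice_ddir:
  fixes F :: "'t::real_normed_vector \<times> 'b::real_normed_vector \<Rightarrow> 'c::real_normed_vector"
  assumes F: "smooth_on (I \<times> V) F" and V: "open V"
  shows "smooth_on (I \<times> V) (slice_ddir v F)"
  unfolding smooth_on_def
proof
  fix k
  from F have "Ck_on (Suc k) (I \<times> V) F" unfolding smooth_on_def by blast
  then obtain F' where F': "\<forall>x\<in>I \<times> V. (F has_derivative F' x) (at x within I \<times> V)" "\<forall>v. Ck_on k (I \<times> V) (\<lambda>x. F' x v)"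
    by auto
  have "F' x (0, v) = slice_ddir v F x" if x: "x \<in> I \<times> V" for x
  proof -
    obtain t z where tz: "x = (t, z)" "t \<in> I" "z \<in> V" using x by auto
    have 1: "((\<lambda>z. (t, z)) has_derivative (\<lambda>v. (0, v))) (at z within V)"
      by (auto intro!: derivative_eq_intros)
    have 2: "(F has_derivative F' (t, z)) (at (t, z) within (\<lambda>z. (t, z)) ` V)"
      using has_derivative_subset[of F "F' (t, z)" "(t, z)" "I \<times> V"] F'(1) tz by blast
    have "((\<lambda>z. F (t, z)) has_derivative (\<lambda>v. F' (t, z) (0, v))) (at z within V)"
      by (rule has_derivative_in_compose[OF 1 2])
    then have "((\<lambda>z. F (t, z)) has_derivative (\<lambda>v. F' (t, z) (0, v))) (at z)"
      unfolding at_within_open[OF tz(3) V] .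
    from frechet_derivative_at[OF this] show ?thesis
      unfolding slice_ddir_def tz by (simp add: fun_eq_iff)
  qed
  then show "Ck_on k (I \<times> V) (slice_ddir v F)" using F'(2) Ck_on_cong[of "I \<times> V" "\<lambda>x. F' x (0, v)" "slice_ddir v F" k] by blast
qed

lemma smooth_on_slice_wirtinger:
  fixes F :: "real \<times> (complex^'n::finite) \<Rightarrow> complex"
  assumes F: "smooth_on (I \<times> V) F" and V: "open V"
  shows "smooth_on (I \<times> V) (\<lambda>x. wirtinger i (\<lambda>z. F (fst x, z)) (snd x))"
    "smooth_on (I \<times> V) (\<lambda>x. wirtinger_bar i (\<lambda>z. F (fst x, z)) (snd x))"
proof -
  have sd: "smooth_on (I \<times> V) (\<lambda>x. frechet_derivative (\<lambda>z. F (fst x, z)) (at (snd x)) v)" for v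
    using smooth_on_slice_ddir[OF F V, of v] by (simp add: slice_ddir_def[abs_def])
  show "smooth_on (I \<times> V) (\<lambda>x. wirtinger i (\<lambda>z. F (fst x, z)) (snd x))"
    "smooth_on (I \<times> V) (\<lambda>x. wirtinger_bar i (\<lambda>z. F (fst x, z)) (snd x))"
    unfolding wirtinger_def wirtinger_bar_def divide_inverse
    by (intro smooth_on_intros sd)+
qed

lemma continuous_on_slice_scal:
  fixes G :: "'n::finite \<Rightarrow> 'n \<Rightarrow> real \<times> (complex^'n) \<Rightarrow> complex"
  assumes G: "\<And>i j. smooth_on (I \<times> V) (G i j)" and V: "open V"
    and pd: "\<And>x. x \<in> I \<times> V \<Longrightarrow> hermitian_pd (\<lambda>i j. G i j x)"
  shows "continuous_on (I \<times> V) (\<lambda>x. scal (\<lambda>k l z. G k l (fst x, z)) (snd x))"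
proof -
  have 1: "smooth_on (I \<times> V) (\<lambda>x. minv (\<lambda>k l. G k l (fst x, snd x)) i j)" for i j
    using smooth_on_minv[OF G pd] by simp
  have 2: "smooth_on (I \<times> V) (\<lambda>x. wirtinger i (\<lambda>z. G k l (fst x, z)) (snd x))"
    "smooth_on (I \<times> V) (\<lambda>x. wirtinger_bar i (\<lambda>z. G k l (fst x, z)) (snd x))" for i k l
    using smooth_on_slice_wirtinger[OF G V] by auto
  have 3: "smooth_on (I \<times> V) (\<lambda>x. wirtinger i (wirtinger_bar j (\<lambda>z. G k l (fst x, z))) (snd x))" for i j k l
    using smooth_on_slice_wirtinger(1)[OF 2(2) V, of i j k l] by simp
  have "smooth_on (I \<times> V) (\<lambda>x. scal (\<lambda>k l z. G k l (fst x, z)) (snd x))"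
    unfolding scal_def curv_def by (intro smooth_on_intros 1 2 3)
  then show ?thesis by (rule smooth_on_imp_continuous_on)
qed

section \<open>The minimum principle\<close>

text \<open>Adding \<open>\<epsilon> (t - s)\<close> makes the time derivative strictly positive at a spatial minimum. Hence a minimum of
  the sum over \<open>[s, t1] \<times> M\<close> can only be attained at the initial time.\<close>

lemma minimum_principle:
  fixes f :: "real \<Rightarrow> 'a::topological_space \<Rightarrow> real"
  assumes comp: "compact (UNIV :: 'a set)" and st: "s \<le> t1"
    and cont: "continuous_on ({s..t1} \<times> UNIV) (\<lambda>x. f (fst x) (snd x))"
    and inc: "\<And>t p. s < t \<Longrightarrow> t \<le> t1 \<Longrightarrow> (\<And>p'. f t p \<le> f t p') \<Longrightarrow>
        \<exists>d\<ge>0. ((\<lambda>r. f r p) has_real_derivative d) (at t)"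
    and init: "\<And>p. q \<le> f s p"
  shows "q \<le> f t1 p1"
proof (rule ccontr)
  assume neg: "\<not> q \<le> f t1 p1"
  \<comment> \<open>Small enough that the perturbed function is still below \<open>q\<close> at \<open>(t1, p1)\<close>.\<close>
  define \<epsilon> where "\<epsilon> = (q - f t1 p1) / (2 * (t1 - s + 1))"
  have \<epsilon>: "\<epsilon> > 0" using neg st by (simp add: \<epsilon>_def)
  have "\<epsilon> * (t1 - s) < \<epsilon> * (2 * (t1 - s + 1))" using \<epsilon> st by (intro mult_strict_left_mono) auto
  also have "\<dots> = q - f t1 p1" using st by (simp add: \<epsilon>_def)
  finally have small: "f t1 p1 + \<epsilon> * (t1 - s) < q" by simp
  define F where "F x = f (fst x) (snd x) + \<epsilon> * (fst x - s)" for x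
  have "compact ({s..t1} \<times> (UNIV :: 'a set))" by (intro compact_Times comp) simp
  moreover have "continuous_on ({s..t1} \<times> UNIV) F"
    unfolding F_def by (intro continuous_intros cont)
  moreover have "{s..t1} \<times> (UNIV :: 'a set) \<noteq> {}" using st by auto
  ultimately obtain x where x: "x \<in> {s..t1} \<times> UNIV" "\<And>y. y \<in> {s..t1} \<times> UNIV \<Longrightarrow> F x \<le> F y"
    using continuous_attains_inf by metis
  obtain t p where tp: "x = (t, p)" by fastforce
  have t: "s \<le> t" "t \<le> t1" using x(1) tp by auto
  have "F (t, p) < q" using x(2)[of "(t1, p1)"] small st tp by (simp add: F_def)
  then have "t \<noteq> s" using init[of p] by (auto simp: F_def)
  with t have t: "s < t" "t \<le> t1" by auto
  have "f t p \<le> f t p'" for p' using x(2)[of "(t, p')"] t tp by (simp add: F_def)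
  then obtain d where d: "d \<ge> 0" "((\<lambda>r. f r p) has_real_derivative d) (at t)"
    using inc[OF t] by blast
  have "((\<lambda>r. f r p + \<epsilon> * (r - s)) has_real_derivative d + \<epsilon>) (at t)"
    by (auto intro!: derivative_eq_intros d(2))
  then obtain e where e: "e > 0" "\<And>h. 0 < h \<Longrightarrow> h < e \<Longrightarrow> f (t - h) p + \<epsilon> * (t - h - s) < f t p + \<epsilon> * (t - s)"
    using DERIV_pos_inc_left[of "\<lambda>r. f r p + \<epsilon> * (r - s)" "d + \<epsilon>" t] d(1) \<epsilon> by auto
  define h where "h = min (e / 2) (t - s)"
  have h: "0 < h" "h < e" "h \<le> t - s" using e(1) t by (auto simp: h_def)
  have "F (t, p) \<le> F (t - h, p)" using x(2)[of "(t - h, p)"] h t tp by auto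
  with e(2)[OF h(1,2)] show False by (simp add: F_def)
qed

section \<open>Solutions of the flow\<close>

lemma open_time_interior: "open {t. 0 < t \<and> ereal t < \<tau>}"
proof -
  have "open {t::real. ereal t < \<tau>}" by (cases \<tau>) (auto simp: lessThan_def[symmetric])
  moreover have "{t. 0 < t \<and> ereal t < \<tau>} = {0<..} \<inter> {t. ereal t < \<tau>}" by auto
  ultimately show ?thesis by (simp add: open_Int)
qed

text \<open>Lowering the index undoes the contraction with the inverse metric in \<open>torsion\<close>.\<close>

lemma torsion_low_eq:
  assumes "hermitian_metric A h" "c \<in> A" "z \<in> chart_image c"
  shows "torsion_low h c i j l z = wirtinger i (metric_comp h c j l) z - wirtinger j (metric_comp h c i l) z"
proof -
  let ?X = "\<lambda>l. wirtinger i (metric_comp h c j l) z - wirtinger j (metric_comp h c i l) z"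
  have "torsion_low h c i j l z = (\<Sum>m\<in>UNIV. (\<Sum>k\<in>UNIV. inv_comp h c k m z * metric_comp h c k l z) * ?X m)"
    unfolding torsion_low_def torsion_def sum_distrib_right by (subst sum.swap) (simp add: mult_ac)
  then show ?thesis
    unfolding inv_comp_minv minv_left[OF metric_comp_pd[OF assms]] by (simp add: sum_delta_mult)
qed

context
  fixes A :: "('a::{t2_space, second_countable_topology}, 'n::finite) chart set"
    and \<tau> :: ereal and g :: "real \<Rightarrow> ('a, 'n) tensor2"
  assumes A: "complex_atlas A" and sol: "HCF_solution A \<tau> g"
begin

lemma hermitian_g: "t \<in> time_interval \<tau> \<Longrightarrow> hermitian_metric A (g t)"
  using sol unfolding HCF_solution_def smooth_metric_family_def by blast

lemma is_chart_A: "c \<in> A \<Longrightarrow> is_chart c"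
  using A unfolding complex_atlas_def by blast

definition flow_metric :: "('a, 'n) chart \<Rightarrow> 'n \<Rightarrow> 'n \<Rightarrow> real \<times> (complex^'n) \<Rightarrow> complex" where
  "flow_metric c i j x = metric_comp (g (fst x)) c i j (snd x)"

lemma smooth_flow_metric:
  assumes c: "c \<in> A"
  shows "smooth_on (time_interval \<tau> \<times> chart_image c) (flow_metric c i j)"
proof -
  have sm: "smooth_on (time_interval \<tau> \<times> chart_image c) (\<lambda>x. g (fst x) c (chart_inv c (snd x)) u v)" for u v
  proof -
    have "smooth_on (time_interval \<tau> \<times> chart_image c) (\<lambda>(t, z). g t c (chart_inv c z) u v)"
      using sol c unfolding HCF_solution_def smooth_metric_family_def by blast
    then show ?thesis by (simp only: case_prod_beta')
  qed
  show ?thesis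
    unfolding flow_metric_def[abs_def] metric_comp_def[abs_def] Let_def divide_inverse
    by (intro smooth_on_intros sm)
qed

lemma pd_flow_metric:
  assumes "c \<in> A" "x \<in> time_interval \<tau> \<times> chart_image c"
  shows "hermitian_pd (\<lambda>i j. flow_metric c i j x)"
  unfolding flow_metric_def using assms by (intro metric_comp_pd[OF hermitian_g assms(1)]) auto

text \<open>Continuity is local, and near a point the curvature may be computed in one fixed chart because of
  \<open>second_scalar_curvature_chart\<close>.\<close>

lemma continuous_scalar_curvature:
  "continuous_on (time_interval \<tau> \<times> UNIV) (\<lambda>x. second_scalar_curvature A (g (fst x)) (snd x))"
  unfolding continuous_on_eq_continuous_within
proof
  fix x assume x: "x \<in> time_interval \<tau> \<times> (UNIV :: 'a set)"
  obtain c where c: "c \<in> A" "snd x \<in> chart_dom c" using A unfolding complex_atlas_def by blast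
  note ic = is_chart_A[OF c(1), unfolded is_chart_def]
  let ?f = "\<lambda>x. second_scalar_curvature A (g (fst x)) (snd x)"
  have "continuous_on (time_interval \<tau> \<times> chart_image c) (\<lambda>x. scal (\<lambda>k l z. flow_metric c k l (fst x, z)) (snd x))"
    using ic by (intro continuous_on_slice_scal smooth_flow_metric pd_flow_metric c) auto
  moreover have "continuous_on (time_interval \<tau> \<times> chart_dom c) (\<lambda>y. (fst y, chart_coord c (snd y)))"
  proof -
    have "continuous_on (chart_dom c) (chart_coord c)" using ic homeomorphism_cont1 by blast
    then have "continuous_on (time_interval \<tau> \<times> chart_dom c) (\<lambda>y. chart_coord c (snd y))"
      by (rule continuous_on_compose2) (auto intro: continuous_intros)
    then show ?thesis by (intro continuous_intros)
  qed
  ultimately have "continuous_on (time_interval \<tau> \<times> chart_dom c) (\<lambda>y. scal (\<lambda>k l z. flow_metric c k l (fst (fst y, chart_coord c (snd y)), z)) (snd (fst y, chart_coord c (snd y))))"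
    by (rule continuous_on_compose2) auto
  then have "continuous_on (time_interval \<tau> \<times> chart_dom c) (\<lambda>y. Re (scal (\<lambda>k l z. flow_metric c k l (fst y, z)) (chart_coord c (snd y))))"
    by (auto intro: continuous_intros)
  then have "continuous_on (time_interval \<tau> \<times> chart_dom c) ?f"
    by (rule continuous_on_eq) (auto simp: second_scalar_curvature_chart[OF A hermitian_g c(1)] flow_metric_def[abs_def])
  then have "continuous (at x within time_interval \<tau> \<times> chart_dom c) ?f"
    using x c by (cases x) (simp add: continuous_on_eq_continuous_within)
  moreover have "at x within time_interval \<tau> \<times> chart_dom c = at x within time_interval \<tau> \<times> UNIV"
    by (rule at_within_nhd[of _ "UNIV \<times> chart_dom c"]) (use x c ic in \<open>auto simp: mem_Times_iff open_Times\<close>)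
  ultimately show "continuous (at x within time_interval \<tau> \<times> UNIV) ?f" by simp
qed

text \<open>In a chart around \<open>p\<close> the flow satisfies the assumptions of \<open>spacetime_HCF\<close>. A global minimum in space
  is a minimum in the chart, so that \<open>lap_nonneg_at_min\<close> and \<open>sc_supersolution\<close> apply.\<close>

lemma scalar_curvature_increases_at_min:
  assumes t: "0 < t" "ereal t < \<tau>"
    and min: "\<And>p'. second_scalar_curvature A (g t) p \<le> second_scalar_curvature A (g t) p'"
  shows "\<exists>d\<ge>0. ((\<lambda>r. second_scalar_curvature A (g r) p) has_real_derivative d) (at t)"
proof -
  obtain c where c: "c \<in> A" "p \<in> chart_dom c" using A unfolding complex_atlas_def by blast
  have V: "open (chart_image c)" using is_chart_A[OF c(1)] unfolding is_chart_def by blast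
  let ?I = "{t. 0 < t \<and> ereal t < \<tau>}"
  have sub: "?I \<times> chart_image c \<subseteq> time_interval \<tau> \<times> chart_image c" "?I \<subseteq> time_interval \<tau>"
    by (auto simp: time_interval_def)
  interpret spacetime_metric "?I \<times> chart_image c" "flow_metric c"
  proof
    show "open (?I \<times> chart_image c)" by (intro open_Times open_time_interior V)
    show "smooth_on (?I \<times> chart_image c) (flow_metric c i j)" for i j
      by (rule smooth_on_subset[OF smooth_flow_metric[OF c(1)] sub(1)])
    show "hermitian_pd (\<lambda>i j. flow_metric c i j x)" if "x \<in> ?I \<times> chart_image c" for x
      using pd_flow_metric[OF c(1)] that sub(1) by blast
  qed
  have G_slice: "metric_comp (g s) c = (\<lambda>k l z. flow_metric c k l (s, z))" for s
    by (simp add: flow_metric_def)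
  interpret spacetime_HCF "?I \<times> chart_image c" "flow_metric c"
  proof
    fix x i j assume "x \<in> ?I \<times> chart_image c"
    then obtain s z where x: "x = (s, z)" "s \<in> ?I" "z \<in> chart_image c" "(s, z) \<in> ?I \<times> chart_image c" by auto
    have s: "s \<in> time_interval \<tau>" using x sub by blast
    note h = hermitian_g[OF s]
    have inv: "inv_comp (g s) c i j z = H i j (s, z)" for i j
      by (simp add: inv_comp_minv H_def flow_metric_def)
    have S2: "S2_comp (g s) c i j z = S2 i j (s, z)"
      unfolding S2_comp_def S2_def chern_curv_curv G_slice slice_curvature(1)[OF x(4)] inv ..
    have tor: "torsion_low (g s) c i j l z = T i j l (s, z)" for i j l
      unfolding torsion_low_eq[OF h c(1) x(3)] G_slice slice_derivative(1)[OF x(4) smooth_G] T_def ..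
    have Q: "Q_comp (g s) c i j z = Q i j (s, z)"
      unfolding Q_comp_def Q_def inv tor ..
    have "((\<lambda>s. metric_comp (g s) c i j z) has_vector_derivative
           (- S2_comp (g s) c i j z - Q_comp (g s) c i j z)) (at s within time_interval \<tau>)"
      using sol s c(1) x(3) unfolding HCF_solution_def by blast
    then have "((\<lambda>s. flow_metric c i j (s, z)) has_vector_derivative (- S2 i j (s, z) - Q i j (s, z))) (at s within ?I)"
      unfolding S2 Q flow_metric_def[of c i j "(_, _)"] using sub(2) by (auto intro: has_vector_derivative_within_subset)
    then have "((\<lambda>s. flow_metric c i j (s, z)) has_vector_derivative (- S2 i j (s, z) - Q i j (s, z))) (at s)"
      using at_within_open[OF x(2) open_time_interior] by simp
    then show "dt (flow_metric c i j) x = - S2 i j x - Q i j x"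
      using vector_derivative_unique_at[OF has_vector_derivative_dt[OF x(4) smooth_G]] x(1) by blast
  qed
  define z where "z = chart_coord c p"
  have x: "(t, z) \<in> ?I \<times> chart_image c" using t c by (simp add: z_def)
  have f: "second_scalar_curvature A (g s) p' = Re (sc (s, chart_coord c p'))" if "s \<in> ?I" "p' \<in> chart_dom c" for s p'
  proof -
    have "s \<in> time_interval \<tau>" using that sub by blast
    moreover have "(s, chart_coord c p') \<in> ?I \<times> chart_image c" using that by auto
    ultimately show ?thesis
      using second_scalar_curvature_chart[OF A hermitian_g c(1) that(2)]
      unfolding G_slice by (simp add: slice_curvature(2))
  qed
  have "0 \<le> Re (lap sc (t, z))"
  proof (rule lap_nonneg_at_min[OF x smooth_sc])
    fix y assume "y \<in> ?I \<times> chart_image c" "fst y = fst (t, z)"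
    then obtain p' where "y = (t, chart_coord c p')" "p' \<in> chart_dom c" by auto
    then show "Re (sc (t, z)) \<le> Re (sc y)"
      using min[of p'] f[of t p] f[of t p'] t c unfolding z_def by simp
  qed
  also have "\<dots> \<le> Re (dt sc (t, z))" by (rule sc_supersolution[OF x])
  finally have "0 \<le> Re (dt sc (t, z))" .
  moreover have "((\<lambda>r. second_scalar_curvature A (g r) p) has_real_derivative Re (dt sc (t, z))) (at t)"
  proof -
    have "((\<lambda>r. Re (sc (r, z))) has_vector_derivative Re (dt sc (t, z))) (at t)"
      by (rule bounded_linear.has_vector_derivative[OF bounded_linear_Re has_vector_derivative_dt[OF x smooth_sc]])
    then have "((\<lambda>r. Re (sc (r, z))) has_real_derivative Re (dt sc (t, z))) (at t)"
      by (simp add: has_real_derivative_iff_has_vector_derivative)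
    then show ?thesis
      by (rule has_field_derivative_transform_within_open[OF _ open_time_interior])
         (use t f c in \<open>auto simp: z_def\<close>)
  qed
  ultimately show ?thesis by blast
qed

lemma scalar_curvature_bound_preserved:
  assumes comp: "compact (UNIV :: 'a set)" and st: "0 \<le> s" "s \<le> t" "ereal t < \<tau>"
    and q: "\<And>p. q \<le> second_scalar_curvature A (g s) p"
  shows "q \<le> second_scalar_curvature A (g t) p"
proof (rule minimum_principle[OF comp st(2), where f = "\<lambda>t. second_scalar_curvature A (g t)"])
  have I: "r \<in> time_interval \<tau>" if "r \<in> {s..t}" for r
    using that st ereal_less_eq(3)[of r t] le_less_trans[of "ereal r" "ereal t" \<tau>] by (simp add: time_interval_def)
  then show "continuous_on ({s..t} \<times> UNIV) (\<lambda>x. second_scalar_curvature A (g (fst x)) (snd x))"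
    by (intro continuous_on_subset[OF continuous_scalar_curvature]) auto
  fix r p assume r: "s < r" "r \<le> t"
    and min: "\<And>p'. second_scalar_curvature A (g r) p \<le> second_scalar_curvature A (g r) p'"
  show "\<exists>d\<ge>0. ((\<lambda>r. second_scalar_curvature A (g r) p) has_real_derivative d) (at r)"
    by (rule scalar_curvature_increases_at_min[OF _ _ min]) (use r st I[of r] in \<open>auto simp: time_interval_def\<close>)
qed (rule q)

lemma scalar_curvature_bdd_below:
  assumes comp: "compact (UNIV :: 'a set)" and s: "s \<in> time_interval \<tau>"
  shows "bdd_below (range (second_scalar_curvature A (g s)))"
proof -
  have "continuous_on UNIV (\<lambda>p. second_scalar_curvature A (g (fst (s, p))) (snd (s, p)))"
    by (rule continuous_on_compose2[OF continuous_scalar_curvature]) (use s in \<open>auto intro!: continuous_intros\<close>)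
  then have "compact (range (second_scalar_curvature A (g s)))"
    using compact_continuous_image comp by simp
  then show ?thesis by (intro bounded_imp_bdd_below compact_imp_bounded)
qed

end

theorem mainTheorem9:
  fixes A :: "('a::{t2_space, second_countable_topology}, 'n::finite) chart set"
    and \<tau> :: ereal
    and g :: "real \<Rightarrow> ('a, 'n) tensor2"
  assumes "compact (UNIV :: 'a set)"
    and "complex_atlas A"
    and "0 < \<tau>"
    and "HCF_solution A \<tau> g"
  shows "(\<forall>q::real. (\<forall>p. second_scalar_curvature A (g 0) p \<ge> q) \<longrightarrow>
            (\<forall>t. 0 < t \<and> ereal t < \<tau> \<longrightarrow> (\<forall>p. second_scalar_curvature A (g t) p \<ge> q)))
       \<and> mono_on (time_interval \<tau>) (\<lambda>t. INF p. second_scalar_curvature A (g t) p)"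
proof (intro conjI allI impI)
  note preserved = scalar_curvature_bound_preserved[OF assms(2,4,1)]
  show "q \<le> second_scalar_curvature A (g t) p"
    if "\<forall>p. q \<le> second_scalar_curvature A (g 0) p" "0 < t \<and> ereal t < \<tau>" for q t p
    using preserved[of 0 t q p] that by auto
  show "mono_on (time_interval \<tau>) (\<lambda>t. INF p. second_scalar_curvature A (g t) p)"
  proof (rule mono_onI)
    fix s t assume st: "s \<in> time_interval \<tau>" "t \<in> time_interval \<tau>" "s \<le> t"
    show "(INF p. second_scalar_curvature A (g s) p) \<le> (INF p. second_scalar_curvature A (g t) p)"
    proof (rule cINF_greatest)
      fix p
      show "(INF p. second_scalar_curvature A (g s) p) \<le> second_scalar_curvature A (g t) p"
        by (rule preserved[of s t])
          (use st in \<open>auto simp: time_interval_def intro: cINF_lower scalar_curvature_bdd_below[OF assms(2,4,1) st(1)]\<close>)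
    qed simp
  qed
qed

end
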